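(* Consider the evolution $\partial_t\rho=\mathbf{F}(\rho)$ for $\rho\in\mathcal{P}(\mathbb{R}^{2d})$ with $$\mathbf{F}(\rho)=-\operatorname{div}_q\Bigl(\rho\frac{p}{m}\Bigr)+\operatorname{div}_p\bigl(\rho\nabla_qV+\rho(\nabla_q\Phi*\rho)\bigr)+\mathcal{G}^*(\rho),$$ where $\mathcal{G}^*$ is the adjoint of one of the following operators: (Andersen thermostat) $\displaystyle \mathcal{G}f(q,p)=\gamma\int\bigl[f(q,p')-f(q,p)\bigr]\frac{1}{\sqrt{2\pi m}}e^{-\frac{(p')^2}{2m}}\,\mathrm{d}p'$; (Vlasov–Fokker–Planck) $\displaystyle \mathcal{G}f(q,p)=-\gamma\Bigl\langle\frac{p}{m},\nabla_pf(q,p)\Bigr\rangle+\gamma\Delta_pf(q,p)$. Let $$E(\rho)=\int\Bigl(\frac{p^2}{2m}+V(q)+\tfrac12(\Phi*\rho)(q)\Bigr)\rho(\mathrm{d}q,\mathrm{d}p),\qquad S(\rho)=\int\log\rho(q,p)\,\rho(\mathrm{d}q,\mathrm{d}p)+E(\rho),$$ and $L(\rho)\xi=\operatorname{div}(\rho J\nabla\xi)$ with $J=\begin{pmatrix}0&-\mathbf{1}_d\\ \mathbf{1}_d&0\end{pmatrix}$. Then the Andersen thermostat and the Vlasov–Fokker–Planck equation are pre-GENERIC with entropy $S$, vector field $W(\rho):=L(\rho)\,\mathrm{d}E(\rho)$, and dissipation potentials given respectively by $$\Psi^*(\rho,\xi)=\gamma\int\!\!\int\!\!\int\bigl[\cosh(\xi(q,p')-\xi(q,p))-1\bigr]\frac{1}{\sqrt{2\pi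 m}}e^{-\frac{p^2+(p')^2}{4m}}\sqrt{\rho(q,p')\rho(q,p)}\,\mathrm{d}p'\,\mathrm{d}p\,\mathrm{d}q,$$ $$\Psi^*(\rho,\xi)=\gamma\int|\nabla_p\xi(q,p)|^2\,\mathrm{d}\rho(q,p),$$ with $\Psi$ the Legendre transform of $\Psi^*$ in the second argument.
   Context: Points of $\mathbb{R}^{2d}$ are pairs $(q,p)$ with $q,p\in\mathbb{R}^d$; $\operatorname{div}_q,\operatorname{div}_p,\nabla_q,\nabla_p,\Delta_p$ act on the indicated variables, and $\nabla,\operatorname{div}$ without subscript on $(q,p)$. Constants $m>0$ (mass), $\gamma>0$. $V,\Phi:\mathbb{R}^d\to\mathbb{R}$ are two potentials growing sufficiently fast at infinity, $\Phi$ symmetric ($\Phi(q)=\Phi(-q)$). $(\Phi*\rho)(q)=\int\Phi(q-q')\rho(\mathrm{d}q',\mathrm{d}p')$, and similarly for $\nabla_q\Phi*\rho$. $\mathcal{G}^*(\rho)$ is defined by $\langle\eta,\mathcal{G}^*(\rho)\rangle=\int\mathcal{G}\eta\,\mathrm{d}\rho$. The setting is infinite-dimensional and formal: the state space is $\mathcal{P}(\mathbb{R}^{2d})$ (probability measures, identified with their densities $\rho(q,p)$ when these exist), tangent vectors at $\rho$ are distributions in $H^{-1}(\rho)$, cotangent vectors are functions $\xi(q,p)$, paired by integration $\langle\cdot,\cdot\rangle$. Differentials are functional derivatives: $\mathrm{d}E(\rho)(q,p)=\frac{p^2}{2m}+V(q)+(\Phi*\rho)(q)$ and $\mathrm{d}S(\rho)(q,p)=\log\rho(q,p)+1+\mathrm{d}E(\rho)(q,p)$.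 Identities are understood for densities and functions regular enough for the expressions to make sense and for integrations by parts without boundary terms. Legendre transform: $\Psi(\rho,v)=\sup_\xi\{\langle v,\xi\rangle-\Psi^*(\rho,\xi)\}$. Dissipation potentials (here): a Legendre dual pair $(\Psi,\Psi^* )$ of $[0,\infty]$-valued functions, convex in the second argument, with $\Psi(\rho,0)=\Psi^*(\rho,0)=0$; symmetric: even in the second argument. Pre-GENERIC: the equation $\partial_t\rho=\mathbf{F}(\rho)$ is pre-GENERIC with entropy $S$, vector field $W$ and dissipation potentials $(\Psi,\Psi^* )$ if $\Psi,\Psi^*$ are symmetric, $\langle W(\rho),\mathrm{d}S(\rho)\rangle=0$ for all $\rho$, and for all $\rho$ $$\Psi(\rho,\mathbf{F}(\rho)-W(\rho))+\Psi^*\bigl(\rho,-\tfrac12\mathrm{d}S(\rho)\bigr)+\tfrac12\langle\mathbf{F}(\rho),\mathrm{d}S(\rho)\rangle=0.$$ *)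

theory Defs
  imports "HOL-Probability.Probability_Measure"
begin

type_synonym 'd phase = "(real^'d) \<times> (real^'d)"
type_synonym 'd fn = "'d phase \<Rightarrow> real"

text \<open>
  A functional (in particular a tangent vector, i.e. a distribution) is given by its action on
  functions, so the duality pairing of \<open>v\<close> with \<open>\<xi>\<close> is the application \<open>v \<xi>\<close>.
  A state is identified with its density \<open>\<rho>\<close> with respect to Lebesgue measure.
\<close>
type_synonym 'd functional = "'d fn \<Rightarrow> real"


section \<open>Differential operators\<close>

definition grad :: "('a::euclidean_space \<Rightarrow> real) \<Rightarrow> 'a \<Rightarrow> 'a" where
  "grad f x = (THE D. GDERIV f x :> D)"

definition divergence :: "('a::euclidean_space \<Rightarrow> 'a) \<Rightarrow> 'a \<Rightarrow> real" where
  "divergence X x = (\<Sum>b\<in>Basis. frechet_derivative X (at x) b \<bullet> b)"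

definition grad_q :: "'d fn \<Rightarrow> 'd::finite phase \<Rightarrow> real^'d" where
  "grad_q f = (\<lambda>(q, p). grad (\<lambda>q'. f (q', p)) q)"

definition grad_p :: "'d fn \<Rightarrow> 'd::finite phase \<Rightarrow> real^'d" where
  "grad_p f = (\<lambda>(q, p). grad (\<lambda>p'. f (q, p')) p)"

definition laplacian_p :: "'d::finite fn \<Rightarrow> 'd fn" where
  "laplacian_p f = (\<lambda>(q, p). divergence (grad (\<lambda>p'. f (q, p'))) p)"

definition C1 :: "('a::euclidean_space \<Rightarrow> real) \<Rightarrow> bool" where
  "C1 f \<longleftrightarrow> (\<forall>x. f differentiable (at x)) \<and> continuous_on UNIV (grad f)"

text \<open>
  Distributional divergences: \<open>wdiv \<rho> X\<close> is the distribution
  \<open>div (\<rho> X)\<close>, and similarly in the \<open>q\<close> and in the \<open>p\<close> variable only.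
\<close>
definition wdiv :: "'d::finite fn \<Rightarrow> ('d phase \<Rightarrow> 'd phase) \<Rightarrow> 'd functional" where
  "wdiv \<rho> X = (\<lambda>\<eta>. - (LINT x|lborel. (X x \<bullet> grad \<eta> x) * \<rho> x))"

definition wdiv_q :: "'d::finite fn \<Rightarrow> ('d phase \<Rightarrow> real^'d) \<Rightarrow> 'd functional" where
  "wdiv_q \<rho> X = (\<lambda>\<eta>. - (LINT x|lborel. (X x \<bullet> grad_q \<eta> x) * \<rho> x))"

definition wdiv_p :: "'d::finite fn \<Rightarrow> ('d phase \<Rightarrow> real^'d) \<Rightarrow> 'd functional" where
  "wdiv_p \<rho> X = (\<lambda>\<eta>. - (LINT x|lborel. (X x \<bullet> grad_p \<eta> x) * \<rho> x))"

text \<open>Convolution of a (scalar or vector) kernel in \<open>q\<close> with \<open>\<rho>(dq', dp')\<close>.\<close>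
definition conv ::
  "(real^'d \<Rightarrow> 'b::{banach, second_countable_topology}) \<Rightarrow> 'd::finite fn \<Rightarrow> real^'d \<Rightarrow> 'b" where
  "conv K \<rho> q = (LINT x|lborel. \<rho> x *\<^sub>R K (q - fst x))"


section \<open>Energy, entropy and their differentials\<close>

definition energy_density ::
  "real \<Rightarrow> (real^'d \<Rightarrow> real) \<Rightarrow> (real^'d \<Rightarrow> real) \<Rightarrow> 'd::finite fn \<Rightarrow> 'd fn" where
  "energy_density m V \<Phi> \<rho> = (\<lambda>(q, p). (norm p)\<^sup>2 / (2 * m) + V q + conv \<Phi> \<rho> q / 2)"

definition energy ::
  "real \<Rightarrow> (real^'d \<Rightarrow> real) \<Rightarrow> (real^'d \<Rightarrow> real) \<Rightarrow> 'd::finite functional" where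
  "energy m V \<Phi> \<rho> = (LINT x|lborel. energy_density m V \<Phi> \<rho> x * \<rho> x)"

definition entropy ::
  "real \<Rightarrow> (real^'d \<Rightarrow> real) \<Rightarrow> (real^'d \<Rightarrow> real) \<Rightarrow> 'd::finite functional" where
  "entropy m V \<Phi> \<rho> = (LINT x|lborel. ln (\<rho> x) * \<rho> x) + energy m V \<Phi> \<rho>"

definition d_energy ::
  "real \<Rightarrow> (real^'d \<Rightarrow> real) \<Rightarrow> (real^'d \<Rightarrow> real) \<Rightarrow> 'd::finite fn \<Rightarrow> 'd fn" where
  "d_energy m V \<Phi> \<rho> = (\<lambda>(q, p). (norm p)\<^sup>2 / (2 * m) + V q + conv \<Phi> \<rho> q)"

definition d_entropy ::
  "real \<Rightarrow> (real^'d \<Rightarrow> real) \<Rightarrow> (real^'d \<Rightarrow> real) \<Rightarrow> 'd::finite fn \<Rightarrow> 'd fn" where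
  "d_entropy m V \<Phi> \<rho> = (\<lambda>x. ln (\<rho> x) + 1 + d_energy m V \<Phi> \<rho> x)"

text \<open>
  \<open>\<xi>\<close> is the functional derivative of \<open>S\<close> at \<open>\<rho>\<close>. The perturbations \<open>\<eta>\<close> need not have zero
  mass, so that additive constants in \<open>\<xi>\<close> (such as the \<open>1\<close> in \<open>d_entropy\<close>) are determined.
\<close>
definition has_functional_derivative :: "'d::finite functional \<Rightarrow> 'd fn \<Rightarrow> 'd fn \<Rightarrow> bool" where
  "has_functional_derivative S \<xi> \<rho> \<longleftrightarrow>
     (\<forall>\<eta>. continuous_on UNIV \<eta> \<and> (\<exists>K. compact K \<and> (\<forall>x. x \<notin> K \<longrightarrow> \<eta> x = 0)) \<longrightarrow>
        ((\<lambda>\<epsilon>. S (\<lambda>x. \<rho> x + \<epsilon> * \<eta> x)) has_real_derivative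
           (LINT x|lborel. \<xi> x * \<eta> x)) (at 0))"


section \<open>Cotangent and tangent vectors\<close>

definition H1_seminorm :: "'d::finite fn \<Rightarrow> 'd fn \<Rightarrow> real" where
  "H1_seminorm \<rho> \<xi> = sqrt (LINT x|lborel. (norm (grad \<xi> x))\<^sup>2 * \<rho> x)"

text \<open>
  Cotangent vectors at \<open>\<rho>\<close>: \<open>C\<^sup>1\<close> functions with \<open>\<nabla>\<xi> \<in> L\<^sup>2(\<rho>)\<close> on which, in addition, the
  generator of the evolution makes sense and is \<open>\<rho>\<close>-integrable; the latter condition is the
  parameter \<open>D\<close>.
\<close>
definition cotangent :: "('d::finite fn \<Rightarrow> 'd fn \<Rightarrow> bool) \<Rightarrow> 'd fn \<Rightarrow> 'd fn set" where
  "cotangent D \<rho> = {\<xi>. C1 \<xi> \<and> integrable lborel (\<lambda>x. (norm (grad \<xi> x))\<^sup>2 * \<rho> x) \<and> D \<rho> \<xi>}"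

text \<open>
  Tangent vectors at \<open>\<rho>\<close>: the elements of \<open>H\<^sup>-\<^sup>1(\<rho>)\<close>, that is, linear functionals on the
  cotangent vectors \<open>C\<close> that are bounded with respect to the norm of \<open>\<nabla>\<xi>\<close> in \<open>L\<^sup>2(\<rho>)\<close>.
  Values outside \<open>C\<close> are irrelevant.
\<close>
definition tangent :: "'d::finite fn set \<Rightarrow> 'd fn \<Rightarrow> 'd functional set" where
  "tangent C \<rho> = {v.
     (\<forall>\<xi>\<in>C. \<forall>\<eta>\<in>C. \<forall>a b. v (\<lambda>x. a * \<xi> x + b * \<eta> x) = a * v \<xi> + b * v \<eta>) \<and>
     (\<exists>c. \<forall>\<xi>\<in>C. \<bar>v \<xi>\<bar> \<le> c * H1_seminorm \<rho> \<xi>)}"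


section \<open>Pre-GENERIC equations\<close>

definition legendre ::
  "('d::finite fn \<Rightarrow> 'd fn set) \<Rightarrow> ('d fn \<Rightarrow> 'd fn \<Rightarrow> ereal) \<Rightarrow>
    'd fn \<Rightarrow> 'd functional \<Rightarrow> ereal" where
  "legendre C \<Psi>s \<rho> v = (SUP \<xi>\<in>C \<rho>. ereal (v \<xi>) - \<Psi>s \<rho> \<xi>)"

text \<open>
  In what follows \<open>M\<close> is the set of states and \<open>C \<rho>\<close> the set of cotangent vectors at \<open>\<rho>\<close>;
  \<open>\<Psi>s\<close> stands for \<open>\<Psi>\<^sup>*\<close>. Duality is required in both directions.
\<close>
definition dissipation_potentials ::
  "'d::finite fn set \<Rightarrow> ('d fn \<Rightarrow> 'd fn set) \<Rightarrow>
    ('d fn \<Rightarrow> 'd functional \<Rightarrow> ereal) \<Rightarrow> ('d fn \<Rightarrow> 'd fn \<Rightarrow> ereal) \<Rightarrow> bool" where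
  "dissipation_potentials M C \<Psi> \<Psi>s \<longleftrightarrow> (\<forall>\<rho>\<in>M. let T = tangent (C \<rho>) \<rho> in
     (\<forall>v\<in>T. \<Psi> \<rho> v = (SUP \<xi>\<in>C \<rho>. ereal (v \<xi>) - \<Psi>s \<rho> \<xi>)) \<and>
     (\<forall>\<xi>\<in>C \<rho>. \<Psi>s \<rho> \<xi> = (SUP v\<in>T. ereal (v \<xi>) - \<Psi> \<rho> v)) \<and>
     (\<forall>v\<in>T. 0 \<le> \<Psi> \<rho> v) \<and> (\<forall>\<xi>\<in>C \<rho>. 0 \<le> \<Psi>s \<rho> \<xi>) \<and>
     (\<forall>u\<in>T. \<forall>v\<in>T. \<forall>t\<in>{0..1}.
        \<Psi> \<rho> (\<lambda>\<xi>. (1 - t) * u \<xi> + t * v \<xi>) \<le> ereal (1 - t) * \<Psi> \<rho> u + ereal t * \<Psi> \<rho> v) \<and>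
     (\<forall>\<xi>\<in>C \<rho>. \<forall>\<eta>\<in>C \<rho>. \<forall>t\<in>{0..1}.
        \<Psi>s \<rho> (\<lambda>x. (1 - t) * \<xi> x + t * \<eta> x) \<le> ereal (1 - t) * \<Psi>s \<rho> \<xi> + ereal t * \<Psi>s \<rho> \<eta>) \<and>
     \<Psi> \<rho> (\<lambda>_. 0) = 0 \<and> \<Psi>s \<rho> (\<lambda>_. 0) = 0)"

definition symmetric_potentials ::
  "'d::finite fn set \<Rightarrow> ('d fn \<Rightarrow> 'd fn set) \<Rightarrow>
    ('d fn \<Rightarrow> 'd functional \<Rightarrow> ereal) \<Rightarrow> ('d fn \<Rightarrow> 'd fn \<Rightarrow> ereal) \<Rightarrow> bool" where
  "symmetric_potentials M C \<Psi> \<Psi>s \<longleftrightarrow> (\<forall>\<rho>\<in>M.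
     (\<forall>v\<in>tangent (C \<rho>) \<rho>. \<Psi> \<rho> (\<lambda>\<xi>. - v \<xi>) = \<Psi> \<rho> v) \<and>
     (\<forall>\<xi>\<in>C \<rho>. \<Psi>s \<rho> (\<lambda>x. - \<xi> x) = \<Psi>s \<rho> \<xi>))"

text \<open>
  The equation \<open>\<partial>\<^sub>t \<rho> = F \<rho>\<close> is pre-GENERIC with entropy \<open>S\<close> (whose differential is \<open>dS\<close>),
  vector field \<open>W\<close> and dissipation potentials \<open>(\<Psi>, \<Psi>\<^sup>*)\<close>.
\<close>
definition pre_GENERIC ::
  "'d::finite fn set \<Rightarrow> ('d fn \<Rightarrow> 'd fn set) \<Rightarrow> ('d fn \<Rightarrow> 'd functional) \<Rightarrow>
    'd functional \<Rightarrow> ('d fn \<Rightarrow> 'd fn) \<Rightarrow> ('d fn \<Rightarrow> 'd functional) \<Rightarrow>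
    ('d fn \<Rightarrow> 'd functional \<Rightarrow> ereal) \<Rightarrow> ('d fn \<Rightarrow> 'd fn \<Rightarrow> ereal) \<Rightarrow> bool" where
  "pre_GENERIC M C F S dS W \<Psi> \<Psi>s \<longleftrightarrow>
     dissipation_potentials M C \<Psi> \<Psi>s \<and>
     symmetric_potentials M C \<Psi> \<Psi>s \<and>
     (\<forall>\<rho>\<in>M.
        has_functional_derivative S (dS \<rho>) \<rho> \<and> dS \<rho> \<in> C \<rho> \<and>
        F \<rho> \<in> tangent (C \<rho>) \<rho> \<and> W \<rho> \<in> tangent (C \<rho>) \<rho> \<and>
        W \<rho> (dS \<rho>) = 0 \<and>
        \<Psi> \<rho> (\<lambda>\<xi>. F \<rho> \<xi> - W \<rho> \<xi>) + \<Psi>s \<rho> (\<lambda>x. - (1/2) * dS \<rho> x) + ereal (1/2 * F \<rho> (dS \<rho>)) = 0)"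


section \<open>The two evolutions\<close>

text \<open>
  The prefactor does not depend on the dimension, so for \<open>d > 1\<close> the Gaussian is not
  normalised (the total jump rate then differs from \<open>\<gamma>\<close>).
\<close>
definition maxwell :: "real \<Rightarrow> real^'d::finite \<Rightarrow> real" where
  "maxwell m p = 1 / sqrt (2 * pi * m) * exp (- ((norm p)\<^sup>2 / (2 * m)))"

definition andersen_gen :: "real \<Rightarrow> real \<Rightarrow> 'd::finite fn \<Rightarrow> 'd fn" where
  "andersen_gen m \<gamma> f = (\<lambda>(q, p). \<gamma> * (LINT p'|lborel. (f (q, p') - f (q, p)) * maxwell m p'))"

definition vfp_gen :: "real \<Rightarrow> real \<Rightarrow> 'd::finite fn \<Rightarrow> 'd fn" where
  "vfp_gen m \<gamma> f = (\<lambda>(q, p). - \<gamma> * ((p /\<^sub>R m) \<bullet> grad_p f (q, p)) + \<gamma> * laplacian_p f (q, p))"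

definition andersen_dom :: "real \<Rightarrow> 'd::finite fn \<Rightarrow> 'd fn \<Rightarrow> bool" where
  "andersen_dom m \<rho> f \<longleftrightarrow>
     integrable lborel (\<lambda>((q, p), p'). (f (q, p') - f (q, p)) * maxwell m p' * \<rho> (q, p))"

definition vfp_dom :: "real \<Rightarrow> real \<Rightarrow> 'd::finite fn \<Rightarrow> 'd fn \<Rightarrow> bool" where
  "vfp_dom m \<gamma> \<rho> f \<longleftrightarrow>
     (\<forall>b\<in>Basis. C1 (\<lambda>x. grad_p f x \<bullet> b)) \<and> integrable lborel (\<lambda>x. vfp_gen m \<gamma> f x * \<rho> x)"

definition adjoint_gen :: "('d::finite fn \<Rightarrow> 'd fn) \<Rightarrow> 'd fn \<Rightarrow> 'd functional" where
  "adjoint_gen G \<rho> = (\<lambda>\<eta>. LINT x|lborel. G \<eta> x * \<rho> x)"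

definition evolution ::
  "('d::finite fn \<Rightarrow> 'd fn) \<Rightarrow> real \<Rightarrow> (real^'d \<Rightarrow> real) \<Rightarrow> (real^'d \<Rightarrow> real) \<Rightarrow>
    'd fn \<Rightarrow> 'd functional" where
  "evolution G m V \<Phi> \<rho> = (\<lambda>\<eta>.
     - wdiv_q \<rho> (\<lambda>(q, p). p /\<^sub>R m) \<eta>
     + wdiv_p \<rho> (\<lambda>(q, p). grad V q + conv (grad \<Phi>) \<rho> q) \<eta>
     + adjoint_gen G \<rho> \<eta>)"

definition J :: "'d::finite phase \<Rightarrow> 'd phase" where
  "J = (\<lambda>(a, b). (- b, a))"

definition L :: "'d::finite fn \<Rightarrow> 'd fn \<Rightarrow> 'd functional" where
  "L \<rho> \<xi> = wdiv \<rho> (\<lambda>x. J (grad \<xi> x))"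

definition andersen_Psi_star :: "real \<Rightarrow> real \<Rightarrow> 'd::finite fn \<Rightarrow> 'd fn \<Rightarrow> ereal" where
  "andersen_Psi_star m \<gamma> \<rho> \<xi> = enn2ereal (ennreal \<gamma> *
     (\<integral>\<^sup>+q. \<integral>\<^sup>+p. \<integral>\<^sup>+p'. ennreal ((cosh (\<xi> (q, p') - \<xi> (q, p)) - 1) * (1 / sqrt (2 * pi * m))
        * exp (- (((norm p)\<^sup>2 + (norm p')\<^sup>2) / (4 * m))) * sqrt (\<rho> (q, p') * \<rho> (q, p)))
      \<partial>lborel \<partial>lborel \<partial>lborel))"

definition vfp_Psi_star :: "real \<Rightarrow> 'd::finite fn \<Rightarrow> 'd fn \<Rightarrow> ereal" where
  "vfp_Psi_star \<gamma> \<rho> \<xi> =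
     enn2ereal (ennreal \<gamma> * (\<integral>\<^sup>+x. ennreal ((norm (grad_p \<xi> x))\<^sup>2 * \<rho> x) \<partial>lborel))"


section \<open>Regular states\<close>

text \<open>
  Probability densities regular enough for the expressions to make sense: energy and entropy
  are finite, \<open>\<Phi> * \<rho>\<close> is defined and may be differentiated under the integral sign,
  \<open>dE(\<rho>)\<close> and \<open>dS(\<rho>)\<close> are cotangent vectors and \<open>G\<^sup>*(\<rho>)\<close> is a tangent vector.
  The integrability conditions also take the role of sufficient growth of \<open>V\<close> and \<open>\<Phi>\<close>.
\<close>
definition regular_states ::
  "('d::finite fn \<Rightarrow> 'd fn) \<Rightarrow> ('d fn \<Rightarrow> 'd fn \<Rightarrow> bool) \<Rightarrow>
    real \<Rightarrow> (real^'d \<Rightarrow> real) \<Rightarrow> (real^'d \<Rightarrow> real) \<Rightarrow> 'd fn set" where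
  "regular_states G D m V \<Phi> = {\<rho>.
     (\<forall>x. 0 < \<rho> x) \<and> C1 \<rho> \<and> prob_space (density lborel (\<lambda>x. ennreal (\<rho> x))) \<and>
     (\<forall>q. integrable lborel (\<lambda>x. \<Phi> (q - fst x) * \<rho> x)) \<and>
     (\<forall>K. compact K \<longrightarrow> (\<exists>g. integrable lborel (\<lambda>x. g x * \<rho> x) \<and>
        (\<forall>q\<in>K. \<forall>x. norm (grad \<Phi> (q - fst x)) \<le> g x))) \<and>
     integrable lborel (\<lambda>x. energy_density m V \<Phi> \<rho> x * \<rho> x) \<and>
     integrable lborel (\<lambda>x. ln (\<rho> x) * \<rho> x) \<and>
     d_energy m V \<Phi> \<rho> \<in> cotangent D \<rho> \<and>
     d_entropy m V \<Phi> \<rho> \<in> cotangent D \<rho> \<and>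
     adjoint_gen G \<rho> \<in> tangent (cotangent D \<rho>) \<rho>}"

end

theory Submission
  imports Defs
begin

text \<open>
  On cotangent vectors \<open>F = W + G\<^sup>*\<close>, so the balance involves only the linear functional
  \<open>v = G\<^sup>*(\<rho>)\<close>, and it holds as soon as \<open>\<xi> = - dS/2\<close> maximises \<open>v \<xi> - \<Psi>\<^sup>*(\<xi>)\<close>.

  For Vlasov--Fokker--Planck, integration by parts gives \<open>v \<xi> = - \<gamma> \<integral> \<nabla>\<^sub>p dS \<cdot> \<nabla>\<^sub>p \<xi> d\<rho>\<close>, and one
  completes a square. For the Andersen thermostat, symmetrising in \<open>p, p'\<close> gives
  \<open>v \<xi> = \<integral> w sinh(\<delta>a) \<delta>\<xi>\<close> with \<open>\<delta>\<xi> = \<xi>(q, p') - \<xi>(q, p)\<close>, \<open>a = - dS/2\<close> and \<open>w\<close> the weight in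
  \<open>\<Psi>\<^sup>*\<close>, so that the tangent line inequality of \<open>cosh\<close> applies. The same two convexity arguments
  give biduality; for the Andersen thermostat the optimal flux is truncated to compact sets, where
  it lies in \<open>H\<^sup>-\<^sup>1(\<rho>)\<close> because \<open>\<delta>\<xi>\<close> is an integral of \<open>\<nabla>\<^sub>p \<xi>\<close> along a segment.

  No boundary terms occur in the integrations by parts: all fields involved are \<open>\<rho>\<close>-integrable
  together with their divergences. In \<open>W(dS) = 0\<close> this can even be used componentwise, as the
  components of the Hamiltonian field do not depend on the variable they differentiate.
\<close>

subsection \<open>Gradients\<close>

text \<open>The factor 1/2 is forced: the derivative of the dual potential at \<open>- dS/2\<close>
  has to be \<open>adjoint_gen G \<rho>\<close>. For the quadratic potential it cancels the 2 from
  differentiating a square. For the thermostat the weight is the geometric mean of the jump rate and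
  the rate of the reversed jump, and the jump of \<open>- dS/2\<close> is half the logarithm of
  their ratio; hence the square root and the 4m in the potential. The obstacles come from how little
  a state provides. Regularity is known for \<open>dE\<close> as a whole only, so the derivative of
  \<open>conv \<Phi> \<rho>\<close> is identified along lines. In the Hamiltonian part every
  component is integrable by itself, and Fubini with translation invariance suffices. In the
  Fokker-Planck part only the full divergence is known to be integrable, which forces cutoff
  functions. Cotangent spaces are shown to be closed under scaling, while sums are handled in the
  larger space \<open>H1\<close>, where the bounds are proved. The thermostat potential is not known
  to be finite on all cotangent vectors, so biduality comes from monotone convergence in the
  extended reals.\<close>

lemma grad_eqI:
  assumes "(f has_derivative (\<lambda>h. h \<bullet> D)) (at x)"
  shows "grad f x = D"
  unfolding grad_def gderiv_def
proof (rule the_equality)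
  fix D' assume "(f has_derivative (\<lambda>h. h \<bullet> D')) (at x)"
  then have "(\<lambda>h. h \<bullet> D') = (\<lambda>h. h \<bullet> D)"
    using assms by (rule has_derivative_unique)
  then have "(D' - D) \<bullet> D' = (D' - D) \<bullet> D" by (rule fun_cong)
  then have "(D' - D) \<bullet> (D' - D) = 0" by (simp only: inner_diff_right)
  then show "D' = D" by simp
qed (fact assms)

lemma has_derivative_grad:
  assumes "f differentiable (at x)"
  shows "(f has_derivative (\<lambda>h. h \<bullet> grad f x)) (at x)"
proof -
  obtain f' where f': "(f has_derivative f') (at x)"
    using assms unfolding differentiable_def by blast
  \<comment> \<open>The Riesz vector of the linear functional \<open>f'\<close>, assembled from its
    values on the basis.\<close>
  define D where "D = (\<Sum>b\<in>Basis. f' b *\<^sub>R b)"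
  have lin: "linear f'" using f' has_derivative_linear by blast
  have "f' h = h \<bullet> D" for h
  proof -
    have "f' h = f' (\<Sum>b\<in>Basis. (h \<bullet> b) *\<^sub>R b)" by (simp add: euclidean_representation)
    also have "\<dots> = (\<Sum>b\<in>Basis. (h \<bullet> b) * f' b)"
      by (simp add: linear_sum[OF lin] linear_cmul[OF lin])
    also have "\<dots> = h \<bullet> D" by (simp add: D_def inner_sum_right mult.commute)
    finally show ?thesis .
  qed
  then have "(f has_derivative (\<lambda>h. h \<bullet> D)) (at x)" using f' by presburger
  then show ?thesis using grad_eqI by metis
qed

lemma C1_has_derivative: "C1 f \<Longrightarrow> (f has_derivative (\<lambda>h. h \<bullet> grad f x)) (at x)"
  by (simp add: C1_def has_derivative_grad)

lemma C1_continuous: "C1 f \<Longrightarrow> continuous_on UNIV f"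
  unfolding C1_def by (meson continuous_at_imp_continuous_on differentiable_imp_continuous_within)

lemma C1_continuous_compose:
  "C1 f \<Longrightarrow> continuous_on S g \<Longrightarrow> continuous_on S (\<lambda>x. f (g x))"
  using C1_continuous continuous_on_compose2 by blast

lemma C1_grad_continuous_compose:
  "C1 f \<Longrightarrow> continuous_on S g \<Longrightarrow> continuous_on S (\<lambda>x. grad f (g x))"
  unfolding C1_def using continuous_on_compose2 by blast

lemma C1_borel: "C1 f \<Longrightarrow> f \<in> borel_measurable borel"
  by (simp add: C1_continuous borel_measurable_continuous_onI)

lemma C1_grad_borel: "C1 f \<Longrightarrow> grad f \<in> borel_measurable borel"
  by (simp add: C1_def borel_measurable_continuous_onI)

lemma C1I:
  assumes "\<And>x. (f has_derivative (\<lambda>h. h \<bullet> D x)) (at x)" "continuous_on UNIV D"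
  shows "C1 f" "grad f = D"
proof -
  show "grad f = D" using assms(1) grad_eqI by blast
  then show "C1 f" using assms unfolding C1_def differentiable_def by blast
qed

lemma grad_lincomb:
  assumes "f differentiable (at x)" "g differentiable (at x)"
  shows "grad (\<lambda>x. a * f x + b * g x) x = a *\<^sub>R grad f x + b *\<^sub>R grad g x"
  by (rule grad_eqI)
     (auto intro!: derivative_eq_intros has_derivative_grad assms simp: inner_add_right)

lemma C1_lincomb: "C1 f \<Longrightarrow> C1 g \<Longrightarrow> C1 (\<lambda>x. a * f x + b * g x)"
  by (rule C1I[where D="\<lambda>x. a *\<^sub>R grad f x + b *\<^sub>R grad g x"])
     (auto intro!: derivative_eq_intros continuous_intros C1_has_derivative C1_grad_continuous_compose
       simp: inner_add_right)

lemma C1_grad_lincomb: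
  assumes "C1 f" "C1 g"
  shows "grad (\<lambda>x. a * f x + b * g x) = (\<lambda>x. a *\<^sub>R grad f x + b *\<^sub>R grad g x)"
  using assms unfolding C1_def by (intro ext grad_lincomb) auto

lemma C1_const: "C1 (\<lambda>x. c)"
  by (rule C1I[where D="\<lambda>x. 0"]) auto

lemma grad_const: "grad (\<lambda>x. c) = (\<lambda>x. 0)"
  by (rule C1I) auto

lemma C1_DERIV_line:
  assumes "C1 f"
  shows "((\<lambda>t. f (x + t *\<^sub>R e)) has_real_derivative (e \<bullet> grad f (x + t *\<^sub>R e))) (at t within S)"
  unfolding has_field_derivative_def
  by (rule has_derivative_compose[where g=f, THEN has_derivative_eq_rhs])
     (auto intro!: derivative_eq_intros C1_has_derivative assms)

lemma grad_q_eq: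
  assumes "C1 f" shows "grad_q f x = fst (grad f x)"
proof -
  obtain q p where x: "x = (q, p)" by force
  have "((\<lambda>q'. f (q', p)) has_derivative (\<lambda>h. h \<bullet> fst (grad f (q, p)))) (at q)"
    by (rule has_derivative_compose[where g=f, THEN has_derivative_eq_rhs])
       (auto intro!: derivative_eq_intros C1_has_derivative assms simp: inner_prod_def)
  then show ?thesis using grad_eqI by (simp add: x grad_q_def)
qed

lemma grad_p_eq:
  assumes "C1 f" shows "grad_p f x = snd (grad f x)"
proof -
  obtain q p where x: "x = (q, p)" by force
  have "((\<lambda>p'. f (q, p')) has_derivative (\<lambda>h. h \<bullet> snd (grad f (q, p)))) (at p)"
    by (rule has_derivative_compose[where g=f, THEN has_derivative_eq_rhs])
       (auto intro!: derivative_eq_intros C1_has_derivative assms simp: inner_prod_def)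
  then show ?thesis using grad_eqI by (simp add: x grad_p_def)
qed

subsection \<open>Integration over Euclidean space\<close>

lemma integrable_lborel_translate:
  fixes f :: "'a::euclidean_space \<Rightarrow> 'b::{banach, second_countable_topology}"
  assumes "integrable lborel f"
  shows "integrable lborel (\<lambda>x. f (x + e))"
    and "(LINT x|lborel. f (x + e)) = (LINT x|lborel. f x)"
proof -
  have f: "f \<in> borel_measurable borel" using assms by auto
  have *: "integrable (distr lborel borel ((+) e)) f"
    using assms lborel_distr_plus[of e] by simp
  then show "integrable lborel (\<lambda>x. f (x + e))"
    using f by (subst (asm) integrable_distr_eq) (auto simp: add.commute)
  have "(LINT x|lborel. f x) = (LINT x|distr lborel borel ((+) e). f x)"
    using lborel_distr_plus[of e] by simp
  also have "\<dots> = (LINT x|lborel. f (x + e))"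
    using f by (subst integral_distr) (auto simp: add.commute)
  finally show "(LINT x|lborel. f (x + e)) = (LINT x|lborel. f x)" by simp
qed

text \<open>By translation invariance the integral of \<open>f'\<close> equals its average over the
  shifts by \<open>t *\<^sub>R e\<close> with t in the unit interval. Fubini and the fundamental
  theorem turn this average into the integral of \<open>f (x + e) - f x\<close>, which is 0.
  Integrability thus replaces any decay condition at infinity.\<close>

lemma integral_directional_derivative_eq_0:
  fixes f f' :: "'a::euclidean_space \<Rightarrow> real"
  assumes f: "integrable lborel f" and f': "integrable lborel f'"
    and deriv: "\<And>x. ((\<lambda>t. f (x + t *\<^sub>R e)) has_real_derivative f' x) (at 0)"
    and cont: "\<And>x. continuous_on UNIV (\<lambda>t. f' (x + t *\<^sub>R e))"
  shows "(LINT x|lborel. f' x) = 0"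
proof -
  let ?I = "indicator {0..1::real} :: real \<Rightarrow> real"
  let ?h = "\<lambda>(t, x). ?I t *\<^sub>R f' (x + t *\<^sub>R e)"
  have [measurable]: "f' \<in> borel_measurable borel" using f' by auto
  have D: "((\<lambda>t. f (x + t *\<^sub>R e)) has_real_derivative f' (x + t *\<^sub>R e)) (at t)" for x t
    using deriv[of "x + t *\<^sub>R e"] DERIV_shift[of "\<lambda>t. f (x + t *\<^sub>R e)" _ 0 t]
    by (simp add: algebra_simps)
  have FTC: "(LINT t|lborel. ?I t *\<^sub>R f' (x + t *\<^sub>R e)) = f (x + e) - f x" for x
  proof -
    have "(LINT t|lborel. ?I t *\<^sub>R f' (x + t *\<^sub>R e)) = f (x + 1 *\<^sub>R e) - f (x + 0 *\<^sub>R e)"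
      by (rule integral_FTC_atLeastAtMost)
         (auto intro!: D DERIV_subset[OF D] continuous_on_subset[OF cont]
           simp: has_real_derivative_iff_has_vector_derivative[symmetric])
    then show ?thesis by simp
  qed
  have int: "integrable (lborel \<Otimes>\<^sub>M lborel) ?h"
  proof (rule lborel_pair.Fubini_integrable)
    show "?h \<in> borel_measurable (lborel \<Otimes>\<^sub>M lborel)" by measurable
    show "AE t in lborel. integrable lborel (\<lambda>x. ?h (t, x))"
      using integrable_lborel_translate(1)[OF f'] by simp
    have "(LINT x|lborel. norm (?h (t, x))) = ?I t * (LINT x|lborel. norm (f' x))" for t
      using integrable_lborel_translate(2)[OF integrable_norm[OF f'], of "t *\<^sub>R e"] 
      by (simp add: abs_mult)
    then show "integrable lborel (\<lambda>t. LINT x|lborel. norm (?h (t, x)))"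
      by simp
  qed
  have "(LINT x|lborel. f' x) = (LINT t|lborel. ?I t * (LINT x|lborel. f' x))"
    by simp
  also have "\<dots> = (LINT t|lborel. LINT x|lborel. ?h (t, x))"
    using integrable_lborel_translate(2)[OF f'] by simp
  also have "\<dots> = (LINT x|lborel. LINT t|lborel. ?h (t, x))"
    using lborel_pair.Fubini_integral[of "\<lambda>t x. ?h (t, x)"] int by simp
  also have "\<dots> = (LINT x|lborel. f (x + e) - f x)"
    using FTC by simp
  also have "\<dots> = 0"
    using f integrable_lborel_translate[OF f] by simp
  finally show ?thesis .
qed

lemma integrable_continuous_compact_support:
  fixes f :: "'a::euclidean_space \<Rightarrow> 'b::{banach, second_countable_topology}"
  assumes "continuous_on UNIV f" "compact K" "\<And>x. x \<notin> K \<Longrightarrow> f x = 0"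
  shows "integrable lborel f"
proof -
  have "integrable lborel (\<lambda>x. indicator K x *\<^sub>R f x)"
    using assms by (intro borel_integrable_compact) (auto intro: continuous_on_subset)
  moreover have "(\<lambda>x. indicator K x *\<^sub>R f x) = f"
    using assms(3) by (auto simp: indicator_def)
  ultimately show ?thesis by simp
qed

text \<open>Derived from positivity of the quadratic form \<open>quad\<close>, with constants
  already in the shape of \<open>H1_seminorm\<close>; the integrability of the mixed products is
  delivered along with the bound.\<close>

lemma weighted_Cauchy_Schwarz:
  fixes X Y :: "'a::euclidean_space \<Rightarrow> 'b::euclidean_space"
  assumes meas [measurable]: "X \<in> borel_measurable borel" "Y \<in> borel_measurable borel"
      "\<rho> \<in> borel_measurable borel"
    and nonneg: "\<And>x. 0 \<le> \<rho> x"
    and X: "integrable lborel (\<lambda>x. (norm (X x))\<^sup>2 * \<rho> x)"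
    and Y: "integrable lborel (\<lambda>x. (norm (Y x))\<^sup>2 * \<rho> x)"
  shows "integrable lborel (\<lambda>x. norm (X x) * norm (Y x) * \<rho> x)"
    and "integrable lborel (\<lambda>x. (X x \<bullet> Y x) * \<rho> x)"
    and "\<bar>LINT x|lborel. (X x \<bullet> Y x) * \<rho> x\<bar> \<le>
      sqrt (LINT x|lborel. (norm (X x))\<^sup>2 * \<rho> x) * sqrt (LINT x|lborel. (norm (Y x))\<^sup>2 * \<rho> x)"
proof -
  have "2 * (norm (X x) * norm (Y x)) \<le> (norm (X x))\<^sup>2 + (norm (Y x))\<^sup>2" for x
    using sum_squares_bound[of "norm (X x)" "norm (Y x)"] by simp
  then have bound: "norm (X x) * norm (Y x) * \<rho> x \<le> (norm (X x))\<^sup>2 * \<rho> x + (norm (Y x))\<^sup>2 * \<rho> x" for x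
    using mult_right_mono[of "norm (X x) * norm (Y x)" "(norm (X x))\<^sup>2 + (norm (Y x))\<^sup>2" "\<rho> x"] nonneg[of x]
    by (smt (verit) distrib_right mult_nonneg_nonneg norm_ge_zero)
  show 1: "integrable lborel (\<lambda>x. norm (X x) * norm (Y x) * \<rho> x)"
    by (rule Bochner_Integration.integrable_bound[OF Bochner_Integration.integrable_add[OF X Y]])
       (auto simp: nonneg intro!: order_trans[OF bound])
  show 2: "integrable lborel (\<lambda>x. (X x \<bullet> Y x) * \<rho> x)"
    by (rule Bochner_Integration.integrable_bound[OF 1])
       (auto simp: nonneg abs_mult Cauchy_Schwarz_ineq2 intro!: mult_right_mono)
  let ?A = "LINT x|lborel. (norm (X x))\<^sup>2 * \<rho> x" and ?B = "LINT x|lborel. (X x \<bullet> Y x) * \<rho> x"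
    and ?C = "LINT x|lborel. (norm (Y x))\<^sup>2 * \<rho> x"
  have AC: "0 \<le> ?A" "0 \<le> ?C" using nonneg by auto
  have quad: "0 \<le> s\<^sup>2 * ?A - 2 * s * t * ?B + t\<^sup>2 * ?C" for s t
  proof -
    have "(norm (s *\<^sub>R X x - t *\<^sub>R Y x))\<^sup>2 * \<rho> x =
        s\<^sup>2 * ((norm (X x))\<^sup>2 * \<rho> x) - 2 * s * t * ((X x \<bullet> Y x) * \<rho> x) + t\<^sup>2 * ((norm (Y x))\<^sup>2 * \<rho> x)" for x
      unfolding power2_norm_eq_inner
      by (simp add: inner_diff inner_commute algebra_simps power2_eq_square)
    moreover have "0 \<le> (LINT x|lborel. (norm (s *\<^sub>R X x - t *\<^sub>R Y x))\<^sup>2 * \<rho> x)"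
      using nonneg by auto
    ultimately show ?thesis using X Y 2 by simp
  qed
  \<comment> \<open>If \<open>?C = 0\<close>, the form is affine in t, and for
    \<open>?B \<noteq> 0\<close> the values \<open>s = 1\<close>,
    \<open>t = (?A + 1) / (2 * ?B)\<close> would make it -1. Otherwise \<open>s = ?C\<close>,
    \<open>t = ?B\<close> yields \<open>?C\<close> times the difference of the two sides.\<close>
  have "?B\<^sup>2 \<le> ?A * ?C"
  proof (cases "?C = 0")
    case True
    have "?B = 0"
    proof (rule ccontr)
      assume "?B \<noteq> 0"
      then have "2 * 1 * ((?A + 1) / (2 * ?B)) * ?B = ?A + 1" by simp
      with quad[of 1 "(?A + 1) / (2 * ?B)"] True show False by simp
    qed
    then show ?thesis using AC by simp
  next
    case False
    then have C: "?C > 0" using AC by linarith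
    have "0 \<le> ?C * (?A * ?C - ?B\<^sup>2)"
      using quad[of ?C ?B] by (simp add: power2_eq_square algebra_simps)
    then show ?thesis using C by (simp add: zero_le_mult_iff)
  qed
  then have "sqrt (?B\<^sup>2) \<le> sqrt (?A * ?C)" by (rule real_sqrt_le_mono)
  then show "\<bar>?B\<bar> \<le> sqrt ?A * sqrt ?C" by (simp only: real_sqrt_abs real_sqrt_mult)
qed

subsection \<open>Cotangent and tangent vectors\<close>

lemma tangent_scale:
  assumes "v \<in> tangent C \<rho>" "\<xi> \<in> C"
  shows "v (\<lambda>x. a * \<xi> x) = a * v \<xi>"
proof -
  have "v (\<lambda>x. a * \<xi> x + 0 * \<xi> x) = a * v \<xi> + 0 * v \<xi>"
    using assms unfolding tangent_def by blast
  then show ?thesis by simp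
qed

lemma tangentI:
  assumes "\<And>\<xi> \<eta> a b. \<xi> \<in> C \<Longrightarrow> \<eta> \<in> C \<Longrightarrow> v (\<lambda>x. a * \<xi> x + b * \<eta> x) = a * v \<xi> + b * v \<eta>"
    and "\<And>\<xi>. \<xi> \<in> C \<Longrightarrow> \<bar>v \<xi>\<bar> \<le> c * H1_seminorm \<rho> \<xi>"
  shows "v \<in> tangent C \<rho>"
  using assms unfolding tangent_def by blast

lemma tangent_linear:
  "v \<in> tangent C \<rho> \<Longrightarrow> \<xi> \<in> C \<Longrightarrow> \<eta> \<in> C \<Longrightarrow> v (\<lambda>x. a * \<xi> x + b * \<eta> x) = a * v \<xi> + b * v \<eta>"
  unfolding tangent_def by blast

lemma tangent_mono: "C' \<subseteq> C \<Longrightarrow> tangent C \<rho> \<subseteq> tangent C' \<rho>"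
  unfolding tangent_def by blast

text \<open>The cotangent space without the condition on the generator. Functionals are shown to be
  bounded here and then restricted with \<open>tangent_mono\<close>.\<close>

definition H1 :: "'d::finite fn \<Rightarrow> 'd fn set" where
  "H1 \<rho> = {\<xi>. C1 \<xi> \<and> integrable lborel (\<lambda>x. (norm (grad \<xi> x))\<^sup>2 * \<rho> x)}"

lemma cotangent_subset_H1: "cotangent D \<rho> \<subseteq> H1 \<rho>"
  by (auto simp: cotangent_def H1_def)

lemma cotangent_alt: "cotangent D \<rho> = {\<xi> \<in> H1 \<rho>. D \<rho> \<xi>}"
  by (auto simp: cotangent_def H1_def)

lemma H1_C1: "\<xi> \<in> H1 \<rho> \<Longrightarrow> C1 \<xi>"
  by (simp add: H1_def)

lemma H1_scale: "\<xi> \<in> H1 \<rho> \<Longrightarrow> (\<lambda>x. c * \<xi> x) \<in> H1 \<rho>"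
  and grad_scale: "C1 \<xi> \<Longrightarrow> grad (\<lambda>x. c * \<xi> x) = (\<lambda>x. c *\<^sub>R grad \<xi> x)"
  and C1_scale: "C1 \<xi> \<Longrightarrow> C1 (\<lambda>x. c * \<xi> x)"
  for \<xi> :: "'d::finite fn"
proof -
  have *: "C1 (\<lambda>x. c * \<xi> x) \<and> grad (\<lambda>x. c * \<xi> x) = (\<lambda>x. c *\<^sub>R grad \<xi> x)" if "C1 \<xi>"
    using C1_lincomb[OF that that, of c 0] grad_lincomb[of \<xi> _ \<xi> c 0] that by (auto simp: C1_def fun_eq_iff)
  then show "C1 \<xi> \<Longrightarrow> grad (\<lambda>x. c * \<xi> x) = (\<lambda>x. c *\<^sub>R grad \<xi> x)"
    and "C1 \<xi> \<Longrightarrow> C1 (\<lambda>x. c * \<xi> x)" by auto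
  show "(\<lambda>x. c * \<xi> x) \<in> H1 \<rho>" if "\<xi> \<in> H1 \<rho>"
    using that * by (simp add: H1_def power_mult_distrib mult.assoc)
qed

lemma zero_in_H1: "(\<lambda>x. 0) \<in> H1 \<rho>"
  by (simp add: H1_def C1_const grad_const)

text \<open>A vector field in L2 of \<open>\<rho>\<close> represents an element of H^-1, by
  Cauchy-Schwarz. This is the source of the Hamiltonian tangent vector and of the Dirichlet
  functionals.\<close>

lemma tangent_H1_integral:
  fixes X :: "'d::finite phase \<Rightarrow> 'd phase"
  assumes \<rho>: "\<And>x. 0 \<le> \<rho> x" "\<rho> \<in> borel_measurable borel"
    and X: "X \<in> borel_measurable borel" "integrable lborel (\<lambda>x. (norm (X x))\<^sup>2 * \<rho> x)"
  shows "(\<lambda>\<eta>. LINT x|lborel. (X x \<bullet> grad \<eta> x) * \<rho> x) \<in> tangent (H1 \<rho>) \<rho>"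
    and "\<eta> \<in> H1 \<rho> \<Longrightarrow> integrable lborel (\<lambda>x. (X x \<bullet> grad \<eta> x) * \<rho> x)"
    and "\<eta> \<in> H1 \<rho> \<Longrightarrow> integrable lborel (\<lambda>x. norm (X x) * norm (grad \<eta> x) * \<rho> x)"
proof -
  have CS: "integrable lborel (\<lambda>x. (X x \<bullet> grad \<eta> x) * \<rho> x)"
    "integrable lborel (\<lambda>x. norm (X x) * norm (grad \<eta> x) * \<rho> x)"
    "\<bar>LINT x|lborel. (X x \<bullet> grad \<eta> x) * \<rho> x\<bar> \<le>
      sqrt (LINT x|lborel. (norm (X x))\<^sup>2 * \<rho> x) * H1_seminorm \<rho> \<eta>" if "\<eta> \<in> H1 \<rho>" for \<eta>
    using that weighted_Cauchy_Schwarz[OF X(1) _ \<rho>(2) \<rho>(1) X(2)] C1_grad_borel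
    by (auto simp: H1_def H1_seminorm_def)
  then show "\<eta> \<in> H1 \<rho> \<Longrightarrow> integrable lborel (\<lambda>x. (X x \<bullet> grad \<eta> x) * \<rho> x)"
    and "\<eta> \<in> H1 \<rho> \<Longrightarrow> integrable lborel (\<lambda>x. norm (X x) * norm (grad \<eta> x) * \<rho> x)" by blast+
  have "(LINT x|lborel. (X x \<bullet> grad (\<lambda>x. a * \<xi> x + b * \<eta> x) x) * \<rho> x) =
      a * (LINT x|lborel. (X x \<bullet> grad \<xi> x) * \<rho> x) + b * (LINT x|lborel. (X x \<bullet> grad \<eta> x) * \<rho> x)"
    if "\<xi> \<in> H1 \<rho>" "\<eta> \<in> H1 \<rho>" for \<xi> \<eta> a b
  proof -
    have "(X x \<bullet> grad (\<lambda>x. a * \<xi> x + b * \<eta> x) x) * \<rho> x =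
        a * ((X x \<bullet> grad \<xi> x) * \<rho> x) + b * ((X x \<bullet> grad \<eta> x) * \<rho> x)" for x
      using that by (simp add: C1_grad_lincomb H1_def inner_add_right algebra_simps)
    then show ?thesis using CS that by simp
  qed
  then show "(\<lambda>\<eta>. LINT x|lborel. (X x \<bullet> grad \<eta> x) * \<rho> x) \<in> tangent (H1 \<rho>) \<rho>"
    using CS(3) unfolding tangent_def by blast
qed

lemma tangent_add:
  assumes "u \<in> tangent C \<rho>" "v \<in> tangent C \<rho>"
  shows "(\<lambda>\<xi>. u \<xi> + v \<xi>) \<in> tangent C \<rho>"
proof -
  obtain c1 c2 where c: "\<And>\<xi>. \<xi> \<in> C \<Longrightarrow> \<bar>u \<xi>\<bar> \<le> c1 * H1_seminorm \<rho> \<xi>"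
    "\<And>\<xi>. \<xi> \<in> C \<Longrightarrow> \<bar>v \<xi>\<bar> \<le> c2 * H1_seminorm \<rho> \<xi>"
    using assms unfolding tangent_def by blast
  have "\<bar>u \<xi> + v \<xi>\<bar> \<le> (c1 + c2) * H1_seminorm \<rho> \<xi>" if "\<xi> \<in> C" for \<xi>
    using c[OF that] by (simp add: distrib_right abs_le_iff)
  then show ?thesis
    by (intro tangentI[where c="c1 + c2"]) (auto simp: algebra_simps tangent_linear[OF assms(1)] tangent_linear[OF assms(2)])
qed

lemma tangent_cmult:
  assumes "u \<in> tangent C \<rho>"
  shows "(\<lambda>\<xi>. k * u \<xi>) \<in> tangent C \<rho>"
proof -
  obtain c where c: "\<And>\<xi>. \<xi> \<in> C \<Longrightarrow> \<bar>u \<xi>\<bar> \<le> c * H1_seminorm \<rho> \<xi>"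
    using assms unfolding tangent_def by blast
  have "\<bar>k * u \<xi>\<bar> \<le> (\<bar>k\<bar> * c) * H1_seminorm \<rho> \<xi>" if "\<xi> \<in> C" for \<xi>
    using mult_left_mono[OF c[OF that], of "\<bar>k\<bar>"] by (simp add: abs_mult mult.assoc)
  then show ?thesis
    by (intro tangentI[where c="\<bar>k\<bar> * c"]) (auto simp: algebra_simps tangent_linear[OF assms])
qed

subsection \<open>Legendre duality\<close>

lemma legendre_nonneg:
  assumes "(\<lambda>_. 0) \<in> C \<rho>" "\<Psi>s \<rho> (\<lambda>_. 0) = 0" "v \<in> tangent (C \<rho>) \<rho>"
  shows "0 \<le> legendre C \<Psi>s \<rho> v"
proof -
  have "v (\<lambda>_. 0) = 0" using tangent_scale[OF assms(3,1), of 0] by simp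
  then show ?thesis
    unfolding legendre_def by (intro SUP_upper2[OF assms(1)]) (simp add: assms(2))
qed

lemma Fenchel_Young:
  assumes "\<xi> \<in> C \<rho>" "0 \<le> \<Psi>s \<rho> \<xi>"
  shows "ereal (v \<xi>) - legendre C \<Psi>s \<rho> v \<le> \<Psi>s \<rho> \<xi>"
proof -
  have "ereal (v \<xi>) - \<Psi>s \<rho> \<xi> \<le> legendre C \<Psi>s \<rho> v"
    unfolding legendre_def using assms(1) by (rule SUP_upper)
  then show ?thesis using assms(2)
    by (cases "\<Psi>s \<rho> \<xi>"; cases "legendre C \<Psi>s \<rho> v") auto
qed

text \<open>A supremum of affine functionals is convex, its sign and its value at 0 come from those
  of \<open>\<Psi>s\<close>, and one half of biduality is Fenchel-Young. The hypothesis
  \<open>bidual\<close> is the other half, which Fenchel-Moreau would draw from lower semicontinuity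
  and which is instead proved separately for each potential.\<close>

lemma dissipation_potentials_legendreI:
  fixes C :: "'d::finite fn \<Rightarrow> 'd fn set"
  assumes zero: "\<And>\<rho>. \<rho> \<in> M \<Longrightarrow> (\<lambda>_. 0) \<in> C \<rho>"
    and \<Psi>s_zero: "\<And>\<rho>. \<rho> \<in> M \<Longrightarrow> \<Psi>s \<rho> (\<lambda>_. 0) = 0"
    and nonneg: "\<And>\<rho> \<xi>. \<rho> \<in> M \<Longrightarrow> \<xi> \<in> C \<rho> \<Longrightarrow> 0 \<le> \<Psi>s \<rho> \<xi>"
    and convex: "\<And>\<rho> \<xi> \<eta> t. \<rho> \<in> M \<Longrightarrow> \<xi> \<in> C \<rho> \<Longrightarrow> \<eta> \<in> C \<rho> \<Longrightarrow> t \<in> {0..1} \<Longrightarrow>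
       \<Psi>s \<rho> (\<lambda>x. (1 - t) * \<xi> x + t * \<eta> x) \<le> ereal (1 - t) * \<Psi>s \<rho> \<xi> + ereal t * \<Psi>s \<rho> \<eta>"
    and bidual: "\<And>\<rho> \<xi>. \<rho> \<in> M \<Longrightarrow> \<xi> \<in> C \<rho> \<Longrightarrow>
       \<Psi>s \<rho> \<xi> \<le> (SUP v\<in>tangent (C \<rho>) \<rho>. ereal (v \<xi>) - legendre C \<Psi>s \<rho> v)"
  shows "dissipation_potentials M C (legendre C \<Psi>s) \<Psi>s"
  unfolding dissipation_potentials_def Let_def
proof (intro ballI conjI)
  fix \<rho> assume \<rho>: "\<rho> \<in> M"
  note zero = zero[OF \<rho>] and \<Psi>s_zero = \<Psi>s_zero[OF \<rho>] and nonneg = nonneg[OF \<rho>]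
    and convex = convex[OF \<rho>] and bidual = bidual[OF \<rho>]
  let ?T = "tangent (C \<rho>) \<rho>" and ?\<Psi> = "legendre C \<Psi>s"
  show "?\<Psi> \<rho> v = (SUP \<xi>\<in>C \<rho>. ereal (v \<xi>) - \<Psi>s \<rho> \<xi>)" for v
    by (simp add: legendre_def)
  show "\<Psi>s \<rho> \<xi> = (SUP v\<in>?T. ereal (v \<xi>) - ?\<Psi> \<rho> v)" if "\<xi> \<in> C \<rho>" for \<xi>
    using that by (intro antisym bidual SUP_least Fenchel_Young nonneg)
  show "0 \<le> ?\<Psi> \<rho> v" if "v \<in> ?T" for v
    using that zero \<Psi>s_zero by (intro legendre_nonneg)
  show "0 \<le> \<Psi>s \<rho> \<xi>" if "\<xi> \<in> C \<rho>" for \<xi> using that by (rule nonneg)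
  show "\<Psi>s \<rho> (\<lambda>x. (1 - t) * \<xi> x + t * \<eta> x) \<le> ereal (1 - t) * \<Psi>s \<rho> \<xi> + ereal t * \<Psi>s \<rho> \<eta>"
    if "\<xi> \<in> C \<rho>" "\<eta> \<in> C \<rho>" "t \<in> {0..1}" for \<xi> \<eta> t
    using that by (rule convex)
  show "\<Psi>s \<rho> (\<lambda>_. 0) = 0" by (rule \<Psi>s_zero)
  show "?\<Psi> \<rho> (\<lambda>_. 0) = 0"
  proof (rule antisym)
    show "?\<Psi> \<rho> (\<lambda>_. 0) \<le> 0"
      unfolding legendre_def
    proof (rule SUP_least)
      fix \<xi> assume "\<xi> \<in> C \<rho>"
      then have "0 \<le> \<Psi>s \<rho> \<xi>" by (rule nonneg)
      then show "ereal 0 - \<Psi>s \<rho> \<xi> \<le> 0" by (cases "\<Psi>s \<rho> \<xi>") auto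
    qed
    show "0 \<le> ?\<Psi> \<rho> (\<lambda>_. 0)"
      unfolding legendre_def by (rule SUP_upper2[OF zero]) (simp add: \<Psi>s_zero)
  qed
  show "?\<Psi> \<rho> (\<lambda>\<xi>. (1 - t) * u \<xi> + t * v \<xi>) \<le> ereal (1 - t) * ?\<Psi> \<rho> u + ereal t * ?\<Psi> \<rho> v"
    if t: "t \<in> {0..1}" for u v t
    unfolding legendre_def[of _ _ _ "\<lambda>\<xi>. (1 - t) * u \<xi> + t * v \<xi>"]
  proof (rule SUP_least)
    fix \<xi> assume \<xi>: "\<xi> \<in> C \<rho>"
    show "ereal ((1 - t) * u \<xi> + t * v \<xi>) - \<Psi>s \<rho> \<xi> \<le> ereal (1 - t) * ?\<Psi> \<rho> u + ereal t * ?\<Psi> \<rho> v"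
    proof (cases "\<Psi>s \<rho> \<xi>")
      case (real s)
      have *: "ereal (w \<xi> - s) \<le> ?\<Psi> \<rho> w" for w
        unfolding legendre_def by (rule SUP_upper2[OF \<xi>]) (simp add: real)
      have "ereal (1 - t) * ereal (u \<xi> - s) + ereal t * ereal (v \<xi> - s)
          \<le> ereal (1 - t) * ?\<Psi> \<rho> u + ereal t * ?\<Psi> \<rho> v"
        using t by (intro add_mono ereal_mult_left_mono *) auto
      moreover have "ereal (1 - t) * ereal (u \<xi> - s) + ereal t * ereal (v \<xi> - s) =
          ereal ((1 - t) * u \<xi> + t * v \<xi>) - \<Psi>s \<rho> \<xi>"
        by (simp add: real algebra_simps)
      ultimately show ?thesis by simp
    next
      case PInf
      then show ?thesis by simp
    next
      case MInf
      then show ?thesis using nonneg[OF \<xi>] by simp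
    qed
  qed
qed

text \<open>The supremum is reindexed by \<open>\<xi>\<close> to \<open>- \<xi>\<close>.\<close>

lemma symmetric_potentials_legendreI:
  assumes neg: "\<And>\<rho> \<xi>. \<rho> \<in> M \<Longrightarrow> \<xi> \<in> C \<rho> \<Longrightarrow> (\<lambda>x. - \<xi> x) \<in> C \<rho>"
    and even: "\<And>\<rho> \<xi>. \<rho> \<in> M \<Longrightarrow> \<xi> \<in> C \<rho> \<Longrightarrow> \<Psi>s \<rho> (\<lambda>x. - \<xi> x) = \<Psi>s \<rho> \<xi>"
  shows "symmetric_potentials M C (legendre C \<Psi>s) \<Psi>s"
  unfolding symmetric_potentials_def
proof (intro ballI conjI)
  fix \<rho> assume \<rho>: "\<rho> \<in> M"
  show "\<Psi>s \<rho> (\<lambda>x. - \<xi> x) = \<Psi>s \<rho> \<xi>" if "\<xi> \<in> C \<rho>" for \<xi>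
    using \<rho> that by (rule even)
  fix v assume v: "v \<in> tangent (C \<rho>) \<rho>"
  have *: "v (\<lambda>x. - \<xi> x) = - v \<xi>" if "\<xi> \<in> C \<rho>" for \<xi>
    using tangent_scale[OF v that, of "-1"] by simp
  show "legendre C \<Psi>s \<rho> (\<lambda>\<xi>. - v \<xi>) = legendre C \<Psi>s \<rho> v"
  proof (rule antisym)
    show "legendre C \<Psi>s \<rho> (\<lambda>\<xi>. - v \<xi>) \<le> legendre C \<Psi>s \<rho> v"
      unfolding legendre_def
      using * by (intro SUP_least SUP_upper2[OF neg[OF \<rho>]]) (auto simp: even[OF \<rho>])
    show "legendre C \<Psi>s \<rho> v \<le> legendre C \<Psi>s \<rho> (\<lambda>\<xi>. - v \<xi>)"
      unfolding legendre_def
      using * by (intro SUP_least SUP_upper2[OF neg[OF \<rho>]]) (auto simp: even[OF \<rho>])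
  qed
qed

lemma legendre_eqI:
  assumes "a \<in> C \<rho>"
    and "\<And>\<xi>. \<xi> \<in> C \<rho> \<Longrightarrow> ereal (v \<xi>) - \<Psi>s \<rho> \<xi> \<le> ereal (v a) - \<Psi>s \<rho> a"
  shows "legendre C \<Psi>s \<rho> v = ereal (v a) - \<Psi>s \<rho> a"
  unfolding legendre_def by (intro antisym SUP_least SUP_upper assms)

text \<open>The balance holds because the supremum in \<open>\<Psi> \<rho> (F - W)\<close> is attained at \<open>-dS/2\<close>.\<close>
lemma pre_GENERIC_balance:
  assumes v: "v \<in> tangent (C \<rho>) \<rho>" and dS: "dS \<in> C \<rho>" "(\<lambda>x. - (1/2) * dS x) \<in> C \<rho>"
    and fin: "\<Psi>s \<rho> (\<lambda>x. - (1/2) * dS x) = ereal s"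
    and opt: "\<And>\<xi>. \<xi> \<in> C \<rho> \<Longrightarrow> ereal (v \<xi>) - \<Psi>s \<rho> \<xi> \<le>
      ereal (v (\<lambda>x. - (1/2) * dS x)) - \<Psi>s \<rho> (\<lambda>x. - (1/2) * dS x)"
  shows "legendre C \<Psi>s \<rho> v + \<Psi>s \<rho> (\<lambda>x. - (1/2) * dS x) + ereal (1/2 * v dS) = 0"
  using legendre_eqI[where C=C and \<rho>=\<rho> and v=v and \<Psi>s=\<Psi>s and a="\<lambda>x. - (1/2) * dS x", OF dS(2) opt] tangent_scale[OF v dS(1), of "-(1/2)"] fin by simp

subsection \<open>Regular states\<close>

text \<open>Keeps quantified phase-space points whole; otherwise the simplifier would split them
  into q and p.\<close>

declare split_paired_All [simp del] split_paired_Ex [simp del]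

text \<open>Mean value theorem on a segment. The gradient bound is requested on that segment alone,
  because the dominating functions for \<open>grad \<Phi>\<close> are uniform only over compact sets
  of positions.\<close>

lemma C1_increment_bound:
  fixes f :: "'a::euclidean_space \<Rightarrow> real"
  assumes f: "C1 f" and B: "\<And>s. s \<in> {0..1} \<Longrightarrow> norm (grad f (x + s *\<^sub>R e)) \<le> B"
    and t: "0 \<le> t" "t \<le> 1"
  shows "\<bar>f (x + t *\<^sub>R e) - f x\<bar> \<le> t * norm e * B"
proof (cases "t = 0")
  case False
  then have "0 < t" using t by simp
  then obtain z where z: "0 < z" "z < t"
    "f (x + t *\<^sub>R e) - f (x + 0 *\<^sub>R e) = (t - 0) * (e \<bullet> grad f (x + z *\<^sub>R e))"
    using MVT2[of 0 t "\<lambda>t. f (x + t *\<^sub>R e)" "\<lambda>t. e \<bullet> grad f (x + t *\<^sub>R e)"] C1_DERIV_line[OF f]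
    by blast
  have "\<bar>e \<bullet> grad f (x + z *\<^sub>R e)\<bar> \<le> norm e * norm (grad f (x + z *\<^sub>R e))"
    by (rule Cauchy_Schwarz_ineq2)
  also have "\<dots> \<le> norm e * B"
    using z t by (intro mult_left_mono B) auto
  finally show ?thesis
    using z(3) t by (simp add: abs_mult mult.assoc mult_left_mono)
qed simp

text \<open>The conditions on a state that do not mention the generator, so that the Hamiltonian
  part and the functional derivatives are proved once for both evolutions.\<close>

locale regular_state =
  fixes m :: real and V \<Phi> :: "real^'d::finite \<Rightarrow> real" and \<rho> :: "'d fn"
  assumes m_pos: "0 < m" and V: "C1 V" and \<Phi>: "C1 \<Phi>" and \<Phi>_sym: "\<Phi> (- q) = \<Phi> q"
    and \<rho>_pos: "0 < \<rho> x" and \<rho>: "C1 \<rho>" and \<rho>_int: "integrable lborel \<rho>"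
    and \<Phi>_int: "integrable lborel (\<lambda>x. \<Phi> (q - fst x) * \<rho> x)"
    and \<Phi>_dom: "compact K \<Longrightarrow> \<exists>g. integrable lborel (\<lambda>x. g x * \<rho> x) \<and>
        (\<forall>q\<in>K. \<forall>x. norm (grad \<Phi> (q - fst x)) \<le> g x)"
    and energy_int: "integrable lborel (\<lambda>x. energy_density m V \<Phi> \<rho> x * \<rho> x)"
    and entropy_int: "integrable lborel (\<lambda>x. ln (\<rho> x) * \<rho> x)"
    and dE_H1: "d_energy m V \<Phi> \<rho> \<in> H1 \<rho>"
    and dS_H1: "d_entropy m V \<Phi> \<rho> \<in> H1 \<rho>"

lemma regular_statesD:
  assumes "0 < m" "C1 V" "C1 \<Phi>" "\<And>q. \<Phi> (- q) = \<Phi> q" "\<rho> \<in> regular_states G D m V \<Phi>"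
  shows "regular_state m V \<Phi> \<rho>"
proof -
  have pos: "\<And>x. 0 < \<rho> x" and C1: "C1 \<rho>"
    and prob: "prob_space (density lborel (\<lambda>x. ennreal (\<rho> x)))"
    using assms(5) by (simp_all add: regular_states_def)
  have [measurable]: "\<rho> \<in> borel_measurable borel" using C1_borel[OF C1] .
  have "(\<integral>\<^sup>+x. ennreal (\<rho> x) \<partial>lborel) = 1"
    using prob_space.emeasure_space_1[OF prob] by (simp add: emeasure_density)
  then have "integrable lborel \<rho>"
    using pos by (intro integrableI_nn_integral_finite[where x=1]) (auto simp: less_imp_le)
  then show ?thesis
    using assms cotangent_subset_H1[of D \<rho>]
    by unfold_locales (auto simp: regular_states_def)
qed

context regular_state
begin

abbreviation "dE \<equiv> d_energy m V \<Phi> \<rho>"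
abbreviation "dS \<equiv> d_entropy m V \<Phi> \<rho>"

lemma dE_C1: "C1 dE" and dS_C1: "C1 dS"
  using dE_H1 dS_H1 by (simp_all add: H1_def)

lemma \<rho>_nonneg: "0 \<le> \<rho> x"
  using \<rho>_pos[of x] by simp

lemma borel [measurable]:
  "\<rho> \<in> borel_measurable borel" "grad \<rho> \<in> borel_measurable borel"
  "V \<in> borel_measurable borel" "grad V \<in> borel_measurable borel"
  "\<Phi> \<in> borel_measurable borel" "grad \<Phi> \<in> borel_measurable borel"
  "dE \<in> borel_measurable borel" "grad dE \<in> borel_measurable borel"
  "dS \<in> borel_measurable borel" "grad dS \<in> borel_measurable borel"
  by (rule C1_borel C1_grad_borel, rule \<rho> V \<Phi> dE_C1 dS_C1)+

lemma continuous_\<rho>: "continuous_on UNIV \<rho>"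
  by (rule C1_continuous[OF \<rho>])

subsection \<open>The gradient of the energy\<close>

text \<open>Since existence of the derivative is assumed, only its value has to be found, and one
  sequence of difference quotients is enough. Dominated convergence applies to it with the bound
  from \<open>\<Phi>_dom\<close>.\<close>

lemma conv_grad_eq:
  assumes D: "((\<lambda>t. conv \<Phi> \<rho> (q + t *\<^sub>R b)) has_real_derivative D) (at 0)"
  shows "D = b \<bullet> conv (grad \<Phi>) \<rho> q"
proof -
  define K where "K = (\<lambda>s. q + s *\<^sub>R b) ` {0..1::real}"
  have "compact K" unfolding K_def by (intro compact_continuous_image continuous_intros) auto
  from \<Phi>_dom[OF this] obtain g where g_dom: "integrable lborel (\<lambda>x. g x * \<rho> x) \<and>
      (\<forall>q\<in>K. \<forall>x. norm (grad \<Phi> (q - fst x)) \<le> g x)" ..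
  then have g: "integrable lborel (\<lambda>x. g x * \<rho> x)"
    "\<And>q x. q \<in> K \<Longrightarrow> norm (grad \<Phi> (q - fst x)) \<le> g x"
    by simp_all
  \<comment> \<open>Steps in (0, 1], so that all intermediate points stay on the segment
    \<open>K\<close> over which \<open>g\<close> dominates.\<close>
  define h where "h n = 1 / real (Suc n)" for n
  have h: "0 < h n" "h n \<le> 1" "h n \<noteq> 0" for n by (auto simp: h_def)
  have h0: "h \<longlonglongrightarrow> 0" unfolding h_def by (rule lim_1_over_n[THEN LIMSEQ_Suc])
  define s where "s n x = (\<Phi> (q - fst x + h n *\<^sub>R b) - \<Phi> (q - fst x)) / h n * \<rho> x" for n x
  have "norm (s n x) \<le> norm b * (g x * \<rho> x)" for n x
  proof -
    have "\<bar>\<Phi> (q - fst x + h n *\<^sub>R b) - \<Phi> (q - fst x)\<bar> \<le> h n * norm b * g x"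
    proof (rule C1_increment_bound[OF \<Phi>])
      fix s :: real assume "s \<in> {0..1}"
      then have "q + s *\<^sub>R b \<in> K" unfolding K_def by blast
      from g(2)[OF this, of x] show "norm (grad \<Phi> (q - fst x + s *\<^sub>R b)) \<le> g x"
        by (simp add: algebra_simps)
    qed (use h in \<open>auto simp: less_imp_le\<close>)
    then have *: "\<bar>(\<Phi> (q - fst x + h n *\<^sub>R b) - \<Phi> (q - fst x)) / h n\<bar> \<le> norm b * g x"
      using h[of n] by (simp add: abs_div field_simps)
    have "\<bar>s n x\<bar> = \<bar>(\<Phi> (q - fst x + h n *\<^sub>R b) - \<Phi> (q - fst x)) / h n\<bar> * \<rho> x"
      unfolding s_def abs_mult using \<rho>_nonneg[of x] by simp
    also have "\<dots> \<le> norm b * g x * \<rho> x"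
      by (rule mult_right_mono[OF * \<rho>_nonneg])
    finally show ?thesis by (simp add: mult.assoc)
  qed
  moreover have lim: "(\<lambda>n. s n x) \<longlonglongrightarrow> (b \<bullet> grad \<Phi> (q - fst x)) * \<rho> x" for x
  proof -
    have "((\<lambda>t. \<Phi> (q - fst x + t *\<^sub>R b)) has_real_derivative b \<bullet> grad \<Phi> (q - fst x)) (at 0)"
      using C1_DERIV_line[OF \<Phi>, of "q - fst x" b 0] by simp
    then have "((\<lambda>t. (\<Phi> (q - fst x + t *\<^sub>R b) - \<Phi> (q - fst x)) / t) \<longlongrightarrow> b \<bullet> grad \<Phi> (q - fst x)) (at 0)"
      by (simp add: has_field_derivative_iff)
    moreover have "filterlim h (at 0) sequentially"
      using h0 h(3) by (simp add: filterlim_at)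
    ultimately show ?thesis
      unfolding s_def by (intro tendsto_mult_right) (rule filterlim_compose)
  qed
  moreover have meas: "s n \<in> borel_measurable lborel" for n
    unfolding s_def measurable_lborel2
    by (intro borel_measurable_continuous_onI continuous_intros C1_continuous_compose[OF \<Phi>] continuous_\<rho>)
      (use h(3) in auto)
  moreover have "(\<lambda>x. (b \<bullet> grad \<Phi> (q - fst x)) * \<rho> x) \<in> borel_measurable lborel"
    unfolding measurable_lborel2
    by (intro borel_measurable_continuous_onI continuous_intros
        C1_grad_continuous_compose[OF \<Phi>] continuous_\<rho>)
  moreover have "integrable lborel (\<lambda>x. norm b * (g x * \<rho> x))" using g(1) by simp
  ultimately have "(\<lambda>n. LINT x|lborel. s n x) \<longlonglongrightarrow> (LINT x|lborel. (b \<bullet> grad \<Phi> (q - fst x)) * \<rho> x)"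
    by (intro integral_dominated_convergence[where w="\<lambda>x. norm b * (g x * \<rho> x)"]) auto
  also have "(\<lambda>n. LINT x|lborel. s n x) = (\<lambda>n. (conv \<Phi> \<rho> (q + h n *\<^sub>R b) - conv \<Phi> \<rho> q) / h n)"
  proof
    fix n
    have "s n x = (\<Phi> (q + h n *\<^sub>R b - fst x) * \<rho> x - \<Phi> (q - fst x) * \<rho> x) / h n" for x
      by (simp add: s_def algebra_simps diff_divide_distrib)
    then show "(LINT x|lborel. s n x) = (conv \<Phi> \<rho> (q + h n *\<^sub>R b) - conv \<Phi> \<rho> q) / h n"
      using \<Phi>_int by (simp add: conv_def mult.commute)
  qed
  finally have lim1: "(\<lambda>n. (conv \<Phi> \<rho> (q + h n *\<^sub>R b) - conv \<Phi> \<rho> q) / h n)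
    \<longlonglongrightarrow> (LINT x|lborel. (b \<bullet> grad \<Phi> (q - fst x)) * \<rho> x)" .
  have "((\<lambda>t. (conv \<Phi> \<rho> (q + t *\<^sub>R b) - conv \<Phi> \<rho> q) / t) \<longlongrightarrow> D) (at 0)"
    using D by (simp add: has_field_derivative_iff)
  moreover have "filterlim h (at 0) sequentially"
    using h0 h(3) by (simp add: filterlim_at)
  ultimately have "(\<lambda>n. (conv \<Phi> \<rho> (q + h n *\<^sub>R b) - conv \<Phi> \<rho> q) / h n) \<longlonglongrightarrow> D"
    by (rule filterlim_compose)
  then have "D = (LINT x|lborel. (b \<bullet> grad \<Phi> (q - fst x)) * \<rho> x)"
    using lim1 LIMSEQ_unique by blast
  also have "\<dots> = (LINT x|lborel. b \<bullet> (\<rho> x *\<^sub>R grad \<Phi> (q - fst x)))"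
    by (simp add: mult.commute)
  also have "\<dots> = b \<bullet> conv (grad \<Phi>) \<rho> q"
    unfolding conv_def
  proof (rule integral_inner_right)
    have "q \<in> K" unfolding K_def by (rule image_eqI[where x=0]) auto
    then have "norm (\<rho> x *\<^sub>R grad \<Phi> (q - fst x)) \<le> norm (g x * \<rho> x)" for x
      using mult_left_mono[OF order_trans[OF g(2)[of q x] abs_ge_self] \<rho>_nonneg[of x]] \<rho>_nonneg[of x]
      by (simp add: abs_mult mult.commute)
    moreover have "(\<lambda>x. \<rho> x *\<^sub>R grad \<Phi> (q - fst x)) \<in> borel_measurable lborel"
      unfolding measurable_lborel2
      by (intro borel_measurable_continuous_onI continuous_intros
          C1_grad_continuous_compose[OF \<Phi>] continuous_\<rho>)
    ultimately show "integrable lborel (\<lambda>x. \<rho> x *\<^sub>R grad \<Phi> (q - fst x))"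
      by (intro Bochner_Integration.integrable_bound[OF g(1)]) auto
  qed
  finally show ?thesis .
qed

text \<open>The convolution is differentiable along lines because it is \<open>dE\<close>, which is
  C1, minus explicit differentiable terms; \<open>conv_grad_eq\<close> then supplies the
  value.\<close>

lemma grad_dE: "grad dE (q, p) = (grad V q + conv (grad \<Phi>) \<rho> q, p /\<^sub>R m)"
proof -
  have "snd (grad dE (q, p)) = grad_p dE (q, p)" by (simp add: grad_p_eq[OF dE_C1])
  also have "\<dots> = grad (\<lambda>p'. (norm p')\<^sup>2 / (2 * m) + V q + conv \<Phi> \<rho> q) p"
    by (simp add: grad_p_def d_energy_def)
  also have "\<dots> = p /\<^sub>R m"
    unfolding power2_norm_eq_inner
    by (rule grad_eqI) (use m_pos in \<open>auto intro!: derivative_eq_intros simp: inner_commute field_simps\<close>)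
  finally have snd: "snd (grad dE (q, p)) = p /\<^sub>R m" .
  have "b \<bullet> fst (grad dE (q, p)) = b \<bullet> (grad V q + conv (grad \<Phi>) \<rho> q)" for b
  proof -
    have "((\<lambda>t. dE ((q, p) + t *\<^sub>R (b, 0))) has_real_derivative (b, 0) \<bullet> grad dE (q, p)) (at 0)"
      using C1_DERIV_line[OF dE_C1, of "(q, p)" "(b, 0)" 0] by (simp add: zero_prod_def)
    moreover have "((\<lambda>t. (norm p)\<^sup>2 / (2 * m) + V (q + t *\<^sub>R b)) has_real_derivative b \<bullet> grad V q) (at 0)"
      using C1_DERIV_line[OF V, of q b 0] by (auto intro!: derivative_eq_intros)
    ultimately have "((\<lambda>t. dE ((q, p) + t *\<^sub>R (b, 0)) - ((norm p)\<^sup>2 / (2 * m) + V (q + t *\<^sub>R b)))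
        has_real_derivative (b, 0) \<bullet> grad dE (q, p) - b \<bullet> grad V q) (at 0)"
      by (rule DERIV_diff)
    then have "((\<lambda>t. conv \<Phi> \<rho> (q + t *\<^sub>R b))
        has_real_derivative (b, 0) \<bullet> grad dE (q, p) - b \<bullet> grad V q) (at 0)"
      by (simp add: d_energy_def)
    from conv_grad_eq[OF this] show ?thesis
      by (simp add: inner_prod_def inner_add_right)
  qed
  then have "fst (grad dE (q, p)) = grad V q + conv (grad \<Phi>) \<rho> q"
    by (metis vector_eq_rdot inner_commute)
  then show ?thesis using snd by (metis prod.collapse)
qed

lemma grad_dE_translate_q: "snd (grad dE (x + (b, 0))) = snd (grad dE x)"
  and grad_dE_translate_p: "fst (grad dE (x + (0, b))) = fst (grad dE x)"
  by (cases x; simp add: grad_dE)+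

lemma grad_dS: "grad dS x = grad \<rho> x /\<^sub>R \<rho> x + grad dE x"
proof (rule grad_eqI)
  have "((\<lambda>x. ln (\<rho> x) + 1 + dE x) has_derivative
      (\<lambda>h. h \<bullet> (grad \<rho> x /\<^sub>R \<rho> x + grad dE x))) (at x)"
    by (rule derivative_eq_intros C1_has_derivative[OF \<rho>] C1_has_derivative[OF dE_C1] \<rho>_pos refl)+
      (auto simp: inner_add_right field_simps)
  then show "(dS has_derivative (\<lambda>h. h \<bullet> (grad \<rho> x /\<^sub>R \<rho> x + grad dE x))) (at x)"
    by (simp add: d_entropy_def)
qed

lemma dE_L2: "integrable lborel (\<lambda>x. (norm (grad dE x))\<^sup>2 * \<rho> x)"
  using dE_H1 by (simp add: H1_def)

end

subsection \<open>The Hamiltonian vector field\<close>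

lemma J_eq: "J x = (- snd x, fst x)"
  by (cases x) (simp add: J_def)

lemma norm_J: "norm (J x) = norm x"
  by (cases x) (simp add: J_eq norm_Pair add.commute)

lemma norm_fst_le_norm: "norm (fst x) \<le> norm x" and norm_snd_le_norm: "norm (snd x) \<le> norm x"
  by (cases x; simp add: norm_snd_le norm_fst_le)+

lemma weighted_L2_mono:
  fixes X Y :: "'a::euclidean_space \<Rightarrow> 'b::euclidean_space"
  assumes [measurable]: "X \<in> borel_measurable borel" "\<rho> \<in> borel_measurable borel"
    and "\<And>x. 0 \<le> \<rho> x" "\<And>x. norm (X x) \<le> norm (Y x)"
    and Y: "integrable lborel (\<lambda>x. (norm (Y x))\<^sup>2 * \<rho> x)"
  shows "integrable lborel (\<lambda>x. (norm (X x))\<^sup>2 * \<rho> x)"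
  using assms(3,4) 
  by (intro Bochner_Integration.integrable_bound[OF Y] AE_I2) (simp_all add: abs_mult mult_right_mono power_mono)

lemma inner_J_self: "J x \<bullet> x = 0"
  by (cases x) (simp add: J_eq inner_commute)

lemma inner_prod_axis_sum:
  fixes x y :: "'a::euclidean_space"
  shows "x \<bullet> y = (\<Sum>b\<in>Basis. (x \<bullet> b) * (b \<bullet> y))"
  by (subst euclidean_inner) (simp add: inner_commute)

context regular_state
begin

lemma fst_grad_dE: "fst (grad dE x) = grad V (fst x) + conv (grad \<Phi>) \<rho> (fst x)"
  and snd_grad_dE: "snd (grad dE x) = snd x /\<^sub>R m"
  by (cases x; simp add: grad_dE)+

lemma continuous_grad_dE: "continuous_on UNIV (grad dE)"
  using dE_C1 by (simp add: C1_def)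

lemma hamiltonian_tangent: "L \<rho> dE \<in> tangent (H1 \<rho>) \<rho>"
proof -
  have "(\<lambda>x. J (grad dE x)) \<in> borel_measurable borel"
    unfolding J_eq by (intro borel_measurable_continuous_onI continuous_intros continuous_grad_dE)
  then have "(\<lambda>\<eta>. LINT x|lborel. (J (grad dE x) \<bullet> grad \<eta> x) * \<rho> x) \<in> tangent (H1 \<rho>) \<rho>"
    by (intro tangent_H1_integral) (simp_all add: norm_J dE_L2 \<rho>_nonneg)
  from tangent_cmult[OF this, of "-1"] show ?thesis
    by (simp add: L_def wdiv_def)
qed

text \<open>The transport terms are \<open>L \<rho> dE\<close> written out by
  \<open>grad_dE\<close>. Splitting the integral is legitimate because each half of
  \<open>grad dE\<close> is bounded in norm by the whole and so is itself in L2 of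
  \<open>\<rho>\<close>.\<close>

lemma evolution_eq:
  assumes \<eta>: "\<eta> \<in> H1 \<rho>"
  shows "evolution G m V \<Phi> \<rho> \<eta> = L \<rho> dE \<eta> + adjoint_gen G \<rho> \<eta>"
proof -
  have C1: "C1 \<eta>" using \<eta> by (rule H1_C1)
  have int_q: "integrable lborel (\<lambda>x. ((snd (grad dE x), 0) \<bullet> grad \<eta> x) * \<rho> x)"
  proof (rule tangent_H1_integral(2)[OF \<rho>_nonneg borel(1) _ _ \<eta>])
    show meas: "(\<lambda>x. (snd (grad dE x), 0 :: real^'d)) \<in> borel_measurable borel"
      by (intro borel_measurable_continuous_onI continuous_intros continuous_grad_dE)
    show "integrable lborel (\<lambda>x. (norm (snd (grad dE x), 0 :: real^'d))\<^sup>2 * \<rho> x)"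
      using meas by (rule weighted_L2_mono[OF _ borel(1) \<rho>_nonneg _ dE_L2])
        (simp add: norm_Pair norm_snd_le_norm)
  qed
  have int_p: "integrable lborel (\<lambda>x. ((0, fst (grad dE x)) \<bullet> grad \<eta> x) * \<rho> x)"
  proof (rule tangent_H1_integral(2)[OF \<rho>_nonneg borel(1) _ _ \<eta>])
    show meas: "(\<lambda>x. (0 :: real^'d, fst (grad dE x))) \<in> borel_measurable borel"
      by (intro borel_measurable_continuous_onI continuous_intros continuous_grad_dE)
    show "integrable lborel (\<lambda>x. (norm (0 :: real^'d, fst (grad dE x)))\<^sup>2 * \<rho> x)"
      using meas by (rule weighted_L2_mono[OF _ borel(1) \<rho>_nonneg _ dE_L2])
        (simp add: norm_Pair norm_fst_le_norm)
  qed
  have "L \<rho> dE \<eta> = - (LINT x|lborel. - (((snd (grad dE x), 0) \<bullet> grad \<eta> x) * \<rho> x)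
      + ((0, fst (grad dE x)) \<bullet> grad \<eta> x) * \<rho> x)"
    unfolding L_def wdiv_def J_eq by (simp add: inner_prod_def algebra_simps)
  also have "\<dots> = (LINT x|lborel. ((snd (grad dE x), 0) \<bullet> grad \<eta> x) * \<rho> x)
      - (LINT x|lborel. ((0, fst (grad dE x)) \<bullet> grad \<eta> x) * \<rho> x)"
    using int_p int_q by simp
  also have "\<dots> = - wdiv_q \<rho> (\<lambda>(q, p). p /\<^sub>R m) \<eta> + wdiv_p \<rho> (\<lambda>(q, p). grad V q + conv (grad \<Phi>) \<rho> q) \<eta>"
    unfolding wdiv_q_def wdiv_p_def
    by (simp add: grad_q_eq[OF C1] grad_p_eq[OF C1] inner_prod_def fst_grad_dE snd_grad_dE split_beta')
  finally show ?thesis by (simp add: evolution_def)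
qed

lemma grad_\<rho>: "grad \<rho> x = \<rho> x *\<^sub>R (grad dS x - grad dE x)"
  using \<rho>_pos[of x] by (simp add: grad_dS)

lemma dE_dS_int: "integrable lborel (\<lambda>x. norm (grad dE x) * norm (grad dS x) * \<rho> x)"
  using tangent_H1_integral(3)[OF \<rho>_nonneg _ _ dE_L2 dS_H1] by simp

text \<open>L2 lies in L1 because \<open>\<rho>\<close> has finite mass: a number is at most 1 plus
  its square.\<close>

lemma integrable_norm_grad:
  assumes \<xi>: "\<xi> \<in> H1 \<rho>"
  shows "integrable lborel (\<lambda>x. norm (grad \<xi> x) * \<rho> x)"
proof (rule Bochner_Integration.integrable_bound)
  have [measurable]: "grad \<xi> \<in> borel_measurable borel"
    using C1_grad_borel[OF H1_C1[OF \<xi>]] .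
  show "integrable lborel (\<lambda>x. \<rho> x + (norm (grad \<xi> x))\<^sup>2 * \<rho> x)"
    using \<rho>_int \<xi> by (simp add: H1_def)
  have "norm (grad \<xi> x) * \<rho> x \<le> (1 + (norm (grad \<xi> x))\<^sup>2) * \<rho> x" for x
  proof (rule mult_right_mono[OF _ \<rho>_nonneg])
    have "0 \<le> (norm (grad \<xi> x) - 1)\<^sup>2 + (norm (grad \<xi> x))\<^sup>2 + 1" by simp
    then show "norm (grad \<xi> x) \<le> 1 + (norm (grad \<xi> x))\<^sup>2"
      by (simp add: power2_eq_square algebra_simps)
  qed
  then show "AE x in lborel. norm (norm (grad \<xi> x) * \<rho> x) \<le> norm (\<rho> x + (norm (grad \<xi> x))\<^sup>2 * \<rho> x)"
    using \<rho>_nonneg by (simp add: abs_mult distrib_right)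
  show "(\<lambda>x. norm (grad \<xi> x) * \<rho> x) \<in> borel_measurable lborel" by measurable
qed

text \<open>Each component of the Hamiltonian vector field is constant along the direction in which it
  points, so it can be treated as a constant in the integration by parts.\<close>
lemma integral_component_grad_\<rho>:
  assumes c: "continuous_on UNIV c" "\<And>x. \<bar>c x\<bar> \<le> norm (grad dE x)"
    and inv: "\<And>x t. c (x + t *\<^sub>R e) = c x" and e: "norm e = 1"
  shows "integrable lborel (\<lambda>x. c x * (e \<bullet> grad \<rho> x))"
    and "(LINT x|lborel. c x * (e \<bullet> grad \<rho> x)) = 0"
proof -
  have [measurable]: "c \<in> borel_measurable borel"
    using c(1) by (rule borel_measurable_continuous_onI)
  \<comment> \<open>\<open>grad \<rho>\<close> is \<open>\<rho>\<close> times a difference of two L2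
    gradients, and \<open>c\<close> is bounded by one of them, so products controlled by
    Cauchy-Schwarz dominate the integrand.\<close>
  show int': "integrable lborel (\<lambda>x. c x * (e \<bullet> grad \<rho> x))"
  proof (rule Bochner_Integration.integrable_bound)
    show "integrable lborel (\<lambda>x. norm (grad dE x) * norm (grad dS x) * \<rho> x + (norm (grad dE x))\<^sup>2 * \<rho> x)"
      using dE_dS_int dE_L2 by simp
    show "AE x in lborel. norm (c x * (e \<bullet> grad \<rho> x)) \<le>
      norm (norm (grad dE x) * norm (grad dS x) * \<rho> x + (norm (grad dE x))\<^sup>2 * \<rho> x)"
    proof (rule AE_I2)
      fix x
      have "\<bar>e \<bullet> grad \<rho> x\<bar> \<le> norm (grad \<rho> x)"
        using Cauchy_Schwarz_ineq2[of e "grad \<rho> x"] e by simp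
      also have "\<dots> = \<rho> x * norm (grad dS x - grad dE x)"
        using \<rho>_nonneg[of x] by (simp add: grad_\<rho>)
      also have "\<dots> \<le> \<rho> x * (norm (grad dS x) + norm (grad dE x))"
        by (intro mult_left_mono norm_triangle_ineq4 \<rho>_nonneg)
      finally have "\<bar>c x\<bar> * \<bar>e \<bullet> grad \<rho> x\<bar> \<le> norm (grad dE x) * (\<rho> x * (norm (grad dS x) + norm (grad dE x)))"
        by (intro mult_mono c(2)) auto
      also have "\<dots> \<le> \<bar>norm (grad dE x) * norm (grad dS x) * \<rho> x + (norm (grad dE x))\<^sup>2 * \<rho> x\<bar>"
        by (rule order_trans[OF _ abs_ge_self]) (simp add: algebra_simps power2_eq_square)
      finally show "norm (c x * (e \<bullet> grad \<rho> x)) \<le>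
          norm (norm (grad dE x) * norm (grad dS x) * \<rho> x + (norm (grad dE x))\<^sup>2 * \<rho> x)"
        by (simp add: abs_mult)
    qed
  qed measurable
  have int: "integrable lborel (\<lambda>x. c x * \<rho> x)"
    using c(2) \<rho>_nonneg
    by (intro Bochner_Integration.integrable_bound[OF integrable_norm_grad[OF dE_H1]])
      (auto simp: abs_mult intro!: mult_right_mono)
  show "(LINT x|lborel. c x * (e \<bullet> grad \<rho> x)) = 0"
  proof (rule integral_directional_derivative_eq_0[OF int int', where e=e])
    fix x
    show "((\<lambda>t. c (x + t *\<^sub>R e) * \<rho> (x + t *\<^sub>R e)) has_real_derivative c x * (e \<bullet> grad \<rho> x)) (at 0)"
      unfolding inv using C1_DERIV_line[OF \<rho>, of x e 0] by (auto intro: DERIV_cmult)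
    show "continuous_on UNIV (\<lambda>t. c (x + t *\<^sub>R e) * (e \<bullet> grad \<rho> (x + t *\<^sub>R e)))"
      unfolding inv by (intro continuous_intros C1_grad_continuous_compose[OF \<rho>])
  qed
qed

text \<open>Multiplying \<open>grad dS\<close> by \<open>\<rho>\<close> gives
  \<open>grad \<rho>\<close> plus \<open>\<rho>\<close> times \<open>grad dE\<close>, and the last
  term is orthogonal to \<open>J (grad dE x)\<close>. What remains is the derivative of
  \<open>\<rho>\<close> along a divergence-free field, and its integral vanishes.\<close>

lemma hamiltonian_dS: "L \<rho> dE dS = 0"
proof -
  let ?X = "\<lambda>x b. (snd (grad dE x) \<bullet> b) * ((b, 0) \<bullet> grad \<rho> x)"
    and ?Y = "\<lambda>x b. (fst (grad dE x) \<bullet> b) * ((0, b) \<bullet> grad \<rho> x)"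
  have bound: "\<bar>snd (grad dE x) \<bullet> b\<bar> \<le> norm (grad dE x)" "\<bar>fst (grad dE x) \<bullet> b\<bar> \<le> norm (grad dE x)"
    if "b \<in> Basis" for b x
    using that by (auto intro: order_trans[OF Basis_le_norm] norm_snd_le_norm norm_fst_le_norm)
  have X: "integrable lborel (\<lambda>x. ?X x b)" "(LINT x|lborel. ?X x b) = 0" if "b \<in> Basis" for b
    using that by (intro integral_component_grad_\<rho> continuous_intros continuous_grad_dE bound;
      simp add: norm_Pair grad_dE_translate_q)+
  have Y: "integrable lborel (\<lambda>x. ?Y x b)" "(LINT x|lborel. ?Y x b) = 0" if "b \<in> Basis" for b
    using that by (intro integral_component_grad_\<rho> continuous_intros continuous_grad_dE bound;
      simp add: norm_Pair grad_dE_translate_p)+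
  have "(J (grad dE x) \<bullet> grad dS x) * \<rho> x = (\<Sum>b\<in>Basis. ?Y x b) - (\<Sum>b\<in>Basis. ?X x b)" for x
  proof -
    have "(J (grad dE x) \<bullet> grad dS x) * \<rho> x = J (grad dE x) \<bullet> grad \<rho> x"
      using \<rho>_pos[of x] by (simp add: grad_\<rho> inner_diff_right inner_J_self)
    also have "\<dots> = fst (grad dE x) \<bullet> snd (grad \<rho> x) - snd (grad dE x) \<bullet> fst (grad \<rho> x)"
      by (simp add: J_eq inner_prod_def)
    also have "\<dots> = (\<Sum>b\<in>Basis. ?Y x b) - (\<Sum>b\<in>Basis. ?X x b)"
      unfolding inner_prod_axis_sum[of "fst (grad dE x)" "snd (grad \<rho> x)"]
        inner_prod_axis_sum[of "snd (grad dE x)" "fst (grad \<rho> x)"] by (simp add: inner_prod_def)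
    finally show ?thesis .
  qed
  then show ?thesis
    unfolding L_def wdiv_def using X Y by simp
qed

end

subsection \<open>Functional derivatives of energy and entropy\<close>

text \<open>Lets the entropy be differentiated from an integrated second-order bound, without
  interchanging a limit and an integral; it also handles the kink in
  \<open>DERIV_max_0_square\<close>.\<close>

lemma DERIV_quadratic_remainder:
  fixes T :: "real \<Rightarrow> real"
  assumes "0 < \<delta>" and bound: "\<And>\<epsilon>. \<bar>\<epsilon>\<bar> < \<delta> \<Longrightarrow> \<bar>T \<epsilon> - T 0 - \<epsilon> * D\<bar> \<le> Q * \<epsilon>\<^sup>2"
  shows "(T has_real_derivative D) (at 0)"
proof -
  have "((\<lambda>\<epsilon>. (T \<epsilon> - T 0) / \<epsilon> - D) \<longlongrightarrow> 0) (at 0)"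
  proof (rule Lim_null_comparison)
    have "\<forall>\<^sub>F \<epsilon>::real in at 0. \<bar>\<epsilon>\<bar> < \<delta> \<and> \<epsilon> \<noteq> 0"
      using assms(1) by (auto simp: eventually_at intro!: exI[of _ \<delta>])
    then show "\<forall>\<^sub>F \<epsilon> in at 0. norm ((T \<epsilon> - T 0) / \<epsilon> - D) \<le> Q * \<bar>\<epsilon>\<bar>"
    proof eventually_elim
      case (elim \<epsilon>)
      have "\<bar>(T \<epsilon> - T 0) / \<epsilon> - D\<bar> = \<bar>T \<epsilon> - T 0 - \<epsilon> * D\<bar> / \<bar>\<epsilon>\<bar>"
        using elim by (simp add: abs_divide[symmetric] diff_divide_distrib del: abs_divide)
      also have "\<dots> \<le> Q * \<epsilon>\<^sup>2 / \<bar>\<epsilon>\<bar>"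
        using elim by (intro divide_right_mono bound) auto
      also have "\<dots> = Q * \<bar>\<epsilon>\<bar>"
        using elim by (simp add: power2_eq_square abs_if)
      finally show ?case by simp
    qed
    have "((\<lambda>\<epsilon>. Q * \<bar>\<epsilon>\<bar>) \<longlongrightarrow> Q * \<bar>0\<bar>) (at 0)" by (intro tendsto_intros)
    then show "((\<lambda>\<epsilon>. Q * \<bar>\<epsilon>\<bar>) \<longlongrightarrow> 0) (at 0)" by simp
  qed
  then show ?thesis
    by (simp add: has_field_derivative_iff LIM_zero_iff)
qed

text \<open>Both bounds are \<open>ln y \<le> y - 1\<close>, once for \<open>u / (u + t)\<close> and
  once for its reciprocal.\<close>

lemma x_ln_x_taylor:
  fixes u t :: real
  assumes "0 < u" "0 < u + t"
  shows "0 \<le> ln (u + t) * (u + t) - ln u * u - t * (ln u + 1)"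
    and "ln (u + t) * (u + t) - ln u * u - t * (ln u + 1) \<le> t\<^sup>2 / u"
proof -
  have eq: "ln (u + t) * (u + t) - ln u * u - t * (ln u + 1) = (u + t) * (ln (u + t) - ln u) - t"
    by (simp add: algebra_simps)
  have "- (ln (u + t) - ln u) \<le> u / (u + t) - 1"
    using ln_le_minus_one[of "u / (u + t)"] assms by (simp add: ln_div)
  then have "(u + t) * - (ln (u + t) - ln u) \<le> (u + t) * (u / (u + t) - 1)"
    using assms by (intro mult_left_mono) auto
  also have "\<dots> = - t" using assms by (simp add: field_simps)
  finally show "0 \<le> ln (u + t) * (u + t) - ln u * u - t * (ln u + 1)"
    unfolding eq by (simp add: algebra_simps)
  have "ln (u + t) - ln u \<le> (u + t) / u - 1"
    using ln_le_minus_one[of "(u + t) / u"] assms by (simp add: ln_div)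
  then have "(u + t) * (ln (u + t) - ln u) \<le> (u + t) * ((u + t) / u - 1)"
    using assms by (intro mult_left_mono) auto
  also have "\<dots> = t\<^sup>2 / u + t" using assms by (simp add: field_simps power2_eq_square)
  finally show "ln (u + t) * (u + t) - ln u * u - t * (ln u + 1) \<le> t\<^sup>2 / u"
    unfolding eq by simp
qed

text \<open>Fubini and evenness of the kernel make the interaction a symmetric bilinear form. This
  is why the 1/2 in front of the convolution in the energy disappears in \<open>dE\<close>.\<close>

lemma conv_symmetric:
  fixes \<Phi> :: "real^'d::finite \<Rightarrow> real"
  assumes sym: "\<And>q. \<Phi> (- q) = \<Phi> q"
    and int: "integrable (lborel \<Otimes>\<^sub>M lborel) (\<lambda>(x, y). \<Phi> (fst x - fst y) * a x * b y)"
  shows "integrable lborel (\<lambda>x. conv \<Phi> b (fst x) * a x)"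
    and "(LINT x|lborel. conv \<Phi> b (fst x) * a x) = (LINT y|lborel. conv \<Phi> a (fst y) * b y)"
proof -
  have 1: "(LINT y|lborel. \<Phi> (fst x - fst y) * a x * b y) = conv \<Phi> b (fst x) * a x" for x
  proof -
    have "\<Phi> (fst x - fst y) * a x * b y = (b y *\<^sub>R \<Phi> (fst x - fst y)) * a x" for y by simp
    then show ?thesis by (simp only: conv_def integral_mult_left_zero)
  qed
  have sym': "\<Phi> (fst x - fst y) = \<Phi> (fst y - fst x)" for x y :: "'d phase"
    using sym[of "fst x - fst y"] by simp
  have 2: "(LINT x|lborel. \<Phi> (fst x - fst y) * a x * b y) = conv \<Phi> a (fst y) * b y" for y
  proof -
    have "\<Phi> (fst x - fst y) * a x * b y = (a x *\<^sub>R \<Phi> (fst y - fst x)) * b y" for x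
      by (simp add: sym'[of y x])
    then show ?thesis by (simp only: conv_def integral_mult_left_zero)
  qed
  show "integrable lborel (\<lambda>x. conv \<Phi> b (fst x) * a x)"
    using lborel_pair.integrable_fst'[OF int] by (simp add: 1)
  show "(LINT x|lborel. conv \<Phi> b (fst x) * a x) = (LINT y|lborel. conv \<Phi> a (fst y) * b y)"
    using lborel_pair.Fubini_integral[OF int] by (simp only: 1 2)
qed

context regular_state
begin

text \<open>Moving from 0 to \<open>q\<close> along a segment changes the potential by at most the
  norm of \<open>q\<close> times a gradient bound. A ball around 0 is used since it contains all
  these segments.\<close>

lemma interaction_bound:
  assumes "compact K"
  obtains h where "integrable lborel (\<lambda>x. h x * \<rho> x)"
    "\<And>q x. q \<in> K \<Longrightarrow> \<bar>\<Phi> (q - fst x)\<bar> \<le> h x"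
proof -
  obtain R where R: "\<And>q. q \<in> K \<Longrightarrow> norm q \<le> R"
    using compact_imp_bounded[OF assms] by (auto simp: bounded_iff)
  from \<Phi>_dom[OF compact_cball[of 0 R]] obtain g where g: "integrable lborel (\<lambda>x. g x * \<rho> x) \<and>
      (\<forall>q\<in>cball 0 R. \<forall>x. norm (grad \<Phi> (q - fst x)) \<le> g x)" ..
  show ?thesis
  proof (rule that)
    have "integrable lborel (\<lambda>x. \<bar>\<Phi> (0 - fst x) * \<rho> x\<bar> + R * (g x * \<rho> x))"
      using g by (intro Bochner_Integration.integrable_add integrable_abs \<Phi>_int integrable_mult_right) simp
    then show "integrable lborel (\<lambda>x. (\<bar>\<Phi> (0 - fst x)\<bar> + R * g x) * \<rho> x)"
      using \<rho>_nonneg by (simp add: abs_mult algebra_simps)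
    fix q :: "real^'d" and x :: "'d phase" assume q: "q \<in> K"
    have "\<bar>\<Phi> (0 - fst x + 1 *\<^sub>R q) - \<Phi> (0 - fst x)\<bar> \<le> 1 * norm q * g x"
    proof (rule C1_increment_bound[OF \<Phi>])
      fix s :: real assume s: "s \<in> {0..1}"
      then have "norm (s *\<^sub>R q) \<le> 1 * norm q"
        using mult_right_mono[of s 1 "norm q"] by simp
      then have "s *\<^sub>R q \<in> cball 0 R" using R[OF q] by simp
      then show "norm (grad \<Phi> (0 - fst x + s *\<^sub>R q)) \<le> g x"
        using g by (metis add.commute diff_0 uminus_add_conv_diff)
    qed auto
    moreover have "0 \<le> R" using R[OF q] norm_ge_zero[of q] by linarith
    then have "0 \<in> cball (0::real^'d) R" by simp
    then have "0 \<le> g x" using g norm_ge_zero order_trans by blast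
    then have "norm q * g x \<le> R * g x" using R[OF q] by (rule mult_right_mono[rotated])
    ultimately show "\<bar>\<Phi> (q - fst x)\<bar> \<le> \<bar>\<Phi> (0 - fst x)\<bar> + R * g x"
      by (simp add: algebra_simps)
  qed
qed

text \<open>Read off from \<open>dE\<close>, which is C1, by subtracting the kinetic term and
  \<open>V\<close>.\<close>

lemma continuous_conv: "continuous_on UNIV (\<lambda>x :: 'd phase. conv \<Phi> \<rho> (fst x))"
proof -
  have "(\<lambda>x :: 'd phase. conv \<Phi> \<rho> (fst x)) = (\<lambda>x. dE x - (norm (snd x))\<^sup>2 / (2 * m) - V (fst x))"
    by (auto simp: d_energy_def split_beta')
  then show ?thesis
    using m_pos by (simp only:) (intro continuous_intros C1_continuous_compose[OF V] C1_continuous[OF dE_C1]; simp)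
qed

lemma energy_density_eq: "energy_density m V \<Phi> \<rho> x = dE x - conv \<Phi> \<rho> (fst x) / 2"
  by (simp add: energy_density_def d_energy_def split_beta')

lemma interaction_integrable:
  fixes \<eta> :: "'d fn"
  assumes \<eta>: "continuous_on UNIV \<eta>" "compact K" "\<And>x. x \<notin> K \<Longrightarrow> \<eta> x = 0"
  shows "integrable (lborel \<Otimes>\<^sub>M lborel) (\<lambda>(x, y). \<Phi> (fst x - fst y) * \<rho> x * \<eta> y)"
    (is "integrable _ (\<lambda>(x, y). ?H x y)")
proof -
  have cont: "continuous_on UNIV (\<lambda>z :: 'd phase \<times> 'd phase. ?H (fst z) (snd z))"
    by (intro continuous_intros C1_continuous_compose[OF \<Phi>] C1_continuous_compose[OF \<rho>]
        continuous_on_compose2[OF \<eta>(1)]) auto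
  then have meas: "(\<lambda>(x, y). ?H x y) \<in> borel_measurable (lborel \<Otimes>\<^sub>M lborel)"
    unfolding lborel_prod measurable_lborel2 split_beta' by (rule borel_measurable_continuous_onI)
  have int_y: "integrable lborel (\<lambda>y. ?H x y)" for x
    by (rule integrable_continuous_compact_support[OF _ \<eta>(2)])
      (auto intro!: continuous_intros C1_continuous_compose[OF \<Phi>] \<eta>(1) simp: \<eta>(3))
  have \<eta>_int: "integrable lborel (\<lambda>y. \<bar>\<eta> y\<bar>)"
    using integrable_continuous_compact_support[OF \<eta>] by simp
  have "compact (fst ` K)" using \<eta>(2) by (intro compact_continuous_image continuous_intros)
  then obtain h where h: "integrable lborel (\<lambda>x. h x * \<rho> x)"
    "\<And>q x. q \<in> fst ` K \<Longrightarrow> \<bar>\<Phi> (q - fst x)\<bar> \<le> h x"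
    using interaction_bound by metis
  have bound: "norm (?H x y) \<le> h x * \<rho> x * \<bar>\<eta> y\<bar>" for x y
  proof (cases "y \<in> K")
    case True
    then have "\<bar>\<Phi> (fst x - fst y)\<bar> \<le> h x"
      using h(2)[of "fst y" x] \<Phi>_sym[of "fst x - fst y"] by simp
    then show ?thesis using \<rho>_nonneg[of x] by (simp add: abs_mult mult_right_mono)
  qed (simp add: \<eta>(3))
  show ?thesis
  proof (rule lborel_pair.Fubini_integrable[OF meas])
    show "AE x in lborel. integrable lborel (\<lambda>y. case (x, y) of (x, y) \<Rightarrow> ?H x y)"
      using int_y by simp
    show "integrable lborel (\<lambda>x. LINT y|lborel. norm (case (x, y) of (x, y) \<Rightarrow> ?H x y))"
    proof (rule Bochner_Integration.integrable_bound)
      show "integrable lborel (\<lambda>x. h x * \<rho> x * (LINT y|lborel. \<bar>\<eta> y\<bar>))"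
        using h(1) by simp
      show "(\<lambda>x. LINT y|lborel. norm (case (x, y) of (x, y) \<Rightarrow> ?H x y)) \<in> borel_measurable lborel"
        using meas by (intro lborel.borel_measurable_lebesgue_integral) (simp add: split_beta')
      show "AE x in lborel. norm (LINT y|lborel. norm (case (x, y) of (x, y) \<Rightarrow> ?H x y))
          \<le> norm (h x * \<rho> x * (LINT y|lborel. \<bar>\<eta> y\<bar>))"
      proof (rule AE_I2)
        fix x
        have "norm (LINT y|lborel. norm (?H x y)) = (LINT y|lborel. norm (?H x y))"
          by simp
        also have "\<dots> \<le> (LINT y|lborel. h x * \<rho> x * \<bar>\<eta> y\<bar>)"
          using int_y[of x] \<eta>_int bound by (intro integral_mono integrable_norm integrable_mult_right)
        finally show "norm (LINT y|lborel. norm (case (x, y) of (x, y) \<Rightarrow> ?H x y))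
            \<le> norm (h x * \<rho> x * (LINT y|lborel. \<bar>\<eta> y\<bar>))" by simp
      qed
    qed
  qed
qed

text \<open>Along \<open>\<rho> x + \<epsilon> * \<eta> x\<close> the energy is exactly a quadratic
  polynomial in \<open>\<epsilon>\<close>. Its linear coefficient has two interaction terms, each
  with factor 1/2, which coincide by \<open>conv_symmetric\<close>.\<close>

lemma energy_functional_derivative: "has_functional_derivative (energy m V \<Phi>) dE \<rho>"
  unfolding has_functional_derivative_def
proof (intro allI impI, elim conjE exE)
  fix \<eta> :: "'d fn" and K
  assume \<eta>: "continuous_on UNIV \<eta>" "compact K" "\<forall>x. x \<notin> K \<longrightarrow> \<eta> x = 0"
  then have supp: "\<And>x. x \<notin> K \<Longrightarrow> \<eta> x = 0" and supp': "\<And>x. \<eta> x \<noteq> 0 \<Longrightarrow> x \<in> K"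
    by blast+
  let ?A = "energy_density m V \<Phi> \<rho>"
  let ?c = "\<lambda>x :: 'd phase. conv \<Phi> \<eta> (fst x)"
  have "integrable (lborel \<Otimes>\<^sub>M lborel) (\<lambda>(x, y). \<Phi> (fst x - fst y) * \<rho> x * \<eta> y)"
    by (rule interaction_integrable[OF \<eta>(1,2)]) (rule supp)
  note c\<rho> = conv_symmetric[OF \<Phi>_sym this]
  have "integrable (lborel \<Otimes>\<^sub>M lborel) (\<lambda>(x, y). \<Phi> (fst x - fst y) * \<eta> x * \<eta> y)"
    unfolding lborel_prod
    by (rule integrable_continuous_compact_support[where K="K \<times> K"])
      (auto dest: supp' simp: split_beta' compact_Times \<eta>(2) intro!: continuous_intros
        C1_continuous_compose[OF \<Phi>] continuous_on_compose2[OF \<eta>(1)])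
  note c\<eta> = conv_symmetric[OF \<Phi>_sym this]
  have A\<eta>: "integrable lborel (\<lambda>x. ?A x * \<eta> x)"
    unfolding energy_density_eq
    by (rule integrable_continuous_compact_support[OF _ \<eta>(2)])
      (auto simp: supp intro!: continuous_intros C1_continuous[OF dE_C1] continuous_conv \<eta>(1))
  have conv\<rho>\<eta>: "integrable lborel (\<lambda>x. conv \<Phi> \<rho> (fst x) * \<eta> x)"
    by (rule integrable_continuous_compact_support[OF _ \<eta>(2)])
      (auto simp: supp intro!: continuous_intros continuous_conv \<eta>(1))
  have conv_add: "conv \<Phi> (\<lambda>x. \<rho> x + \<epsilon> * \<eta> x) q = conv \<Phi> \<rho> q + \<epsilon> * conv \<Phi> \<eta> q" for \<epsilon> q
  proof -
    have "integrable lborel (\<lambda>x. \<eta> x * \<Phi> (q - fst x))"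
      by (rule integrable_continuous_compact_support[OF _ \<eta>(2)])
        (auto simp: supp intro!: continuous_intros C1_continuous_compose[OF \<Phi>] \<eta>(1))
    moreover have "integrable lborel (\<lambda>x. \<rho> x * \<Phi> (q - fst x))"
      using \<Phi>_int[of q] by (simp add: mult.commute)
    ultimately show ?thesis by (simp add: conv_def distrib_right mult.assoc)
  qed
  have "energy m V \<Phi> (\<lambda>x. \<rho> x + \<epsilon> * \<eta> x) =
      (LINT x|lborel. ?A x * \<rho> x) + \<epsilon> * ((LINT x|lborel. ?A x * \<eta> x) + (LINT x|lborel. ?c x * \<rho> x) / 2)
      + \<epsilon>\<^sup>2 * ((LINT x|lborel. ?c x * \<eta> x) / 2)" for \<epsilon>
  proof -
    have "energy_density m V \<Phi> (\<lambda>x. \<rho> x + \<epsilon> * \<eta> x) x * (\<rho> x + \<epsilon> * \<eta> x) =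
        ?A x * \<rho> x + (\<epsilon> * (?A x * \<eta> x) + ((\<epsilon> / 2) * (?c x * \<rho> x) + (\<epsilon>\<^sup>2 / 2) * (?c x * \<eta> x)))" for x
      by (simp add: energy_density_def conv_add split_beta' power2_eq_square algebra_simps add_divide_distrib)
    moreover have "(LINT x|lborel. ?A x * \<rho> x + (\<epsilon> * (?A x * \<eta> x) + ((\<epsilon> / 2) * (?c x * \<rho> x) + (\<epsilon>\<^sup>2 / 2) * (?c x * \<eta> x)))) = (LINT x|lborel. ?A x * \<rho> x) + (\<epsilon> * (LINT x|lborel. ?A x * \<eta> x)
        + ((\<epsilon> / 2) * (LINT x|lborel. ?c x * \<rho> x) + (\<epsilon>\<^sup>2 / 2) * (LINT x|lborel. ?c x * \<eta> x)))"
      using integrable_mult_right[OF A\<eta>, of \<epsilon>] integrable_mult_right[OF c\<rho>(1), of "\<epsilon> / 2"]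
        integrable_mult_right[OF c\<eta>(1), of "\<epsilon>\<^sup>2 / 2"] energy_int
      by (simp only: Bochner_Integration.integral_add Bochner_Integration.integrable_add integral_mult_right_zero)
    ultimately show ?thesis unfolding energy_def by (simp add: algebra_simps)
  qed
  moreover have "(LINT x|lborel. dE x * \<eta> x) = (LINT x|lborel. ?A x * \<eta> x) + (LINT x|lborel. ?c x * \<rho> x) / 2"
  proof -
    have "dE x * \<eta> x = ?A x * \<eta> x + (conv \<Phi> \<rho> (fst x) * \<eta> x) / 2" for x
      by (simp add: energy_density_eq algebra_simps)
    then show ?thesis using A\<eta> conv\<rho>\<eta> by (simp add: c\<rho>(2))
  qed
  ultimately show "((\<lambda>\<epsilon>. energy m V \<Phi> (\<lambda>x. \<rho> x + \<epsilon> * \<eta> x)) has_real_derivative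
      (LINT x|lborel. dE x * \<eta> x)) (at 0)"
    by (auto intro!: derivative_eq_intros)
qed

text \<open>The Taylor remainder \<open>R \<epsilon>\<close> lies between 0 and
  \<open>\<epsilon>\<^sup>2 * ((\<eta> x)\<^sup>2 / \<rho> x)\<close>, which is integrable because
  \<open>\<rho>\<close> is bounded below on the support of \<open>\<eta>\<close>.\<close>

lemma entropy_functional_derivative: "has_functional_derivative (entropy m V \<Phi>) dS \<rho>"
  unfolding has_functional_derivative_def
proof (intro allI impI)
  fix \<eta> :: "'d fn"
  assume test: "continuous_on UNIV \<eta> \<and> (\<exists>K. compact K \<and> (\<forall>x. x \<notin> K \<longrightarrow> \<eta> x = 0))"
  then obtain K where \<eta>: "continuous_on UNIV \<eta>" "compact K" and supp: "\<And>x. x \<notin> K \<Longrightarrow> \<eta> x = 0"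
    by blast
  have [measurable]: "\<eta> \<in> borel_measurable borel"
    using \<eta>(1) by (rule borel_measurable_continuous_onI)
  have \<rho>0: "\<rho> x \<noteq> 0" for x using \<rho>_pos[of x] by simp
  have "compact ((\<lambda>x. \<eta> x / \<rho> x) ` K)"
    using \<eta> \<rho>0 by (intro compact_continuous_image continuous_intros)
      (auto intro: continuous_on_subset continuous_on_subset[OF continuous_\<rho>])
  \<comment> \<open>The bound on \<open>\<eta> / \<rho>\<close> keeps the perturbed density positive
    as long as \<open>\<bar>\<epsilon>\<bar> < 1 / B\<close>, so the logarithm is never evaluated
    outside its domain.\<close>
  then obtain B where B: "0 < B" "\<And>x. x \<in> K \<Longrightarrow> \<bar>\<eta> x / \<rho> x\<bar> \<le> B"
    using compact_imp_bounded bounded_pos by (metis (no_types, lifting) imageI real_norm_def)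
  have pos: "0 < \<rho> x + \<epsilon> * \<eta> x" if \<epsilon>: "\<bar>\<epsilon>\<bar> < 1 / B" for \<epsilon> x
  proof (cases "x \<in> K")
    case True
    have "\<bar>\<epsilon> * \<eta> x\<bar> = \<bar>\<epsilon>\<bar> * \<bar>\<eta> x / \<rho> x\<bar> * \<rho> x"
      using \<rho>_pos[of x] by (simp add: abs_mult)
    also have "\<dots> \<le> \<bar>\<epsilon>\<bar> * B * \<rho> x"
      using B(2)[OF True] \<rho>_nonneg[of x] by (intro mult_right_mono mult_left_mono) auto
    also have "\<dots> < 1 * \<rho> x"
      using \<epsilon> B(1) \<rho>_pos[of x] by (intro mult_strict_right_mono) (auto simp: field_simps)
    finally show ?thesis by linarith
  qed (simp add: supp \<rho>_pos)
  define R where "R \<epsilon> x = ln (\<rho> x + \<epsilon> * \<eta> x) * (\<rho> x + \<epsilon> * \<eta> x) - ln (\<rho> x) * \<rho> x - (\<epsilon> * \<eta> x) * (ln (\<rho> x) + 1)" for \<epsilon> x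
  have R: "0 \<le> R \<epsilon> x" "R \<epsilon> x \<le> \<epsilon>\<^sup>2 * ((\<eta> x)\<^sup>2 / \<rho> x)" if \<epsilon>: "\<bar>\<epsilon>\<bar> < 1 / B" for \<epsilon> x
    using x_ln_x_taylor[OF \<rho>_pos pos[OF \<epsilon>], of x] by (simp_all add: R_def power_mult_distrib)
  have Q: "integrable lborel (\<lambda>x. (\<eta> x)\<^sup>2 / \<rho> x)"
    by (rule integrable_continuous_compact_support[OF _ \<eta>(2)])
      (auto simp: supp \<rho>0 intro!: continuous_intros continuous_\<rho> \<eta>(1))
  have D: "integrable lborel (\<lambda>x. (ln (\<rho> x) + 1) * \<eta> x)"
    by (rule integrable_continuous_compact_support[OF _ \<eta>(2)])
      (auto simp: supp \<rho>0 intro!: continuous_intros continuous_\<rho> \<eta>(1))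
  let ?T = "\<lambda>\<epsilon>. LINT x|lborel. ln (\<rho> x + \<epsilon> * \<eta> x) * (\<rho> x + \<epsilon> * \<eta> x)"
  have "(?T has_real_derivative (LINT x|lborel. (ln (\<rho> x) + 1) * \<eta> x)) (at 0)"
  proof (rule DERIV_quadratic_remainder)
    show "0 < 1 / B" using B by simp
    fix \<epsilon> :: real assume \<epsilon>: "\<bar>\<epsilon>\<bar> < 1 / B"
    have R_int: "integrable lborel (R \<epsilon>)"
    proof (rule Bochner_Integration.integrable_bound)
      show "integrable lborel (\<lambda>x. \<epsilon>\<^sup>2 * ((\<eta> x)\<^sup>2 / \<rho> x))"
        by (intro integrable_mult_right Q)
      show "R \<epsilon> \<in> borel_measurable lborel" unfolding R_def by measurable
      show "AE x in lborel. norm (R \<epsilon> x) \<le> norm (\<epsilon>\<^sup>2 * ((\<eta> x)\<^sup>2 / \<rho> x))"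
        using R[OF \<epsilon>] by (intro AE_I2) (metis abs_of_nonneg order_trans real_norm_def)
    qed
    have "?T \<epsilon> = (LINT x|lborel. R \<epsilon> x + ln (\<rho> x) * \<rho> x + \<epsilon> * ((ln (\<rho> x) + 1) * \<eta> x))"
      by (simp add: R_def algebra_simps)
    also have "\<dots> = (LINT x|lborel. R \<epsilon> x) + ?T 0 + \<epsilon> * (LINT x|lborel. (ln (\<rho> x) + 1) * \<eta> x)"
      using R_int entropy_int D by simp
    finally have "?T \<epsilon> - ?T 0 - \<epsilon> * (LINT x|lborel. (ln (\<rho> x) + 1) * \<eta> x) = (LINT x|lborel. R \<epsilon> x)"
      by simp
    moreover have "0 \<le> (LINT x|lborel. R \<epsilon> x)" using R(1)[OF \<epsilon>] by simp
    moreover have "(LINT x|lborel. R \<epsilon> x) \<le> \<epsilon>\<^sup>2 * (LINT x|lborel. (\<eta> x)\<^sup>2 / \<rho> x)"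
      unfolding integral_mult_right_zero[symmetric]
      by (intro integral_mono R_int integrable_mult_right Q R(2)[OF \<epsilon>])
    ultimately show "\<bar>?T \<epsilon> - ?T 0 - \<epsilon> * (LINT x|lborel. (ln (\<rho> x) + 1) * \<eta> x)\<bar>
        \<le> (LINT x|lborel. (\<eta> x)\<^sup>2 / \<rho> x) * \<epsilon>\<^sup>2"
      by (simp add: mult.commute)
  qed
  moreover have "((\<lambda>\<epsilon>. energy m V \<Phi> (\<lambda>x. \<rho> x + \<epsilon> * \<eta> x)) has_real_derivative
      (LINT x|lborel. dE x * \<eta> x)) (at 0)"
    using energy_functional_derivative test unfolding has_functional_derivative_def by blast
  ultimately have "((\<lambda>\<epsilon>. entropy m V \<Phi> (\<lambda>x. \<rho> x + \<epsilon> * \<eta> x)) has_real_derivative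
      (LINT x|lborel. (ln (\<rho> x) + 1) * \<eta> x) + (LINT x|lborel. dE x * \<eta> x)) (at 0)"
    unfolding entropy_def by (rule DERIV_add)
  moreover have "integrable lborel (\<lambda>x. dE x * \<eta> x)"
    by (rule integrable_continuous_compact_support[OF _ \<eta>(2)])
      (auto simp: supp intro!: continuous_intros C1_continuous[OF dE_C1] \<eta>(1))
  then have "(LINT x|lborel. (ln (\<rho> x) + 1) * \<eta> x) + (LINT x|lborel. dE x * \<eta> x) = (LINT x|lborel. dS x * \<eta> x)"
    using D by (simp only: d_entropy_def distrib_right[of _ "d_energy m V \<Phi> \<rho> _"]
        Bochner_Integration.integral_add)
  ultimately show "((\<lambda>\<epsilon>. entropy m V \<Phi> (\<lambda>x. \<rho> x + \<epsilon> * \<eta> x)) has_real_derivative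
      (LINT x|lborel. dS x * \<eta> x)) (at 0)" by simp
qed

end

subsection \<open>Vector fields with integrable divergence\<close>

lemma C1_mult:
  fixes f g :: "'a::euclidean_space \<Rightarrow> real"
  assumes "C1 f" "C1 g"
  shows "C1 (\<lambda>x. f x * g x)" and "grad (\<lambda>x. f x * g x) = (\<lambda>x. f x *\<^sub>R grad g x + g x *\<^sub>R grad f x)"
  by (rule C1I[where D="\<lambda>x. f x *\<^sub>R grad g x + g x *\<^sub>R grad f x"];
    auto intro!: derivative_eq_intros continuous_intros C1_has_derivative C1_continuous
      C1_grad_continuous_compose assms simp: inner_add_right)+

lemma DERIV_max_0_square: "((\<lambda>u::real. (max 0 u)\<^sup>2) has_real_derivative 2 * max 0 u) (at u)"
proof (cases "u = 0")
  case True
  have "((\<lambda>u::real. (max 0 u)\<^sup>2) has_real_derivative 0) (at 0)"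
    by (rule DERIV_quadratic_remainder[where \<delta>=1 and Q=1]) (auto simp: max_def)
  then show ?thesis using True by simp
next
  case False
  then consider "u > 0" | "u < 0" by linarith
  then show ?thesis
  proof cases
    case 1
    have "((\<lambda>u::real. u\<^sup>2) has_real_derivative 2 * max 0 u) (at u)"
      using 1 by (auto intro!: derivative_eq_intros)
    then show ?thesis
      by (rule has_field_derivative_transform_within_open[where S="{0<..}"]) (use 1 in auto)
  next
    case 2
    have "((\<lambda>u::real. 0) has_real_derivative 2 * max 0 u) (at u)"
      using 2 by (auto intro!: derivative_eq_intros)
    then show ?thesis
      by (rule has_field_derivative_transform_within_open[where S="{..<0}"]) (use 2 in auto)
  qed
qed

text \<open>A truncated paraboloid, squared so that the kink on the sphere of radius R disappears
  and the function is C1. For positive R its gradient is at most 4/R.\<close>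

definition cutoff :: "real \<Rightarrow> 'a::euclidean_space \<Rightarrow> real" where
  "cutoff R x = (max 0 (1 - (x \<bullet> x) / R\<^sup>2))\<^sup>2"

lemma cutoff_C1: "C1 (cutoff R :: 'a::euclidean_space \<Rightarrow> real)"
  and grad_cutoff: "grad (cutoff R :: 'a \<Rightarrow> real) = (\<lambda>x. - (4 * max 0 (1 - (x \<bullet> x) / R\<^sup>2) / R\<^sup>2) *\<^sub>R x)"
proof -
  have deriv: "(cutoff R has_derivative (\<lambda>h. h \<bullet> (- (4 * max 0 (1 - (x \<bullet> x) / R\<^sup>2) / R\<^sup>2) *\<^sub>R x))) (at x)" for x :: 'a
  proof -
    \<comment> \<open>For \<open>R = 0\<close> division by zero yields 0: the function is constant
      and the formula gives derivative 0.\<close>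
    have "((\<lambda>x::'a. 1 - (x \<bullet> x) / R\<^sup>2) has_derivative (\<lambda>h. - (2 * (h \<bullet> x) / R\<^sup>2))) (at x)"
      by (cases "R = 0") (auto intro!: derivative_eq_intros
          simp: inner_commute fun_eq_iff field_simps power2_eq_square power4_eq_xxxx)
    from DERIV_compose_FDERIV[OF DERIV_max_0_square this] show ?thesis
      unfolding cutoff_def by (rule has_derivative_eq_rhs) (auto simp: fun_eq_iff)
  qed
  have cont: "continuous_on UNIV (\<lambda>x::'a. - (4 * max 0 (1 - (x \<bullet> x) / R\<^sup>2) / R\<^sup>2) *\<^sub>R x)"
    by (cases "R = 0") (auto intro!: continuous_intros)
  show "C1 (cutoff R :: 'a \<Rightarrow> real)"
    by (rule C1I(1)[OF deriv cont])
  show "grad (cutoff R) = (\<lambda>x :: 'a. - (4 * max 0 (1 - (x \<bullet> x) / R\<^sup>2) / R\<^sup>2) *\<^sub>R x)"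
    by (rule C1I(2)[OF deriv cont])
qed

lemma cutoff_bounds: "0 \<le> cutoff R x" "cutoff R x \<le> 1"
  by (auto simp: cutoff_def power2_eq_square max_def mult_le_one)

lemma cutoff_support:
  assumes "0 < R" "x \<notin> cball 0 R"
  shows "1 - (x \<bullet> x) / R\<^sup>2 < 0"
proof -
  have "R\<^sup>2 < (norm x)\<^sup>2" using assms by (intro power_strict_mono) auto
  then show ?thesis using assms by (simp add: power2_norm_eq_inner)
qed

lemma norm_grad_cutoff:
  fixes x :: "'a::euclidean_space"
  assumes R: "0 < R"
  shows "norm (grad (cutoff R) x) \<le> 4 / R"
proof (cases "x \<in> cball 0 R")
  case True
  have "max 0 (1 - (x \<bullet> x) / R\<^sup>2) \<le> 1" by simp
  then have "max 0 (1 - (x \<bullet> x) / R\<^sup>2) * norm x \<le> 1 * R"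
    using True by (intro mult_mono) auto
  then have "4 / R\<^sup>2 * (max 0 (1 - (x \<bullet> x) / R\<^sup>2) * norm x) \<le> 4 / R\<^sup>2 * R"
    by (intro mult_left_mono) auto
  then show ?thesis using R by (simp add: grad_cutoff power2_eq_square abs_mult)
next
  case False
  then show ?thesis using cutoff_support[OF R False] R by (simp add: grad_cutoff max_def)
qed

lemma cutoff_tendsto_1: "(\<lambda>n. cutoff (real (Suc n)) x) \<longlonglongrightarrow> 1"
proof -
  have "(\<lambda>n. 1 / real (Suc n)) \<longlonglongrightarrow> 0" by (rule lim_1_over_n[THEN LIMSEQ_Suc])
  then have "(\<lambda>n. (max 0 (1 - (x \<bullet> x) * (1 / real (Suc n))\<^sup>2))\<^sup>2) \<longlonglongrightarrow> (max 0 (1 - (x \<bullet> x) * 0\<^sup>2))\<^sup>2"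
    by (intro tendsto_intros)
  then show ?thesis by (simp add: cutoff_def power_divide)
qed

text \<open>The summands of the divergence need not be integrable one by one, so each
  \<open>Y b\<close> is first multiplied by a cutoff. The cut-off fields satisfy the directional
  lemma, and moving the derivative onto the cutoff leaves an error of order 1/(n+1) because each
  \<open>Y b\<close> is integrable. On the other side dominated convergence uses only integrability
  of the sum.\<close>

lemma integral_divergence_eq_0:
  fixes Y :: "'b \<Rightarrow> 'a::euclidean_space \<Rightarrow> real" and e :: "'b \<Rightarrow> 'a"
  assumes I: "finite I" and e: "\<And>b. b \<in> I \<Longrightarrow> norm (e b) \<le> 1"
    and C1: "\<And>b. b \<in> I \<Longrightarrow> C1 (Y b)" and int: "\<And>b. b \<in> I \<Longrightarrow> integrable lborel (Y b)"
    and div: "integrable lborel (\<lambda>x. \<Sum>b\<in>I. e b \<bullet> grad (Y b) x)"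
  shows "(LINT x|lborel. (\<Sum>b\<in>I. e b \<bullet> grad (Y b) x)) = 0"
proof -
  let ?D = "\<lambda>x. \<Sum>b\<in>I. e b \<bullet> grad (Y b) x"
  define \<kappa> where "\<kappa> n = (cutoff (real (Suc n)) :: 'a \<Rightarrow> real)" for n
  have \<kappa>_C1: "C1 (\<kappa> n)" for n by (simp add: \<kappa>_def cutoff_C1)
  note [measurable] = C1_borel[OF \<kappa>_C1] C1_grad_borel[OF \<kappa>_C1]
  have supp: "\<kappa> n x = 0" "grad (\<kappa> n) x = 0" if "x \<notin> cball 0 (real (Suc n))" for n x
    using cutoff_support[OF _ that] unfolding \<kappa>_def grad_cutoff cutoff_def by (auto simp: max_def)
  have zero: "integrable lborel (\<lambda>x. \<kappa> n x * (e b \<bullet> grad (Y b) x))" (is ?i1)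
    "integrable lborel (\<lambda>x. Y b x * (e b \<bullet> grad (\<kappa> n) x))" (is ?i2)
    "(LINT x|lborel. \<kappa> n x * (e b \<bullet> grad (Y b) x)) = - (LINT x|lborel. Y b x * (e b \<bullet> grad (\<kappa> n) x))" (is ?eq)
    if b: "b \<in> I" for n b
  proof -
    note cont = continuous_intros C1_continuous[OF \<kappa>_C1] C1_continuous[OF C1[OF b]]
      C1_grad_continuous_compose[OF \<kappa>_C1] C1_grad_continuous_compose[OF C1[OF b]]
    show i1: ?i1
      by (rule integrable_continuous_compact_support[OF _ compact_cball[of 0 "real (Suc n)"]])
        (auto intro!: cont simp: supp simp del: of_nat_Suc)
    show i2: ?i2
      by (rule integrable_continuous_compact_support[OF _ compact_cball[of 0 "real (Suc n)"]])
        (auto intro!: cont simp: supp simp del: of_nat_Suc)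
    have "(LINT x|lborel. e b \<bullet> grad (\<lambda>x. \<kappa> n x * Y b x) x) = 0"
    proof (rule integral_directional_derivative_eq_0)
      show "integrable lborel (\<lambda>x. \<kappa> n x * Y b x)"
        by (rule integrable_continuous_compact_support[OF _ compact_cball[of 0 "real (Suc n)"]])
          (auto intro!: cont simp: supp simp del: of_nat_Suc)
      show "integrable lborel (\<lambda>x. e b \<bullet> grad (\<lambda>x. \<kappa> n x * Y b x) x)"
        using i1 i2 by (simp add: C1_mult(2)[OF \<kappa>_C1 C1[OF b]] inner_add_right)
      show "((\<lambda>t. \<kappa> n (x + t *\<^sub>R e b) * Y b (x + t *\<^sub>R e b)) has_real_derivative
          e b \<bullet> grad (\<lambda>x. \<kappa> n x * Y b x) x) (at 0)" for x
        using C1_DERIV_line[OF C1_mult(1)[OF \<kappa>_C1 C1[OF b]], of n x "e b" 0] by simp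
      show "continuous_on UNIV (\<lambda>t. e b \<bullet> grad (\<lambda>x. \<kappa> n x * Y b x) (x + t *\<^sub>R e b))" for x
        by (intro continuous_intros C1_grad_continuous_compose C1_mult \<kappa>_C1 C1 b)
    qed
    then show ?eq
      using i1 i2 by (simp add: C1_mult(2)[OF \<kappa>_C1 C1[OF b]] inner_add_right)
  qed
  have "(\<lambda>n. LINT x|lborel. \<kappa> n x * ?D x) \<longlonglongrightarrow> (LINT x|lborel. 1 * ?D x)"
  proof (rule integral_dominated_convergence[where w="\<lambda>x. \<bar>?D x\<bar>"])
    show "integrable lborel (\<lambda>x. \<bar>?D x\<bar>)" using div by (rule integrable_abs)
    show "AE x in lborel. (\<lambda>n. \<kappa> n x * ?D x) \<longlonglongrightarrow> 1 * ?D x"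
      unfolding \<kappa>_def by (intro AE_I2 tendsto_intros cutoff_tendsto_1)
    show "AE x in lborel. norm (\<kappa> n x * ?D x) \<le> \<bar>?D x\<bar>" for n
      by (intro AE_I2)
        (simp add: \<kappa>_def abs_mult abs_of_nonneg cutoff_bounds mult_left_le_one_le del: of_nat_Suc)
    show "(\<lambda>x. 1 * ?D x) \<in> borel_measurable lborel" using div by simp
    show "(\<lambda>x. \<kappa> n x * ?D x) \<in> borel_measurable lborel" for n
      using borel_measurable_integrable[OF div] by measurable
  qed
  moreover have "(\<lambda>n. LINT x|lborel. \<kappa> n x * ?D x) \<longlonglongrightarrow> 0"
  proof (rule Lim_null_comparison)
    let ?C = "\<Sum>b\<in>I. 4 * (LINT x|lborel. \<bar>Y b x\<bar>)"
    have "\<bar>LINT x|lborel. \<kappa> n x * ?D x\<bar> \<le> ?C * (1 / real (Suc n))" for n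
    proof -
      have "(LINT x|lborel. \<kappa> n x * ?D x) = (\<Sum>b\<in>I. - (LINT x|lborel. Y b x * (e b \<bullet> grad (\<kappa> n) x)))"
        using zero by (simp add: sum_distrib_left)
      also have "\<bar>\<dots>\<bar> \<le> (\<Sum>b\<in>I. \<bar>LINT x|lborel. Y b x * (e b \<bullet> grad (\<kappa> n) x)\<bar>)"
        by (rule order_trans[OF sum_abs]) simp
      also have "\<dots> \<le> (\<Sum>b\<in>I. 4 * (LINT x|lborel. \<bar>Y b x\<bar>) * (1 / real (Suc n)))"
      proof (rule sum_mono)
        fix b assume b: "b \<in> I"
        have "\<bar>LINT x|lborel. Y b x * (e b \<bullet> grad (\<kappa> n) x)\<bar> \<le> (LINT x|lborel. \<bar>Y b x * (e b \<bullet> grad (\<kappa> n) x)\<bar>)"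
          by (rule integral_abs_bound)
        also have "\<dots> \<le> (LINT x|lborel. (4 / real (Suc n)) * \<bar>Y b x\<bar>)"
        proof (rule integral_mono)
          show "integrable lborel (\<lambda>x. \<bar>Y b x * (e b \<bullet> grad (\<kappa> n) x)\<bar>)"
            using zero(2)[OF b] by (rule integrable_abs)
          show "integrable lborel (\<lambda>x. (4 / real (Suc n)) * \<bar>Y b x\<bar>)"
            using int[OF b] by (intro integrable_mult_right integrable_abs)
          fix x
          have "\<bar>e b \<bullet> grad (\<kappa> n) x\<bar> \<le> norm (e b) * norm (grad (\<kappa> n) x)"
            by (rule Cauchy_Schwarz_ineq2)
          also have "\<dots> \<le> 1 * (4 / real (Suc n))"
            unfolding \<kappa>_def by (intro mult_mono e b norm_grad_cutoff) auto
          finally show "\<bar>Y b x * (e b \<bullet> grad (\<kappa> n) x)\<bar> \<le> (4 / real (Suc n)) * \<bar>Y b x\<bar>"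
            unfolding abs_mult by (subst mult.commute) (rule mult_right_mono; simp)
        qed
        finally show "\<bar>LINT x|lborel. Y b x * (e b \<bullet> grad (\<kappa> n) x)\<bar> \<le> 4 * (LINT x|lborel. \<bar>Y b x\<bar>) * (1 / real (Suc n))"
          by simp
      qed
      finally show ?thesis by (simp only: sum_distrib_right)
    qed
    then show "\<forall>\<^sub>F n in sequentially. norm (LINT x|lborel. \<kappa> n x * ?D x) \<le> ?C * (1 / real (Suc n))"
      by simp
    have "(\<lambda>n. ?C * (1 / real (Suc n))) \<longlonglongrightarrow> ?C * 0"
      by (intro tendsto_intros lim_1_over_n[THEN LIMSEQ_Suc])
    then show "(\<lambda>n. ?C * (1 / real (Suc n))) \<longlonglongrightarrow> 0" by simp
  qed
  ultimately show ?thesis using LIMSEQ_unique by fastforce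
qed

subsection \<open>A criterion for pre-GENERIC equations\<close>

lemma (in regular_state) H1_lincomb:
  assumes "\<xi> \<in> H1 \<rho>" "\<eta> \<in> H1 \<rho>"
  shows "(\<lambda>x. a * \<xi> x + b * \<eta> x) \<in> H1 \<rho>"
proof -
  have C1: "C1 \<xi>" "C1 \<eta>" using assms by (auto simp: H1_C1)
  note [measurable] = C1_grad_borel[OF C1(1)] C1_grad_borel[OF C1(2)]
  have bound: "(norm (a *\<^sub>R grad \<xi> x + b *\<^sub>R grad \<eta> x))\<^sup>2 * \<rho> x \<le>
      2 * a\<^sup>2 * ((norm (grad \<xi> x))\<^sup>2 * \<rho> x) + 2 * b\<^sup>2 * ((norm (grad \<eta> x))\<^sup>2 * \<rho> x)" for x
  proof -
    have "0 \<le> (norm (a *\<^sub>R grad \<xi> x - b *\<^sub>R grad \<eta> x))\<^sup>2" by simp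
    then have "(norm (a *\<^sub>R grad \<xi> x + b *\<^sub>R grad \<eta> x))\<^sup>2 \<le>
        2 * (norm (a *\<^sub>R grad \<xi> x))\<^sup>2 + 2 * (norm (b *\<^sub>R grad \<eta> x))\<^sup>2"
      unfolding power2_norm_eq_inner by (simp add: inner_diff inner_add inner_commute)
    from mult_right_mono[OF this \<rho>_nonneg[of x]] show ?thesis
      by (simp add: power_mult_distrib algebra_simps)
  qed
  have "integrable lborel (\<lambda>x. (norm (a *\<^sub>R grad \<xi> x + b *\<^sub>R grad \<eta> x))\<^sup>2 * \<rho> x)"
  proof (rule Bochner_Integration.integrable_bound)
    show "integrable lborel (\<lambda>x. 2 * a\<^sup>2 * ((norm (grad \<xi> x))\<^sup>2 * \<rho> x) + 2 * b\<^sup>2 * ((norm (grad \<eta> x))\<^sup>2 * \<rho> x))"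
      using assms by (intro Bochner_Integration.integrable_add integrable_mult_right) (auto simp: H1_def)
    show "AE x in lborel. norm ((norm (a *\<^sub>R grad \<xi> x + b *\<^sub>R grad \<eta> x))\<^sup>2 * \<rho> x) \<le>
        norm (2 * a\<^sup>2 * ((norm (grad \<xi> x))\<^sup>2 * \<rho> x) + 2 * b\<^sup>2 * ((norm (grad \<eta> x))\<^sup>2 * \<rho> x))"
    proof (rule AE_I2)
      fix x
      have "0 \<le> (norm (a *\<^sub>R grad \<xi> x + b *\<^sub>R grad \<eta> x))\<^sup>2 * \<rho> x" using \<rho>_nonneg by simp
      then show "norm ((norm (a *\<^sub>R grad \<xi> x + b *\<^sub>R grad \<eta> x))\<^sup>2 * \<rho> x) \<le>
          norm (2 * a\<^sup>2 * ((norm (grad \<xi> x))\<^sup>2 * \<rho> x) + 2 * b\<^sup>2 * ((norm (grad \<eta> x))\<^sup>2 * \<rho> x))"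
        using bound[of x] unfolding real_norm_def by linarith
    qed
  qed measurable
  then show ?thesis
    using C1 by (simp add: H1_def C1_lincomb C1_grad_lincomb)
qed

text \<open>Isolates what depends on the potential. On \<open>C \<rho>\<close> the difference of
  evolution and Hamiltonian part is \<open>adjoint_gen G \<rho>\<close>, and
  \<open>hamiltonian_dS\<close> gives \<open>F dS\<close> the same value as
  \<open>adjoint_gen G \<rho> dS\<close>, so \<open>pre_GENERIC_balance\<close> applies to the
  generator alone.\<close>

lemma pre_GENERIC_legendreI:
  fixes m :: real and V \<Phi> :: "real^'d::finite \<Rightarrow> real" and G :: "'d fn \<Rightarrow> 'd fn"
    and C :: "'d fn \<Rightarrow> 'd fn set"
  assumes M: "\<And>\<rho>. \<rho> \<in> M \<Longrightarrow> regular_state m V \<Phi> \<rho>"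
    and C: "\<And>\<rho>. \<rho> \<in> M \<Longrightarrow> C \<rho> \<subseteq> H1 \<rho>"
    and scale: "\<And>\<rho> \<xi> c. \<rho> \<in> M \<Longrightarrow> \<xi> \<in> C \<rho> \<Longrightarrow> (\<lambda>x. c * \<xi> x) \<in> C \<rho>"
    and dS: "\<And>\<rho>. \<rho> \<in> M \<Longrightarrow> d_entropy m V \<Phi> \<rho> \<in> C \<rho>"
    and G: "\<And>\<rho>. \<rho> \<in> M \<Longrightarrow> adjoint_gen G \<rho> \<in> tangent (C \<rho>) \<rho>"
    and zero: "\<And>\<rho>. \<rho> \<in> M \<Longrightarrow> \<Psi>s \<rho> (\<lambda>_. 0) = 0"
    and nonneg: "\<And>\<rho> \<xi>. \<rho> \<in> M \<Longrightarrow> \<xi> \<in> C \<rho> \<Longrightarrow> 0 \<le> \<Psi>s \<rho> \<xi>"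
    and even: "\<And>\<rho> \<xi>. \<rho> \<in> M \<Longrightarrow> \<xi> \<in> C \<rho> \<Longrightarrow> \<Psi>s \<rho> (\<lambda>x. - \<xi> x) = \<Psi>s \<rho> \<xi>"
    and convex: "\<And>\<rho> \<xi> \<eta> t. \<rho> \<in> M \<Longrightarrow> \<xi> \<in> C \<rho> \<Longrightarrow> \<eta> \<in> C \<rho> \<Longrightarrow> t \<in> {0..1} \<Longrightarrow>
       \<Psi>s \<rho> (\<lambda>x. (1 - t) * \<xi> x + t * \<eta> x) \<le> ereal (1 - t) * \<Psi>s \<rho> \<xi> + ereal t * \<Psi>s \<rho> \<eta>"
    and bidual: "\<And>\<rho> \<xi>. \<rho> \<in> M \<Longrightarrow> \<xi> \<in> C \<rho> \<Longrightarrow>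
       \<Psi>s \<rho> \<xi> \<le> (SUP v\<in>tangent (C \<rho>) \<rho>. ereal (v \<xi>) - legendre C \<Psi>s \<rho> v)"
    and fin: "\<And>\<rho>. \<rho> \<in> M \<Longrightarrow> \<exists>s. \<Psi>s \<rho> (\<lambda>x. - (1/2) * d_entropy m V \<Phi> \<rho> x) = ereal s"
    and opt: "\<And>\<rho> \<xi>. \<rho> \<in> M \<Longrightarrow> \<xi> \<in> C \<rho> \<Longrightarrow>
       ereal (adjoint_gen G \<rho> \<xi>) - \<Psi>s \<rho> \<xi> \<le>
       ereal (adjoint_gen G \<rho> (\<lambda>x. - (1/2) * d_entropy m V \<Phi> \<rho> x))
         - \<Psi>s \<rho> (\<lambda>x. - (1/2) * d_entropy m V \<Phi> \<rho> x)"
  shows "pre_GENERIC M C (evolution G m V \<Phi>) (entropy m V \<Phi>) (d_entropy m V \<Phi>)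
    (\<lambda>\<rho>. L \<rho> (d_energy m V \<Phi> \<rho>)) (legendre C \<Psi>s) \<Psi>s"
proof -
  have "(\<lambda>_. 0) \<in> C \<rho>" if "\<rho> \<in> M" for \<rho>
    using scale[OF that dS[OF that], of 0] by simp
  then have "dissipation_potentials M C (legendre C \<Psi>s) \<Psi>s"
    by (intro dissipation_potentials_legendreI zero nonneg convex bidual)
  moreover have "symmetric_potentials M C (legendre C \<Psi>s) \<Psi>s"
    using scale[where c="-1"] by (intro symmetric_potentials_legendreI even) auto
  moreover have "has_functional_derivative (entropy m V \<Phi>) (d_entropy m V \<Phi> \<rho>) \<rho> \<and>
      d_entropy m V \<Phi> \<rho> \<in> C \<rho> \<and>
      evolution G m V \<Phi> \<rho> \<in> tangent (C \<rho>) \<rho> \<and> L \<rho> (d_energy m V \<Phi> \<rho>) \<in> tangent (C \<rho>) \<rho> \<and>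
      L \<rho> (d_energy m V \<Phi> \<rho>) (d_entropy m V \<Phi> \<rho>) = 0 \<and>
      legendre C \<Psi>s \<rho> (\<lambda>\<xi>. evolution G m V \<Phi> \<rho> \<xi> - L \<rho> (d_energy m V \<Phi> \<rho>) \<xi>) +
      \<Psi>s \<rho> (\<lambda>x. - (1/2) * d_entropy m V \<Phi> \<rho> x) +
      ereal (1/2 * evolution G m V \<Phi> \<rho> (d_entropy m V \<Phi> \<rho>)) = 0" if mem: "\<rho> \<in> M" for \<rho>
  proof -
    interpret regular_state m V \<Phi> \<rho> using mem by (rule M)
    let ?F = "evolution G m V \<Phi> \<rho>" and ?W = "L \<rho> dE" and ?G = "adjoint_gen G \<rho>"
    note G = G[OF mem] and C = subsetD[OF C[OF mem]] and dS = dS[OF mem]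
    have W: "?W \<in> tangent (C \<rho>) \<rho>"
      using hamiltonian_tangent tangent_mono[of "C \<rho>" "H1 \<rho>" \<rho>] C by blast
    have WG: "(\<lambda>\<eta>. ?W \<eta> + ?G \<eta>) \<in> tangent (C \<rho>) \<rho>"
      using W G by (rule tangent_add)
    obtain c where c: "\<And>\<xi>. \<xi> \<in> C \<rho> \<Longrightarrow> \<bar>?W \<xi> + ?G \<xi>\<bar> \<le> c * H1_seminorm \<rho> \<xi>"
      using WG unfolding tangent_def by blast
    \<comment> \<open>Linear combinations of elements of \<open>C \<rho>\<close> may leave
      \<open>C \<rho>\<close>, but they stay in \<open>H1 \<rho>\<close>, where
      \<open>evolution_eq\<close> still holds; linearity is therefore inherited from
      \<open>WG\<close>.\<close>
    have F: "?F \<in> tangent (C \<rho>) \<rho>"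
      using tangent_linear[OF WG] c
      by (intro tangentI[where c=c]) (simp_all add: evolution_eq C H1_lincomb)
    obtain s where s: "\<Psi>s \<rho> (\<lambda>x. - (1/2) * dS x) = ereal s"
      using fin[OF mem] by blast
    have "legendre C \<Psi>s \<rho> ?G + \<Psi>s \<rho> (\<lambda>x. - (1/2) * dS x) + ereal (1/2 * ?G dS) = 0"
      by (rule pre_GENERIC_balance[where C=C and \<Psi>s=\<Psi>s and \<rho>=\<rho>,
            OF G dS scale[OF mem dS, of "- (1/2)"] s opt[OF mem]])
    moreover have "legendre C \<Psi>s \<rho> (\<lambda>\<xi>. ?F \<xi> - ?W \<xi>) = legendre C \<Psi>s \<rho> ?G"
      unfolding legendre_def by (intro SUP_cong refl) (simp add: evolution_eq C)
    moreover have "?F dS = ?G dS"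
      by (simp add: evolution_eq dS_H1 hamiltonian_dS)
    ultimately show ?thesis
      using entropy_functional_derivative dS F W hamiltonian_dS by simp
  qed
  ultimately show ?thesis unfolding pre_GENERIC_def by blast
qed

subsection \<open>The Vlasov--Fokker--Planck equation\<close>

text \<open>The symmetric bilinear form whose diagonal, multiplied by \<open>\<gamma>\<close>, is
  the Vlasov-Fokker-Planck potential.\<close>

definition dirichlet_p :: "'d::finite fn \<Rightarrow> 'd fn \<Rightarrow> 'd fn \<Rightarrow> real" where
  "dirichlet_p \<rho> \<xi> \<eta> = (LINT x|lborel. (snd (grad \<xi> x) \<bullet> snd (grad \<eta> x)) * \<rho> x)"

definition grad_p_C1 :: "'d::finite fn \<Rightarrow> bool" where
  "grad_p_C1 \<xi> \<longleftrightarrow> C1 \<xi> \<and> (\<forall>b\<in>Basis. C1 (\<lambda>x. grad_p \<xi> x \<bullet> b))"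

text \<open>Rewrites a trace in velocity space as a sum of derivatives along \<open>(0, b)\<close>
  in phase space, the shape required by \<open>integral_divergence_eq_0\<close>.\<close>

lemma laplacian_p_eq:
  assumes "grad_p_C1 \<xi>"
  shows "laplacian_p \<xi> x = (\<Sum>b\<in>Basis. (0, b) \<bullet> grad (\<lambda>x. grad_p \<xi> x \<bullet> b) x)"
proof -
  obtain q p where x: "x = (q, p)" by force
  let ?g = "\<lambda>b x. grad_p \<xi> x \<bullet> b"
  let ?D = "\<lambda>h. \<Sum>b\<in>Basis. ((0, h) \<bullet> grad (?g b) (q, p)) *\<^sub>R b"
  have "((\<lambda>p'. \<Sum>b\<in>Basis. ?g b (q, p') *\<^sub>R b) has_derivative ?D) (at p)"
  proof (rule has_derivative_sum)
    fix b :: "real^'a" assume b: "b \<in> Basis"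
    have "((\<lambda>p'. ?g b (q, p')) has_derivative (\<lambda>h. (0, h) \<bullet> grad (?g b) (q, p))) (at p)"
      by (rule has_derivative_compose[where g="?g b" and f="\<lambda>p'. (q, p')", THEN has_derivative_eq_rhs])
        (use assms b in \<open>auto intro!: derivative_eq_intros C1_has_derivative simp: grad_p_C1_def\<close>)
    then show "((\<lambda>p'. ?g b (q, p') *\<^sub>R b) has_derivative (\<lambda>h. ((0, h) \<bullet> grad (?g b) (q, p)) *\<^sub>R b)) (at p)"
      by (rule has_derivative_scaleR_left)
  qed
  then have "((\<lambda>p'. grad_p \<xi> (q, p')) has_derivative ?D) (at p)"
    by (simp add: euclidean_representation)
  then have "frechet_derivative (\<lambda>p'. grad_p \<xi> (q, p')) (at p) = ?D"
    by (rule frechet_derivative_at[symmetric])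
  moreover have "?D b \<bullet> b = (0, b) \<bullet> grad (?g b) (q, p)" if "b \<in> Basis" for b
    using that by (simp add: inner_sum_left inner_Basis if_distrib sum.delta cong: if_cong)
  ultimately show ?thesis
    by (simp add: x laplacian_p_def divergence_def grad_p_def)
qed

lemma grad_p_scale: "C1 \<xi> \<Longrightarrow> grad_p (\<lambda>x. c * \<xi> x) x = c *\<^sub>R grad_p \<xi> x"
  by (simp add: grad_p_eq C1_scale grad_scale)

lemma grad_p_C1_scale:
  assumes "grad_p_C1 \<xi>" shows "grad_p_C1 (\<lambda>x. c * \<xi> x)"
  using assms by (auto simp: grad_p_C1_def grad_p_scale C1_scale)

lemma vfp_gen_scale:
  assumes "grad_p_C1 \<xi>" shows "vfp_gen m \<gamma> (\<lambda>x. c * \<xi> x) x = c * vfp_gen m \<gamma> \<xi> x"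
proof -
  have "laplacian_p (\<lambda>x. c * \<xi> x) x = c * laplacian_p \<xi> x"
    unfolding laplacian_p_eq[OF assms] laplacian_p_eq[OF grad_p_C1_scale[OF assms]]
    using assms by (simp add: grad_p_C1_def grad_p_scale grad_scale sum_distrib_left)
  then show ?thesis
    using assms by (cases x) (simp add: vfp_gen_def grad_p_C1_def grad_p_scale algebra_simps)
qed

lemma vfp_cotangent_scale:
  assumes "\<xi> \<in> cotangent (vfp_dom m \<gamma>) \<rho>"
  shows "(\<lambda>x. c * \<xi> x) \<in> cotangent (vfp_dom m \<gamma>) \<rho>"
proof -
  have H: "\<xi> \<in> H1 \<rho>" and g: "grad_p_C1 \<xi>" and int: "integrable lborel (\<lambda>x. vfp_gen m \<gamma> \<xi> x * \<rho> x)"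
    using assms by (auto simp: cotangent_alt vfp_dom_def grad_p_C1_def H1_C1)
  have "integrable lborel (\<lambda>x. c * (vfp_gen m \<gamma> \<xi> x * \<rho> x))"
    using int by simp
  then show ?thesis
    using H1_scale[OF H] grad_p_C1_scale[OF g]
    by (simp add: cotangent_alt vfp_dom_def grad_p_C1_def vfp_gen_scale[OF g] mult.assoc)
qed

context regular_state
begin

lemma dirichlet_p:
  assumes \<xi>: "\<xi> \<in> H1 \<rho>"
  shows "\<eta> \<in> H1 \<rho> \<Longrightarrow> integrable lborel (\<lambda>x. (snd (grad \<xi> x) \<bullet> snd (grad \<eta> x)) * \<rho> x)"
    and "dirichlet_p \<rho> \<xi> \<in> tangent (H1 \<rho>) \<rho>"
proof -
  have eq: "(0, snd (grad \<xi> x)) \<bullet> grad \<eta> x = snd (grad \<xi> x) \<bullet> snd (grad \<eta> x)" for \<eta> x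
    by (simp add: inner_prod_def)
  have meas: "(\<lambda>x. (0 :: real^'d, snd (grad \<xi> x))) \<in> borel_measurable borel"
    using H1_C1[OF \<xi>] by (intro borel_measurable_continuous_onI continuous_intros) (simp add: C1_def)
  have L2: "integrable lborel (\<lambda>x. (norm (0 :: real^'d, snd (grad \<xi> x)))\<^sup>2 * \<rho> x)"
    using \<xi> by (intro weighted_L2_mono[OF meas borel(1) \<rho>_nonneg, where Y="grad \<xi>"])
      (auto simp: norm_Pair norm_snd_le_norm H1_def)
  show "\<eta> \<in> H1 \<rho> \<Longrightarrow> integrable lborel (\<lambda>x. (snd (grad \<xi> x) \<bullet> snd (grad \<eta> x)) * \<rho> x)"
    using tangent_H1_integral(2)[OF \<rho>_nonneg borel(1) meas L2] by (simp add: eq)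
  show "dirichlet_p \<rho> \<xi> \<in> tangent (H1 \<rho>) \<rho>"
    using tangent_H1_integral(1)[OF \<rho>_nonneg borel(1) meas L2]
    by (simp add: eq dirichlet_p_def[abs_def])
qed

lemma dirichlet_p_commute: "dirichlet_p \<rho> \<xi> \<eta> = dirichlet_p \<rho> \<eta> \<xi>"
  by (simp add: dirichlet_p_def inner_commute)

lemma dirichlet_p_scale_left: "\<xi> \<in> H1 \<rho> \<Longrightarrow> \<eta> \<in> H1 \<rho> \<Longrightarrow> dirichlet_p \<rho> (\<lambda>x. c * \<xi> x) \<eta> = c * dirichlet_p \<rho> \<xi> \<eta>"
  using tangent_scale[OF dirichlet_p(2)] dirichlet_p_commute by metis

text \<open>The completed square, with equality at \<open>\<eta> = \<xi>\<close>. It serves the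
  optimality of \<open>- dS/2\<close>, biduality and convexity.\<close>

lemma dirichlet_p_Young:
  assumes "\<xi> \<in> H1 \<rho>" "\<eta> \<in> H1 \<rho>"
  shows "2 * dirichlet_p \<rho> \<xi> \<eta> - dirichlet_p \<rho> \<eta> \<eta> \<le> dirichlet_p \<rho> \<xi> \<xi>"
proof -
  note int = dirichlet_p(1)[OF assms(1,1)] dirichlet_p(1)[OF assms(1,2)] dirichlet_p(1)[OF assms(2,2)]
  have "0 \<le> (LINT x|lborel. (norm (snd (grad \<xi> x) - snd (grad \<eta> x)))\<^sup>2 * \<rho> x)"
    using \<rho>_nonneg by simp
  also have "\<dots> = (LINT x|lborel. (snd (grad \<xi> x) \<bullet> snd (grad \<xi> x)) * \<rho> x
      - 2 * ((snd (grad \<xi> x) \<bullet> snd (grad \<eta> x)) * \<rho> x) + (snd (grad \<eta> x) \<bullet> snd (grad \<eta> x)) * \<rho> x)"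
    unfolding power2_norm_eq_inner by (simp add: inner_diff inner_commute algebra_simps)
  also have "\<dots> = dirichlet_p \<rho> \<xi> \<xi> - 2 * dirichlet_p \<rho> \<xi> \<eta> + dirichlet_p \<rho> \<eta> \<eta>"
    using int by (simp add: dirichlet_p_def)
  finally show ?thesis by simp
qed

lemma vfp_Psi_star_eq:
  assumes "0 < \<gamma>" "\<xi> \<in> H1 \<rho>"
  shows "vfp_Psi_star \<gamma> \<rho> \<xi> = ereal (\<gamma> * dirichlet_p \<rho> \<xi> \<xi>)"
proof -
  have eq: "(norm (grad_p \<xi> x))\<^sup>2 = snd (grad \<xi> x) \<bullet> snd (grad \<xi> x)" for x
    by (simp add: grad_p_eq[OF H1_C1[OF assms(2)]] power2_norm_eq_inner)
  have "(\<integral>\<^sup>+x. ennreal ((norm (grad_p \<xi> x))\<^sup>2 * \<rho> x) \<partial>lborel) = ennreal (dirichlet_p \<rho> \<xi> \<xi>)"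
    unfolding eq dirichlet_p_def using dirichlet_p(1)[OF assms(2,2)] \<rho>_nonneg
    by (intro nn_integral_eq_integral) auto
  moreover have "0 \<le> dirichlet_p \<rho> \<xi> \<xi>"
    unfolding dirichlet_p_def using \<rho>_nonneg by simp
  ultimately show ?thesis
    using assms(1) by (simp add: vfp_Psi_star_def ennreal_mult[symmetric])
qed

text \<open>Expand the diagonal value at the mixture in one slot only and bound each term by Young;
  half of the result is again the diagonal value and is absorbed.\<close>

lemma dirichlet_p_convex:
  assumes "\<xi> \<in> H1 \<rho>" "\<eta> \<in> H1 \<rho>" "t \<in> {0..1}"
  shows "dirichlet_p \<rho> (\<lambda>x. (1 - t) * \<xi> x + t * \<eta> x) (\<lambda>x. (1 - t) * \<xi> x + t * \<eta> x)
    \<le> (1 - t) * dirichlet_p \<rho> \<xi> \<xi> + t * dirichlet_p \<rho> \<eta> \<eta>"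
proof -
  let ?\<zeta> = "\<lambda>x. (1 - t) * \<xi> x + t * \<eta> x"
  have \<zeta>: "?\<zeta> \<in> H1 \<rho>" using assms by (intro H1_lincomb)
  have "dirichlet_p \<rho> ?\<zeta> ?\<zeta> = (1 - t) * dirichlet_p \<rho> ?\<zeta> \<xi> + t * dirichlet_p \<rho> ?\<zeta> \<eta>"
    using tangent_linear[OF dirichlet_p(2)[OF \<zeta>] assms(1,2)] .
  moreover have "(1 - t) * (2 * dirichlet_p \<rho> ?\<zeta> \<xi>) \<le> (1 - t) * (dirichlet_p \<rho> ?\<zeta> ?\<zeta> + dirichlet_p \<rho> \<xi> \<xi>)"
    using dirichlet_p_Young[OF \<zeta> assms(1)] assms(3) by (intro mult_left_mono) auto
  moreover have "t * (2 * dirichlet_p \<rho> ?\<zeta> \<eta>) \<le> t * (dirichlet_p \<rho> ?\<zeta> ?\<zeta> + dirichlet_p \<rho> \<eta> \<eta>)"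
    using dirichlet_p_Young[OF \<zeta> assms(2)] assms(3) by (intro mult_left_mono) auto
  ultimately show ?thesis by (simp add: algebra_simps)
qed

text \<open>The integral of the p-divergence of \<open>\<rho>\<close> times
  \<open>grad_p \<xi>\<close> vanishes. Its term with \<open>grad \<rho>\<close> splits into a
  \<open>dS\<close> part and a \<open>dE\<close> part; the latter cancels the friction term, because
  p/m is the p-gradient of \<open>dE\<close>.\<close>

lemma adjoint_vfp_gen:
  assumes "0 < \<gamma>" and \<xi>: "\<xi> \<in> cotangent (vfp_dom m \<gamma>) \<rho>"
  shows "adjoint_gen (vfp_gen m \<gamma>) \<rho> \<xi> = - \<gamma> * dirichlet_p \<rho> dS \<xi>"
proof -
  have H: "\<xi> \<in> H1 \<rho>" and g: "grad_p_C1 \<xi>" and int: "integrable lborel (\<lambda>x. vfp_gen m \<gamma> \<xi> x * \<rho> x)"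
    using \<xi> by (auto simp: cotangent_alt vfp_dom_def grad_p_C1_def H1_C1)
  note C1 = H1_C1[OF H]
  let ?g = "\<lambda>b x. grad_p \<xi> x \<bullet> b"
  let ?Y = "\<lambda>b x. \<rho> x * ?g b x"
  have gC1: "C1 (?g b)" if "b \<in> Basis" for b using g that by (simp add: grad_p_C1_def)
  let ?ES = "\<lambda>x. (snd (grad dS x) \<bullet> snd (grad \<xi> x)) * \<rho> x"
    and ?EE = "\<lambda>x. (snd (grad dE x) \<bullet> snd (grad \<xi> x)) * \<rho> x"
  note ES = dirichlet_p(1)[OF dS_H1 H] and EE = dirichlet_p(1)[OF dE_H1 H]
  have div: "(\<Sum>b\<in>Basis. (0, b) \<bullet> grad (?Y b) x) = laplacian_p \<xi> x * \<rho> x + (?ES x - ?EE x)" for x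
  proof -
    have "(\<Sum>b\<in>Basis. (0, b) \<bullet> grad (?Y b) x) =
        (\<Sum>b\<in>Basis. \<rho> x * ((0, b) \<bullet> grad (?g b) x) + ?g b x * ((0, b) \<bullet> grad \<rho> x))"
      by (intro sum.cong refl) (simp add: C1_mult(2)[OF \<rho> gC1] inner_add_right)
    also have "\<dots> = \<rho> x * laplacian_p \<xi> x + (\<Sum>b\<in>Basis. ?g b x * (b \<bullet> snd (grad \<rho> x)))"
      by (simp add: laplacian_p_eq[OF g] sum.distrib sum_distrib_left inner_prod_def)
    also have "(\<Sum>b\<in>Basis. ?g b x * (b \<bullet> snd (grad \<rho> x))) = grad_p \<xi> x \<bullet> snd (grad \<rho> x)"
      by (rule inner_prod_axis_sum[symmetric])
    also have "\<dots> = ?ES x - ?EE x"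
      by (simp add: grad_p_eq[OF C1] grad_\<rho> inner_diff_right inner_commute algebra_simps)
    finally show ?thesis by simp
  qed
  have gen: "vfp_gen m \<gamma> \<xi> x * \<rho> x = - \<gamma> * ?EE x + \<gamma> * (laplacian_p \<xi> x * \<rho> x)" for x
    by (simp add: vfp_gen_def split_beta' grad_p_eq[OF C1] snd_grad_dE algebra_simps)
  \<comment> \<open>The domain condition controls the whole generator only; the Laplacian is
    recovered by solving for it, the friction term being integrable by Cauchy-Schwarz.\<close>
  have lap: "integrable lborel (\<lambda>x. laplacian_p \<xi> x * \<rho> x)"
  proof -
    have "laplacian_p \<xi> x * \<rho> x = (1 / \<gamma>) * (vfp_gen m \<gamma> \<xi> x * \<rho> x) + ?EE x" for x
      unfolding gen using assms(1) by (simp add: field_simps)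
    then show ?thesis using int EE by simp
  qed
  have "(LINT x|lborel. (\<Sum>b\<in>Basis. (0, b) \<bullet> grad (?Y b) x)) = 0"
  proof (rule integral_divergence_eq_0)
    show "C1 (?Y b)" if "b \<in> Basis" for b using that by (intro C1_mult \<rho> gC1)
    show "integrable lborel (?Y b)" if b: "b \<in> Basis" for b
    proof (rule Bochner_Integration.integrable_bound[OF integrable_norm_grad[OF H]])
      show "?Y b \<in> borel_measurable lborel"
        using C1_borel[OF C1_mult(1)[OF \<rho> gC1[OF b]]] by simp
      show "AE x in lborel. norm (?Y b x) \<le> norm (norm (grad \<xi> x) * \<rho> x)"
      proof (rule AE_I2)
        fix x
        have "\<bar>?g b x\<bar> \<le> norm (grad \<xi> x)"
          using order_trans[OF Basis_le_norm[OF b] norm_snd_le_norm] by (simp add: grad_p_eq[OF C1])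
        from mult_left_mono[OF this \<rho>_nonneg[of x]] show "norm (?Y b x) \<le> norm (norm (grad \<xi> x) * \<rho> x)"
          using \<rho>_nonneg[of x] by (simp add: abs_mult mult.commute)
      qed
    qed
    show "integrable lborel (\<lambda>x. \<Sum>b\<in>Basis. (0, b) \<bullet> grad (?Y b) x)"
      unfolding div using lap ES EE by (intro Bochner_Integration.integrable_add Bochner_Integration.integrable_diff)
  qed (auto simp: norm_Pair)
  then have lap_eq: "(LINT x|lborel. laplacian_p \<xi> x * \<rho> x) + ((LINT x|lborel. ?ES x) - (LINT x|lborel. ?EE x)) = 0"
    unfolding div using lap ES EE by simp
  have adj: "adjoint_gen (vfp_gen m \<gamma>) \<rho> \<xi> =
      - \<gamma> * (LINT x|lborel. ?EE x) + \<gamma> * (LINT x|lborel. laplacian_p \<xi> x * \<rho> x)"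
  proof -
    have "integrable lborel (\<lambda>x. - \<gamma> * ?EE x)" "integrable lborel (\<lambda>x. \<gamma> * (laplacian_p \<xi> x * \<rho> x))"
      using EE lap by (intro integrable_mult_right; simp)+
    then show ?thesis
      unfolding adjoint_gen_def gen by (simp only: Bochner_Integration.integral_add integral_mult_right_zero)
  qed
  have "(LINT x|lborel. laplacian_p \<xi> x * \<rho> x) = (LINT x|lborel. ?EE x) - (LINT x|lborel. ?ES x)"
    using lap_eq by simp
  then show ?thesis
    unfolding dirichlet_p_def by (simp only: adj right_diff_distrib)
qed

end

theorem vfp_pre_GENERIC:
  fixes m \<gamma> :: real and V \<Phi> :: "real^'d::finite \<Rightarrow> real"
  assumes \<gamma>: "\<gamma> > 0" and M: "\<And>\<rho>. \<rho> \<in> M \<Longrightarrow> regular_state m V \<Phi> \<rho>"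
    and dS: "\<And>\<rho>. \<rho> \<in> M \<Longrightarrow> d_entropy m V \<Phi> \<rho> \<in> cotangent (vfp_dom m \<gamma>) \<rho>"
    and G: "\<And>\<rho>. \<rho> \<in> M \<Longrightarrow> adjoint_gen (vfp_gen m \<gamma>) \<rho> \<in> tangent (cotangent (vfp_dom m \<gamma>) \<rho>) \<rho>"
  defines "C \<equiv> cotangent (vfp_dom m \<gamma>)"
  shows "pre_GENERIC M C (evolution (vfp_gen m \<gamma>) m V \<Phi>) (entropy m V \<Phi>) (d_entropy m V \<Phi>)
    (\<lambda>\<rho>. L \<rho> (d_energy m V \<Phi> \<rho>)) (legendre C (vfp_Psi_star \<gamma>)) (vfp_Psi_star \<gamma>)"
proof -
  have scale: "(\<lambda>x. c * \<xi> x) \<in> C \<rho>" if "\<xi> \<in> C \<rho>" for c \<xi> \<rho>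
    using that unfolding C_def by (rule vfp_cotangent_scale)
  have H: "\<xi> \<in> H1 \<rho>" if "\<xi> \<in> C \<rho>" for \<xi> \<rho>
    using that cotangent_subset_H1 unfolding C_def by blast
  have \<Psi>s: "vfp_Psi_star \<gamma> \<rho> \<xi> = ereal (\<gamma> * dirichlet_p \<rho> \<xi> \<xi>)" if "\<rho> \<in> M" "\<xi> \<in> H1 \<rho>" for \<rho> \<xi>
    using regular_state.vfp_Psi_star_eq[OF M \<gamma>] that by blast
  have dirichlet_nonneg: "0 \<le> dirichlet_p \<rho> \<xi> \<xi>" if "\<rho> \<in> M" for \<rho> \<xi>
    using regular_state.\<rho>_nonneg[OF M[OF that]] by (simp add: dirichlet_p_def)
  have Young: "ereal (2 * \<gamma> * dirichlet_p \<rho> \<xi> \<eta>) - vfp_Psi_star \<gamma> \<rho> \<eta> \<le> ereal (\<gamma> * dirichlet_p \<rho> \<xi> \<xi>)"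
    if "\<rho> \<in> M" "\<xi> \<in> H1 \<rho>" "\<eta> \<in> H1 \<rho>" for \<rho> \<xi> \<eta>
    using mult_left_mono[OF regular_state.dirichlet_p_Young[OF M that(2,3)], of \<gamma>] that \<gamma>
    by (simp add: \<Psi>s algebra_simps)
  show ?thesis
  proof (rule pre_GENERIC_legendreI)
    fix \<rho> assume mem: "\<rho> \<in> M"
    show "regular_state m V \<Phi> \<rho>" using mem by (rule M)
    interpret regular_state m V \<Phi> \<rho> using mem by (rule M)
    show "C \<rho> \<subseteq> H1 \<rho>" using H by blast
    show dS: "dS \<in> C \<rho>" and G: "adjoint_gen (vfp_gen m \<gamma>) \<rho> \<in> tangent (C \<rho>) \<rho>"
      using assms(3,4)[OF mem] by (simp_all add: C_def)
    let ?a = "\<lambda>x. - (1/2) * dS x"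
    have a: "?a \<in> C \<rho>" using dS by (rule scale)
    show "vfp_Psi_star \<gamma> \<rho> (\<lambda>_. 0) = 0"
      by (simp add: \<Psi>s[OF mem zero_in_H1] dirichlet_p_def grad_const)
    show "\<exists>s. vfp_Psi_star \<gamma> \<rho> ?a = ereal s"
      using \<Psi>s[OF mem H[OF a]] by blast
    fix \<xi> assume \<xi>: "\<xi> \<in> C \<rho>"
    show "(\<lambda>x. c * \<xi> x) \<in> C \<rho>" for c using \<xi> by (rule scale)
    show "0 \<le> vfp_Psi_star \<gamma> \<rho> \<xi>"
      using \<gamma> dirichlet_nonneg[OF mem] by (simp add: \<Psi>s[OF mem H[OF \<xi>]])
    have "dirichlet_p \<rho> (\<lambda>x. - \<xi> x) (\<lambda>x. - \<xi> x) = dirichlet_p \<rho> \<xi> \<xi>"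
      using grad_scale[of \<xi> "-1"] H1_C1[OF H[OF \<xi>]] by (simp add: dirichlet_p_def)
    moreover have "(\<lambda>x. - \<xi> x) \<in> C \<rho>" using scale[OF \<xi>, of "-1"] by simp
    ultimately show "vfp_Psi_star \<gamma> \<rho> (\<lambda>x. - \<xi> x) = vfp_Psi_star \<gamma> \<rho> \<xi>"
      using \<Psi>s[OF mem H] \<xi> by simp
    show "vfp_Psi_star \<gamma> \<rho> (\<lambda>x. (1 - t) * \<xi> x + t * \<eta> x)
        \<le> ereal (1 - t) * vfp_Psi_star \<gamma> \<rho> \<xi> + ereal t * vfp_Psi_star \<gamma> \<rho> \<eta>"
      if "\<eta> \<in> C \<rho>" "t \<in> {0..1}" for \<eta> t
      using mult_left_mono[OF dirichlet_p_convex[OF H[OF \<xi>] H[OF that(1)] that(2)], of \<gamma>] \<gamma>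
      unfolding \<Psi>s[OF mem H[OF \<xi>]] \<Psi>s[OF mem H[OF that(1)]]
        \<Psi>s[OF mem H1_lincomb[OF H[OF \<xi>] H[OF that(1)]]]
      by (simp only: times_ereal.simps plus_ereal.simps ereal_less_eq distrib_left mult.left_commute)
    \<comment> \<open>The adjoint generator is the derivative of the potential at \<open>?a\<close>:
      the 2 from the square meets the 1/2 in \<open>?a\<close>.\<close>
    have adj: "adjoint_gen (vfp_gen m \<gamma>) \<rho> \<eta> = 2 * \<gamma> * dirichlet_p \<rho> ?a \<eta>" if "\<eta> \<in> C \<rho>" for \<eta>
      using adjoint_vfp_gen[OF \<gamma>, of \<eta>] that dirichlet_p_scale_left[OF dS_H1 H[OF that], of "-(1/2)"]
      by (simp add: C_def)
    show "ereal (adjoint_gen (vfp_gen m \<gamma>) \<rho> \<xi>) - vfp_Psi_star \<gamma> \<rho> \<xi>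
        \<le> ereal (adjoint_gen (vfp_gen m \<gamma>) \<rho> ?a) - vfp_Psi_star \<gamma> \<rho> ?a"
      using Young[OF mem H[OF a] H[OF \<xi>]] unfolding adj[OF \<xi>] adj[OF a] \<Psi>s[OF mem H[OF a]] by simp
    \<comment> \<open>The derivative of the potential at \<open>\<xi>\<close>; it attains the
      supremum in the bidual and lies in H^-1 since \<open>\<xi>\<close> is in
      \<open>H1 \<rho>\<close>.\<close>
    let ?v = "\<lambda>\<eta>. 2 * \<gamma> * dirichlet_p \<rho> \<xi> \<eta>"
    have v: "?v \<in> tangent (C \<rho>) \<rho>"
      using tangent_cmult[OF dirichlet_p(2)[OF H[OF \<xi>]]] tangent_mono[of "C \<rho>" "H1 \<rho>"] H by blast
    have "legendre C (vfp_Psi_star \<gamma>) \<rho> ?v \<le> ereal (\<gamma> * dirichlet_p \<rho> \<xi> \<xi>)"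
      unfolding legendre_def by (intro SUP_least Young mem H \<xi>)
    then have "ereal (?v \<xi>) - ereal (\<gamma> * dirichlet_p \<rho> \<xi> \<xi>) \<le> ereal (?v \<xi>) - legendre C (vfp_Psi_star \<gamma>) \<rho> ?v"
      by (intro ereal_minus_mono) auto
    then show "vfp_Psi_star \<gamma> \<rho> \<xi> \<le> (SUP v\<in>tangent (C \<rho>) \<rho>. ereal (v \<xi>) - legendre C (vfp_Psi_star \<gamma>) \<rho> v)"
      by (intro SUP_upper2[OF v]) (simp add: \<Psi>s[OF mem H[OF \<xi>]])
  qed
qed

subsection \<open>Velocity jumps\<close>

text \<open>A phase point with the velocity it jumps to, written \<open>((q, p), p')\<close>; the
  nested integrals of the thermostat become one integral over such triples.\<close>

type_synonym 'd triple = "'d phase \<times> (real^'d)"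

lemma borel_measurable_compose_continuous:
  fixes g :: "'a::topological_space \<Rightarrow> 'b::topological_space"
  assumes "f \<in> borel_measurable borel" "continuous_on UNIV g"
  shows "(\<lambda>x. f (g x)) \<in> borel_measurable borel"
  using measurable_compose[OF borel_measurable_continuous_onI[OF assms(2)] assms(1)] .

lemma nn_integral_lborel_prod:
  fixes f :: "'a::euclidean_space \<times> 'b::euclidean_space \<Rightarrow> ennreal"
  assumes "f \<in> borel_measurable borel"
  shows "(\<integral>\<^sup>+z. f z \<partial>lborel) = (\<integral>\<^sup>+x. \<integral>\<^sup>+y. f (x, y) \<partial>lborel \<partial>lborel)"
  using lborel.nn_integral_fst[of f lborel] assms by (simp add: lborel_prod)

lemma borel_measurable_nn_integral_snd:
  fixes f :: "'a::euclidean_space \<times> 'b::euclidean_space \<Rightarrow> ennreal"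
  assumes "f \<in> borel_measurable borel"
  shows "(\<lambda>x. \<integral>\<^sup>+y. f (x, y) \<partial>lborel) \<in> borel_measurable borel"
  using lborel.borel_measurable_nn_integral_fst[of f lborel] assms by (simp add: lborel_prod)

lemma nn_integral_triple:
  fixes f :: "'d::finite triple \<Rightarrow> ennreal"
  assumes "f \<in> borel_measurable borel"
  shows "(\<integral>\<^sup>+z. f z \<partial>lborel) = (\<integral>\<^sup>+q. \<integral>\<^sup>+p. \<integral>\<^sup>+p'. f ((q, p), p') \<partial>lborel \<partial>lborel \<partial>lborel)"
  using nn_integral_lborel_prod[OF assms] nn_integral_lborel_prod[OF borel_measurable_nn_integral_snd[OF assms]]
  by simp

lemma nn_integral_lborel_affine:
  fixes f :: "'a::euclidean_space \<Rightarrow> ennreal"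
  assumes f: "f \<in> borel_measurable borel" and c: "0 < c"
  shows "(\<integral>\<^sup>+x. f x \<partial>lborel) = ennreal (c ^ DIM('a)) * (\<integral>\<^sup>+x. f (t + c *\<^sub>R x) \<partial>lborel)"
proof -
  have "(\<integral>\<^sup>+x. f x \<partial>lborel) =
      (\<integral>\<^sup>+x. f x \<partial>density (distr lborel borel (\<lambda>x. t + c *\<^sub>R x)) (\<lambda>_. ennreal (\<bar>c\<bar> ^ DIM('a))))"
    using lborel_affine[of c t] c by simp
  also have "\<dots> = (\<integral>\<^sup>+x. ennreal (c ^ DIM('a)) * f (t + c *\<^sub>R x) \<partial>lborel)"
    using f c by (simp add: nn_integral_density nn_integral_distr)
  also have "\<dots> = ennreal (c ^ DIM('a)) * (\<integral>\<^sup>+x. f (t + c *\<^sub>R x) \<partial>lborel)"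
    by (intro nn_integral_cmult)
      (simp, intro borel_measurable_compose_continuous[OF f] continuous_intros)
  finally show ?thesis .
qed

definition swap :: "'d::finite triple \<Rightarrow> 'd triple" where
  "swap z = ((fst (fst z), snd z), snd (fst z))"

lemma continuous_swap: "continuous_on UNIV swap"
  unfolding swap_def by (intro continuous_intros)

lemma nn_integral_swap:
  assumes f: "f \<in> borel_measurable borel"
  shows "(\<integral>\<^sup>+z. f (swap z) \<partial>lborel) = (\<integral>\<^sup>+z. f z \<partial>lborel)"
proof -
  have "(\<integral>\<^sup>+z. f (swap z) \<partial>lborel) = (\<integral>\<^sup>+q. \<integral>\<^sup>+p. \<integral>\<^sup>+p'. f ((q, p'), p) \<partial>lborel \<partial>lborel \<partial>lborel)"
    using nn_integral_triple[OF borel_measurable_compose_continuous[OF f continuous_swap]]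
    by (simp add: swap_def)
  also have "\<dots> = (\<integral>\<^sup>+q. \<integral>\<^sup>+p. \<integral>\<^sup>+p'. f ((q, p), p') \<partial>lborel \<partial>lborel \<partial>lborel)"
  proof (rule nn_integral_cong)
    fix q
    have "(\<lambda>(p, p'). f ((q, p'), p)) \<in> borel_measurable (lborel \<Otimes>\<^sub>M lborel)"
      unfolding lborel_prod measurable_lborel2 split_beta'
      by (intro borel_measurable_compose_continuous[OF f] continuous_intros)
    then show "(\<integral>\<^sup>+p. \<integral>\<^sup>+p'. f ((q, p'), p) \<partial>lborel \<partial>lborel) = (\<integral>\<^sup>+p. \<integral>\<^sup>+p'. f ((q, p), p') \<partial>lborel \<partial>lborel)"
      using lborel_pair.Fubini'[of "\<lambda>p p'. f ((q, p'), p)"] by simp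
  qed
  also have "\<dots> = (\<integral>\<^sup>+z. f z \<partial>lborel)"
    by (rule nn_integral_triple[OF f, symmetric])
  finally show ?thesis .
qed

lemma distr_swap: "distr lborel borel swap = (lborel :: 'd::finite triple measure)"
proof (rule measure_eqI)
  fix A :: "'d triple set" assume "A \<in> sets (distr lborel borel swap)"
  then have A: "A \<in> sets borel" by simp
  have meas: "swap \<in> lborel \<rightarrow>\<^sub>M (borel :: 'd triple measure)"
    using borel_measurable_continuous_onI[OF continuous_swap] by simp
  have "emeasure (distr lborel borel swap) A = (\<integral>\<^sup>+z. indicator A z \<partial>distr lborel borel swap)"
    using A by simp
  also have "\<dots> = (\<integral>\<^sup>+z. indicator A (swap z) \<partial>lborel)"
    using A meas by (intro nn_integral_distr) auto
  also have "\<dots> = (\<integral>\<^sup>+z. indicator A z \<partial>lborel)"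
    using A by (intro nn_integral_swap) simp
  finally show "emeasure (distr lborel borel swap) A = emeasure lborel A"
    using A by simp
qed simp

lemma integral_swap:
  fixes f :: "'d::finite triple \<Rightarrow> real"
  assumes "integrable lborel f"
  shows "integrable lborel (\<lambda>z. f (swap z))" "(LINT z|lborel. f (swap z)) = (LINT z|lborel. f z)"
proof -
  have meas: "swap \<in> lborel \<rightarrow>\<^sub>M (borel :: 'd triple measure)" "f \<in> borel_measurable borel"
    using borel_measurable_continuous_onI[OF continuous_swap] assms by auto
  show "integrable lborel (\<lambda>z. f (swap z))"
    using assms integrable_distr_eq[OF meas] by (simp add: distr_swap)
  show "(LINT z|lborel. f (swap z)) = (LINT z|lborel. f z)"
    using integral_distr[OF meas] by (simp add: distr_swap)
qed

text \<open>Equal radii make the box invariant under \<open>swap\<close>, and convexity of the balls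
  keeps interpolated velocities inside.\<close>

definition jump_box :: "real \<Rightarrow> 'd::finite triple set" where
  "jump_box R = (cball 0 R \<times> cball 0 R) \<times> cball 0 R"

lemma compact_jump_box: "compact (jump_box R)"
  unfolding jump_box_def by (intro compact_Times compact_cball)

lemma borel_jump_box [measurable]: "jump_box R \<in> sets borel"
  using compact_jump_box by (intro borel_closed compact_imp_closed)

section \<open>Jumps controlled by the gradient along velocity segments\<close>

definition interpolate :: "real \<Rightarrow> 'd::finite triple \<Rightarrow> 'd phase" where
  "interpolate s z = (fst (fst z), (1 - s) *\<^sub>R snd (fst z) + s *\<^sub>R snd z)"

text \<open>For \<open>s \<ge> 1/2\<close> the substitution of \<open>p' \<mapsto> (1 - s) p + s p'\<close> has Jacobian at least \<open>2\<^sup>-\<^sup>d\<close>;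
  for \<open>s \<le> 1/2\<close> one substitutes \<open>p\<close> instead.\<close>
lemma nn_integral_interpolate_le:
  fixes \<psi> :: "'d::finite phase \<Rightarrow> ennreal"
  assumes \<psi>: "\<psi> \<in> borel_measurable borel" and s: "s \<in> {0..1}"
  shows "(\<integral>\<^sup>+z. indicator (jump_box R) z * \<psi> (interpolate s z) \<partial>lborel) \<le>
    ennreal (2 ^ CARD('d)) * emeasure lborel (cball (0::real^'d) R) * (\<integral>\<^sup>+x. \<psi> x \<partial>lborel)"
proof -
  let ?B = "cball (0::real^'d) R"
  let ?I = "\<lambda>s. \<integral>\<^sup>+z. indicator (jump_box R) z * \<psi> (interpolate s z) \<partial>lborel"
  have meas: "(\<lambda>z. indicator (jump_box R) z * \<psi> (interpolate s z)) \<in> borel_measurable borel" for s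
    unfolding interpolate_def
    by (intro borel_measurable_times_ennreal borel_measurable_indicator borel_jump_box
        borel_measurable_compose_continuous[OF \<psi>] continuous_intros)
  have half: "?I s \<le> ennreal (2 ^ CARD('d)) * emeasure lborel ?B * (\<integral>\<^sup>+x. \<psi> x \<partial>lborel)"
    if s: "1 / 2 \<le> s" for s
  proof -
    have subst: "(\<integral>\<^sup>+p'. \<psi> (q, (1 - s) *\<^sub>R p + s *\<^sub>R p') \<partial>lborel) \<le> ennreal (2 ^ CARD('d)) * (\<integral>\<^sup>+y. \<psi> (q, y) \<partial>lborel)" for q p
    proof -
      let ?X = "\<integral>\<^sup>+p'. \<psi> (q, (1 - s) *\<^sub>R p + s *\<^sub>R p') \<partial>lborel"
      \<comment> \<open>Inserts the factor 1 as the product of the d-th powers of 2 and 1/2; since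
        \<open>1 / 2 \<le> s\<close>, the second is at most \<open>s ^ CARD('d)\<close>, the
        Jacobian of the substitution.\<close>
      have "?X = ennreal (2 ^ CARD('d)) * (ennreal ((1 / 2) ^ CARD('d)) * ?X)"
        by (simp add: mult.assoc[symmetric] ennreal_mult[symmetric] power_mult_distrib[symmetric])
      also have "\<dots> \<le> ennreal (2 ^ CARD('d)) * (ennreal (s ^ CARD('d)) * ?X)"
        using s by (intro mult_left_mono mult_right_mono ennreal_leI power_mono) auto
      also have "ennreal (s ^ CARD('d)) * ?X = (\<integral>\<^sup>+y. \<psi> (q, y) \<partial>lborel)"
        using nn_integral_lborel_affine[of "\<lambda>y. \<psi> (q, y)" s "(1 - s) *\<^sub>R p"] s
          borel_measurable_compose_continuous[OF \<psi>, of "\<lambda>y. (q, y)"]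
        by (simp add: continuous_intros)
      finally show ?thesis .
    qed
    have meas_y: "(\<lambda>q. \<integral>\<^sup>+y. \<psi> (q, y) \<partial>lborel) \<in> borel_measurable borel"
      by (rule borel_measurable_nn_integral_snd[OF \<psi>])
    have "?I s = (\<integral>\<^sup>+q. \<integral>\<^sup>+p. \<integral>\<^sup>+p'. indicator (jump_box R) ((q, p), p') *
        \<psi> (q, (1 - s) *\<^sub>R p + s *\<^sub>R p') \<partial>lborel \<partial>lborel \<partial>lborel)"
      using nn_integral_triple[OF meas, of s] by (simp add: interpolate_def)
    \<comment> \<open>Only the constraint on \<open>p\<close> is kept: after the substitution in
      \<open>p'\<close> the integrand no longer depends on \<open>p\<close>, which contributes the
      volume of the ball.\<close>
    also have "\<dots> \<le> (\<integral>\<^sup>+q. \<integral>\<^sup>+p. \<integral>\<^sup>+p'. indicator ?B p *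
        \<psi> (q, (1 - s) *\<^sub>R p + s *\<^sub>R p') \<partial>lborel \<partial>lborel \<partial>lborel)"
      by (intro nn_integral_mono mult_right_mono) (auto simp: jump_box_def indicator_def)
    also have "\<dots> = (\<integral>\<^sup>+q. \<integral>\<^sup>+p. indicator ?B p *
        (\<integral>\<^sup>+p'. \<psi> (q, (1 - s) *\<^sub>R p + s *\<^sub>R p') \<partial>lborel) \<partial>lborel \<partial>lborel)"
      by (intro nn_integral_cong nn_integral_cmult)
        (simp, intro borel_measurable_compose_continuous[OF \<psi>] continuous_intros)
    also have "\<dots> \<le> (\<integral>\<^sup>+q. \<integral>\<^sup>+p. indicator ?B p *
        (ennreal (2 ^ CARD('d)) * (\<integral>\<^sup>+y. \<psi> (q, y) \<partial>lborel)) \<partial>lborel \<partial>lborel)"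
      by (intro nn_integral_mono mult_left_mono subst) simp
    also have "\<dots> = (\<integral>\<^sup>+q. (ennreal (2 ^ CARD('d)) * emeasure lborel ?B) * (\<integral>\<^sup>+y. \<psi> (q, y) \<partial>lborel) \<partial>lborel)"
      by (intro nn_integral_cong) (subst nn_integral_multc; simp add: mult_ac borel_measurable_indicator)
    also have "\<dots> = ennreal (2 ^ CARD('d)) * emeasure lborel ?B * (\<integral>\<^sup>+q. \<integral>\<^sup>+y. \<psi> (q, y) \<partial>lborel \<partial>lborel)"
      using meas_y by (intro nn_integral_cmult) simp
    also have "(\<integral>\<^sup>+q. \<integral>\<^sup>+y. \<psi> (q, y) \<partial>lborel \<partial>lborel) = (\<integral>\<^sup>+x. \<psi> x \<partial>lborel)"
      by (rule nn_integral_lborel_prod[OF \<psi>, symmetric])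
    finally show ?thesis .
  qed
  show ?thesis
  proof (cases "1 / 2 \<le> s")
    case True
    then show ?thesis by (rule half)
  next
    case False
    \<comment> \<open>Exchanging \<open>p\<close> and \<open>p'\<close> turns interpolation at s
      into interpolation at 1 - s and preserves the box.\<close>
    have "?I s = (\<integral>\<^sup>+z. indicator (jump_box R) (swap z) * \<psi> (interpolate s (swap z)) \<partial>lborel)"
      using nn_integral_swap[OF meas, of s] by simp
    also have "\<dots> = ?I (1 - s)"
      by (intro nn_integral_cong) (auto simp: swap_def interpolate_def jump_box_def indicator_def add.commute)
    finally show ?thesis using half[of "1 - s"] False by simp
  qed
qed

definition jump :: "'d::finite fn \<Rightarrow> 'd triple \<Rightarrow> real" where
  "jump \<xi> z = \<xi> (fst (fst z), snd z) - \<xi> (fst z)"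

lemma jump_swap: "jump \<xi> (swap z) = - jump \<xi> z"
  by (simp add: jump_def swap_def)

lemma jump_lincomb: "jump (\<lambda>x. a * \<xi> x + b * \<eta> x) z = a * jump \<xi> z + b * jump \<eta> z"
  by (simp add: jump_def algebra_simps)

lemma continuous_jump:
  assumes "continuous_on UNIV \<xi>" shows "continuous_on UNIV (jump \<xi>)"
  unfolding jump_def by (intro continuous_intros continuous_on_compose2[OF assms]) auto

text \<open>Fundamental theorem along the segment from p to p', whose length is at most 2R. The
  inner indicator records that the segment stays in the balls, so the gradient enters only on a
  compact set.\<close>

lemma jump_le_path_integral:
  assumes \<xi>: "C1 \<xi>" and z: "z \<in> jump_box R"
  shows "ennreal \<bar>jump \<xi> z\<bar> \<le>
    (\<integral>\<^sup>+s. indicator {0..1} s * (ennreal (2 * R) *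
      (indicator (cball 0 R \<times> cball 0 R) (interpolate s z) * ennreal (norm (grad \<xi> (interpolate s z))))) \<partial>lborel)"
proof -
  obtain q p p' where zq: "z = ((q, p), p')" by (metis prod.collapse)
  define e where "e = (0 :: real^'a, p' - p)"
  define x where "x = (q, p)"
  let ?f = "\<lambda>s. e \<bullet> grad \<xi> (x + s *\<^sub>R e)"
  have path: "x + s *\<^sub>R e = interpolate s z" for s
    by (simp add: x_def e_def zq interpolate_def algebra_simps)
  have cont: "continuous_on UNIV ?f"
    by (intro continuous_intros C1_grad_continuous_compose[OF \<xi>])
  have "(LINT s|lborel. indicator {0..1} s *\<^sub>R ?f s) = \<xi> (x + 1 *\<^sub>R e) - \<xi> (x + 0 *\<^sub>R e)"
    by (rule integral_FTC_atLeastAtMost)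
      (auto intro: C1_DERIV_line[OF \<xi>] continuous_on_subset[OF cont]
        simp: has_real_derivative_iff_has_vector_derivative[symmetric])
  then have "ennreal \<bar>jump \<xi> z\<bar> = ennreal (norm (LINT s|lborel. indicator {0..1} s *\<^sub>R ?f s))"
    by (simp add: jump_def zq x_def e_def)
  also have "\<dots> \<le> (\<integral>\<^sup>+s. ennreal (norm (indicator {0..1} s *\<^sub>R ?f s)) \<partial>lborel)"
    by (rule integral_norm_bound_ennreal[OF borel_integrable_compact])
      (auto intro: continuous_on_subset[OF cont])
  also have "\<dots> \<le> (\<integral>\<^sup>+s. indicator {0..1} s * (ennreal (2 * R) *
      (indicator (cball 0 R \<times> cball 0 R) (interpolate s z) * ennreal (norm (grad \<xi> (interpolate s z))))) \<partial>lborel)"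
  proof (rule nn_integral_mono)
    fix s :: real
    show "ennreal (norm (indicator {0..1} s *\<^sub>R ?f s)) \<le> indicator {0..1} s * (ennreal (2 * R) *
      (indicator (cball 0 R \<times> cball 0 R) (interpolate s z) * ennreal (norm (grad \<xi> (interpolate s z)))))"
    proof (cases "s \<in> {0..1}")
      case True
      have pp: "p \<in> cball 0 R" "p' \<in> cball 0 R" "q \<in> cball 0 R"
        using z by (auto simp: zq jump_box_def)
      have "(1 - s) *\<^sub>R p + s *\<^sub>R p' \<in> cball 0 R"
        using True pp by (intro convexD[OF convex_cball]) auto
      then have mem: "interpolate s z \<in> cball 0 R \<times> cball 0 R"
        using pp by (simp add: interpolate_def zq)
      have "\<bar>?f s\<bar> \<le> norm e * norm (grad \<xi> (x + s *\<^sub>R e))"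
        by (rule Cauchy_Schwarz_ineq2)
      also have "\<dots> \<le> (2 * R) * norm (grad \<xi> (interpolate s z))"
        using pp norm_triangle_ineq4[of p' p] unfolding path
        by (intro mult_right_mono) (auto simp: norm_Pair e_def)
      finally have "ennreal \<bar>?f s\<bar> \<le> ennreal (2 * R) * ennreal (norm (grad \<xi> (interpolate s z)))"
        using pp order_trans[OF norm_ge_zero, of q R]
        by (subst ennreal_mult[symmetric]) (auto intro: ennreal_leI)
      then show ?thesis
        using True mem by simp
    qed simp
  qed
  finally show ?thesis .
qed

text \<open>Tonelli exchanges the path parameter with the triple, and
  \<open>nn_integral_interpolate_le\<close> is uniform in that parameter. The outcome is a local L1
  norm of the gradient, which the H1 seminorm controls wherever \<open>\<rho>\<close> is bounded
  below.\<close>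

lemma nn_integral_jump_le:
  fixes \<xi> :: "'d::finite fn"
  assumes \<xi>: "C1 \<xi>"
  shows "(\<integral>\<^sup>+z. indicator (jump_box R) z * ennreal \<bar>jump \<xi> z\<bar> \<partial>lborel) \<le>
    ennreal (2 * R) * (ennreal (2 ^ CARD('d)) * emeasure lborel (cball (0::real^'d) R)) *
    (\<integral>\<^sup>+x. indicator (cball 0 R \<times> cball 0 R) x * ennreal (norm (grad \<xi> x)) \<partial>lborel)"
proof -
  let ?\<psi> = "\<lambda>x. indicator (cball 0 R \<times> cball 0 R) x * ennreal (norm (grad \<xi> x)) :: ennreal"
  let ?c = "ennreal (2 ^ CARD('d)) * emeasure lborel (cball (0::real^'d) R)"
  let ?J = "indicator (jump_box R) :: 'd triple \<Rightarrow> ennreal"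
  have [measurable]: "grad \<xi> \<in> borel_measurable borel" using C1_grad_borel[OF \<xi>] .
  have K: "cball 0 R \<times> cball 0 R \<in> sets (borel :: 'd phase measure)"
    by (intro borel_closed closed_Times closed_cball)
  have \<psi>: "?\<psi> \<in> borel_measurable borel"
    using K by measurable
  have meas: "(\<lambda>z. ?J (snd z) * (indicator {0..1} (fst z) * (ennreal (2 * R) * ?\<psi> (interpolate (fst z) (snd z)))))
      \<in> borel_measurable borel"
  proof -
    have "(\<lambda>z. ?J (snd z)) \<in> borel_measurable (borel :: (real \<times> 'd triple) measure)"
      by (rule borel_measurable_compose_continuous) (auto intro!: continuous_intros)
    moreover have "(\<lambda>z. indicator {0..1} (fst z) :: ennreal) \<in> borel_measurable (borel :: (real \<times> 'd triple) measure)"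
      by (rule borel_measurable_compose_continuous[where f="indicator {0..1}"]) (auto intro!: continuous_intros)
    moreover have "(\<lambda>z. ?\<psi> (interpolate (fst z) (snd z))) \<in> borel_measurable (borel :: (real \<times> 'd triple) measure)"
      unfolding interpolate_def
      by (rule borel_measurable_compose_continuous[OF \<psi>]) (intro continuous_intros)
    ultimately show ?thesis by measurable
  qed
  have "(\<integral>\<^sup>+z. ?J z * ennreal \<bar>jump \<xi> z\<bar> \<partial>lborel) \<le>
      (\<integral>\<^sup>+z. ?J z * (\<integral>\<^sup>+s. indicator {0..1} s * (ennreal (2 * R) * ?\<psi> (interpolate s z)) \<partial>lborel) \<partial>lborel)"
  proof (rule nn_integral_mono)
    fix z
    show "?J z * ennreal \<bar>jump \<xi> z\<bar> \<le>
        ?J z * (\<integral>\<^sup>+s. indicator {0..1} s * (ennreal (2 * R) * ?\<psi> (interpolate s z)) \<partial>lborel)"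
      using jump_le_path_integral[OF \<xi>, of z R] by (cases "z \<in> jump_box R") auto
  qed
  also have "\<dots> = (\<integral>\<^sup>+z. \<integral>\<^sup>+s. ?J z * (indicator {0..1} s * (ennreal (2 * R) * ?\<psi> (interpolate s z))) \<partial>lborel \<partial>lborel)"
  proof (intro nn_integral_cong nn_integral_cmult[symmetric])
    fix z :: "'d triple"
    have "(\<lambda>s. ?\<psi> (interpolate s z)) \<in> borel_measurable borel"
      unfolding interpolate_def
      by (rule borel_measurable_compose_continuous[OF \<psi>]) (intro continuous_intros)
    then show "(\<lambda>s. indicator {0..1} s * (ennreal (2 * R) * ?\<psi> (interpolate s z))) \<in> borel_measurable lborel"
      by measurable
  qed
  also have "\<dots> = (\<integral>\<^sup>+s. \<integral>\<^sup>+z. ?J z * (indicator {0..1} s * (ennreal (2 * R) * ?\<psi> (interpolate s z))) \<partial>lborel \<partial>lborel)"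
    using lborel_pair.Fubini'[of "\<lambda>s z. ?J z * (indicator {0..1} s * (ennreal (2 * R) * ?\<psi> (interpolate s z)))"] meas
    by (simp add: lborel_prod split_beta')
  also have "\<dots> \<le> (\<integral>\<^sup>+s. indicator {0..1::real} s * (ennreal (2 * R) * ?c * (\<integral>\<^sup>+x. ?\<psi> x \<partial>lborel)) \<partial>lborel)"
  proof (rule nn_integral_mono)
    fix s :: real
    have m: "(\<lambda>z. ?J z * ?\<psi> (interpolate s z)) \<in> borel_measurable lborel"
      unfolding interpolate_def measurable_lborel2
      by (intro borel_measurable_times_ennreal borel_measurable_indicator borel_jump_box
        borel_measurable_compose_continuous[OF \<psi>] continuous_intros)
    have "(\<integral>\<^sup>+z. ?J z * (indicator {0..1} s * (ennreal (2 * R) * ?\<psi> (interpolate s z))) \<partial>lborel) =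
        (\<integral>\<^sup>+z. (indicator {0..1} s * ennreal (2 * R)) * (?J z * ?\<psi> (interpolate s z)) \<partial>lborel)"
      by (simp add: mult_ac)
    also have "\<dots> = (indicator {0..1} s * ennreal (2 * R)) * (\<integral>\<^sup>+z. ?J z * ?\<psi> (interpolate s z) \<partial>lborel)"
      using m by (rule nn_integral_cmult)
    also have "\<dots> \<le> indicator {0..1} s * (ennreal (2 * R) * ?c * (\<integral>\<^sup>+x. ?\<psi> x \<partial>lborel))"
    proof (cases "s \<in> {0..1}")
      case True
      then show ?thesis
        using mult_left_mono[OF nn_integral_interpolate_le[OF \<psi> True, of R], of "ennreal (2 * R)"]
        by (simp add: mult.assoc)
    qed simp
    finally show "(\<integral>\<^sup>+z. ?J z * (indicator {0..1} s * (ennreal (2 * R) * ?\<psi> (interpolate s z))) \<partial>lborel)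
      \<le> indicator {0..1} s * (ennreal (2 * R) * ?c * (\<integral>\<^sup>+x. ?\<psi> x \<partial>lborel))" .
  qed
  also have "\<dots> = ennreal (2 * R) * ?c * (\<integral>\<^sup>+x. ?\<psi> x \<partial>lborel)"
    by (simp add: nn_integral_multc)
  finally show ?thesis .
qed

subsection \<open>The Andersen thermostat\<close>

text \<open>The inequality \<open>1 + x \<le> exp x\<close>, applied to both exponentials in
  \<open>cosh\<close>.\<close>

lemma cosh_tangent_le: "cosh c + sinh c * (a - c) \<le> cosh (a::real)"
proof -
  have "exp c * (1 + (a - c)) \<le> exp c * exp (a - c)"
    by (intro mult_left_mono exp_ge_add_one_self) simp
  moreover have "exp (- c) * (1 + (c - a)) \<le> exp (- c) * exp (c - a)"
    by (intro mult_left_mono exp_ge_add_one_self) simp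
  ultimately show ?thesis
    unfolding exp_add[symmetric] cosh_field_def sinh_field_def
    by (simp add: algebra_simps add_divide_distrib diff_divide_distrib)
qed

text \<open>Take the tangent at the intermediate point; its slope terms cancel in the convex
  combination.\<close>

lemma cosh_convex:
  fixes a b t :: real
  assumes "t \<in> {0..1}"
  shows "cosh ((1 - t) * a + t * b) \<le> (1 - t) * cosh a + t * cosh b"
proof -
  let ?c = "(1 - t) * a + t * b"
  have "(1 - t) * (cosh ?c + sinh ?c * (a - ?c)) \<le> (1 - t) * cosh a"
    "t * (cosh ?c + sinh ?c * (b - ?c)) \<le> t * cosh b"
    using assms by (intro mult_left_mono cosh_tangent_le; simp)+
  moreover have "(1 - t) * (cosh ?c + sinh ?c * (a - ?c)) + t * (cosh ?c + sinh ?c * (b - ?c)) = cosh ?c"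
    by (simp add: algebra_simps)
  ultimately show ?thesis by linarith
qed

lemma andersen_dom_iff:
  "andersen_dom m \<rho> \<xi> \<longleftrightarrow> integrable lborel (\<lambda>z. jump \<xi> z * maxwell m (snd z) * \<rho> (fst z))"
  by (simp add: andersen_dom_def jump_def split_beta')

lemma andersen_cotangent_scale:
  assumes "\<xi> \<in> cotangent (andersen_dom m) \<rho>"
  shows "(\<lambda>x. c * \<xi> x) \<in> cotangent (andersen_dom m) \<rho>"
proof -
  have H: "\<xi> \<in> H1 \<rho>" and dom: "andersen_dom m \<rho> \<xi>"
    using assms by (auto simp: cotangent_alt)
  have "andersen_dom m \<rho> (\<lambda>x. c * \<xi> x)"
    using integrable_mult_right[OF dom[unfolded andersen_dom_iff], of c]
    by (simp add: andersen_dom_iff jump_def algebra_simps)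
  then show ?thesis using H1_scale[OF H] by (simp add: cotangent_alt)
qed

locale andersen_state = regular_state m V \<Phi> \<rho>
  for m :: real and V \<Phi> :: "real^'d::finite \<Rightarrow> real" and \<rho> :: "'d fn" +
  fixes \<gamma> :: real
  assumes \<gamma>_pos: "0 < \<gamma>"
begin

abbreviation "C \<equiv> cotangent (andersen_dom m) \<rho>"
abbreviation "\<Psi>s \<equiv> andersen_Psi_star m \<gamma> \<rho>"

section \<open>Detailed balance and the symmetrised generator\<close>

definition rate :: "'d triple \<Rightarrow> real" where
  "rate z = \<gamma> * maxwell m (snd z) * \<rho> (fst z)"

text \<open>The geometric mean of \<open>rate z\<close> and \<open>rate (swap z)\<close>: taking the
  root of two Gaussians turns 2m into 4m in the exponent.\<close>

definition weight :: "'d triple \<Rightarrow> real" where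
  "weight z = \<gamma> * (1 / sqrt (2 * pi * m)) *
     exp (- (((norm (snd (fst z)))\<^sup>2 + (norm (snd z))\<^sup>2) / (4 * m))) *
     sqrt (\<rho> (fst (fst z), snd z) * \<rho> (fst z))"

text \<open>Half the logarithm of the ratio of \<open>rate z\<close> to
  \<open>rate (swap z)\<close>, as \<open>weight_exp\<close> shows.\<close>

definition affinity :: "'d triple \<Rightarrow> real" where
  "affinity = jump (\<lambda>x. - (1/2) * dS x)"

lemma C_C1: "\<xi> \<in> C \<Longrightarrow> C1 \<xi>"
  by (simp add: cotangent_def)

lemma weight_nonneg: "0 \<le> weight z"
  using \<gamma>_pos m_pos \<rho>_nonneg by (simp add: weight_def)

lemma continuous_weight: "continuous_on UNIV weight"
  unfolding weight_def using m_pos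
  by (intro continuous_intros C1_continuous_compose[OF \<rho>]) auto

lemma borel_weight [measurable]: "weight \<in> borel_measurable borel"
  by (rule borel_measurable_continuous_onI[OF continuous_weight])

lemma borel_jump: "C1 \<xi> \<Longrightarrow> jump \<xi> \<in> borel_measurable borel"
  by (intro borel_measurable_continuous_onI continuous_jump C1_continuous)

text \<open>A jump keeps q, so \<open>V\<close>, the convolution and the constant 1 drop out of the
  jump of \<open>dS\<close>; only the logarithms of the density and the kinetic energies remain.
  With the root written as an exponential, both identities compare exponents.\<close>

lemma weight_exp: "weight z * exp (affinity z) = rate z" "weight z * exp (- affinity z) = rate (swap z)"
proof -
  obtain q p p' where z: "z = ((q, p), p')" by (metis prod.collapse)
  let ?k = "\<gamma> * (1 / sqrt (2 * pi * m))"
  have sq: "sqrt (\<rho> (q, p') * \<rho> (q, p)) = exp ((ln (\<rho> (q, p')) + ln (\<rho> (q, p))) / 2)"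
  proof -
    have "\<rho> (q, p') * \<rho> (q, p) = exp (ln (\<rho> (q, p')) + ln (\<rho> (q, p)))"
      by (simp add: exp_add \<rho>_pos)
    also have "\<dots> = (exp ((ln (\<rho> (q, p')) + ln (\<rho> (q, p))) / 2))\<^sup>2"
      by (simp add: exp_double[symmetric])
    finally show ?thesis by simp
  qed
  have aff: "affinity z = (ln (\<rho> (q, p)) - ln (\<rho> (q, p'))) / 2 + ((norm p)\<^sup>2 - (norm p')\<^sup>2) / (4 * m)"
    using m_pos by (simp add: affinity_def jump_def z d_entropy_def d_energy_def field_simps)
  have w: "weight z = ?k * exp (- (((norm p)\<^sup>2 + (norm p')\<^sup>2) / (4 * m)) + (ln (\<rho> (q, p')) + ln (\<rho> (q, p))) / 2)"
    by (simp only: weight_def z fst_conv snd_conv sq exp_add mult.assoc)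
  have "weight z * exp (affinity z) = ?k * exp (- ((norm p')\<^sup>2 / (2 * m)) + ln (\<rho> (q, p)))"
    unfolding w aff mult.assoc exp_add[symmetric] using m_pos by (simp add: field_simps)
  then show "weight z * exp (affinity z) = rate z"
    by (simp only: rate_def maxwell_def z fst_conv snd_conv exp_add exp_ln[OF \<rho>_pos] mult.assoc)
  have "weight z * exp (- affinity z) = ?k * exp (- ((norm p)\<^sup>2 / (2 * m)) + ln (\<rho> (q, p')))"
    unfolding w aff mult.assoc exp_add[symmetric] using m_pos by (simp add: field_simps)
  then show "weight z * exp (- affinity z) = rate (swap z)"
    by (simp only: rate_def maxwell_def z swap_def fst_conv snd_conv exp_add exp_ln[OF \<rho>_pos] mult.assoc)
qed

lemma weight_sinh: "weight z * sinh (affinity z) = (rate z - rate (swap z)) / 2"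
  using weight_exp[of z] by (simp add: sinh_field_def right_diff_distrib)

lemma adjoint_andersen_gen:
  assumes "\<xi> \<in> C"
  shows "integrable lborel (\<lambda>z. weight z * sinh (affinity z) * jump \<xi> z)"
    and "adjoint_gen (andersen_gen m \<gamma>) \<rho> \<xi> = (LINT z|lborel. weight z * sinh (affinity z) * jump \<xi> z)"
proof -
  have "integrable lborel (\<lambda>z. jump \<xi> z * maxwell m (snd z) * \<rho> (fst z))"
    using assms by (simp add: cotangent_def andersen_dom_iff)
  from integrable_mult_right[OF this, of \<gamma>]
  have int: "integrable lborel (\<lambda>z. jump \<xi> z * rate z)"
    by (simp add: rate_def mult_ac)
  note int_swap = integral_swap[OF int]
  \<comment> \<open>\<open>jump \<xi>\<close> is odd under \<open>swap\<close>, so averaging the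
    integrand with its reversal leaves the antisymmetric part of \<open>rate\<close>, which is
    \<open>weight_sinh\<close>.\<close>
  have eq: "weight z * sinh (affinity z) * jump \<xi> z =
      (jump \<xi> z * rate z + jump \<xi> (swap z) * rate (swap z)) / 2" for z
    by (simp add: weight_sinh jump_swap algebra_simps diff_divide_distrib)
  show "integrable lborel (\<lambda>z. weight z * sinh (affinity z) * jump \<xi> z)"
    unfolding eq using int int_swap(1) by simp
  have "adjoint_gen (andersen_gen m \<gamma>) \<rho> \<xi> = (LINT x|lborel. LINT p'|lborel. jump \<xi> (x, p') * rate (x, p'))"
    unfolding adjoint_gen_def
  proof (rule Bochner_Integration.integral_cong[OF refl])
    fix x :: "'d phase"
    obtain q p where x: "x = (q, p)" by force
    have "andersen_gen m \<gamma> \<xi> x * \<rho> x = (LINT p'|lborel. \<gamma> * ((\<xi> (q, p') - \<xi> (q, p)) * maxwell m p') * \<rho> x)"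
      by (simp add: andersen_gen_def x)
    also have "\<dots> = (LINT p'|lborel. jump \<xi> (x, p') * rate (x, p'))"
      by (intro Bochner_Integration.integral_cong refl) (simp add: jump_def rate_def x)
    finally show "andersen_gen m \<gamma> \<xi> x * \<rho> x = (LINT p'|lborel. jump \<xi> (x, p') * rate (x, p'))" .
  qed
  also have "\<dots> = (LINT z|lborel. jump \<xi> z * rate z)"
    using lborel_pair.integral_fst'[of "\<lambda>z. jump \<xi> z * rate z"] int by (simp add: lborel_prod)
  also have "\<dots> = (LINT z|lborel. weight z * sinh (affinity z) * jump \<xi> z)"
    unfolding eq using int int_swap by simp
  finally show "adjoint_gen (andersen_gen m \<gamma>) \<rho> \<xi> = (LINT z|lborel. weight z * sinh (affinity z) * jump \<xi> z)" .
qed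

section \<open>The thermostat potential as a single integral and its optimality\<close>

definition cost :: "'d fn \<Rightarrow> 'd triple \<Rightarrow> real" where
  "cost \<xi> z = (cosh (jump \<xi> z) - 1) * weight z"

lemma cost_nonneg: "0 \<le> cost \<xi> z"
  using cosh_real_ge_1[of "jump \<xi> z"] weight_nonneg[of z] by (simp add: cost_def)

lemma borel_cost: "C1 \<xi> \<Longrightarrow> cost \<xi> \<in> borel_measurable borel"
  unfolding cost_def
  by (intro borel_measurable_continuous_onI continuous_intros continuous_on_cosh continuous_weight
      continuous_jump C1_continuous)

lemma Psi_star_eq:
  assumes "C1 \<xi>"
  shows "\<Psi>s \<xi> = enn2ereal (\<integral>\<^sup>+z. ennreal (cost \<xi> z) \<partial>lborel)"
proof -
  \<comment> \<open>\<open>cost\<close> contains \<open>\<gamma>\<close> through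
    \<open>weight\<close>, while the nested integral has it outside.\<close>
  let ?f = "\<lambda>z. ennreal (cost \<xi> z / \<gamma>)"
  have meas: "?f \<in> borel_measurable borel"
    using borel_cost[OF assms] by measurable
  have "(\<integral>\<^sup>+q. \<integral>\<^sup>+p. \<integral>\<^sup>+p'. ennreal ((cosh (\<xi> (q, p') - \<xi> (q, p)) - 1) * (1 / sqrt (2 * pi * m))
        * exp (- (((norm p)\<^sup>2 + (norm p')\<^sup>2) / (4 * m))) * sqrt (\<rho> (q, p') * \<rho> (q, p)))
      \<partial>lborel \<partial>lborel \<partial>lborel) = (\<integral>\<^sup>+q. \<integral>\<^sup>+p. \<integral>\<^sup>+p'. ?f ((q, p), p') \<partial>lborel \<partial>lborel \<partial>lborel)"
    using \<gamma>_pos by (simp add: cost_def weight_def jump_def mult_ac)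
  also have "\<dots> = (\<integral>\<^sup>+z. ?f z \<partial>lborel)"
    by (rule nn_integral_triple[OF meas, symmetric])
  finally have "\<Psi>s \<xi> = enn2ereal (ennreal \<gamma> * (\<integral>\<^sup>+z. ?f z \<partial>lborel))"
    by (simp only: andersen_Psi_star_def)
  also have "ennreal \<gamma> * (\<integral>\<^sup>+z. ?f z \<partial>lborel) = (\<integral>\<^sup>+z. ennreal \<gamma> * ?f z \<partial>lborel)"
    using meas by (intro nn_integral_cmult[symmetric]) simp
  also have "\<dots> = (\<integral>\<^sup>+z. ennreal (cost \<xi> z) \<partial>lborel)"
    using \<gamma>_pos by (simp add: ennreal_mult'[symmetric])
  finally show ?thesis .
qed

text \<open>The domain condition controls jumps to first order only, whereas \<open>cosh\<close>
  grows exponentially, so an infinite value has to be allowed for; such competitors contribute minus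
  infinity to a supremum.\<close>

lemma Psi_star_cases:
  assumes "C1 \<xi>"
  obtains "\<Psi>s \<xi> = \<infinity>" | "integrable lborel (cost \<xi>)" "\<Psi>s \<xi> = ereal (LINT z|lborel. cost \<xi> z)"
proof (cases "(\<integral>\<^sup>+z. ennreal (cost \<xi> z) \<partial>lborel) = \<infinity>")
  case True
  then show ?thesis using that(1) by (simp add: Psi_star_eq[OF assms])
next
  case False
  then have int: "integrable lborel (cost \<xi>)"
    using borel_cost[OF assms] cost_nonneg
    by (intro integrableI_nonneg) (auto simp: top.not_eq_extremum)
  moreover have "\<Psi>s \<xi> = ereal (LINT z|lborel. cost \<xi> z)"
    unfolding Psi_star_eq[OF assms] using cost_nonneg
    by (subst nn_integral_eq_integral[OF int]) auto
  ultimately show ?thesis by (rule that(2))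
qed

lemma Psi_star_of_integrable:
  assumes "C1 \<xi>" "integrable lborel (cost \<xi>)"
  shows "\<Psi>s \<xi> = ereal (LINT z|lborel. cost \<xi> z)"
  unfolding Psi_star_eq[OF assms(1)] using cost_nonneg
  by (subst nn_integral_eq_integral[OF assms(2)]) auto

lemma Psi_star_even:
  assumes "C1 \<xi>"
  shows "\<Psi>s (\<lambda>x. - \<xi> x) = \<Psi>s \<xi>"
proof -
  have "jump (\<lambda>x. - \<xi> x) z = - jump \<xi> z" for z by (simp add: jump_def)
  then show ?thesis
    using C1_scale[OF assms, of "-1"] by (simp add: Psi_star_eq assms cost_def)
qed

lemma Psi_star_convex:
  assumes "C1 \<xi>" "C1 \<eta>" "t \<in> {0..1}"
  shows "\<Psi>s (\<lambda>x. (1 - t) * \<xi> x + t * \<eta> x) \<le> ereal (1 - t) * \<Psi>s \<xi> + ereal t * \<Psi>s \<eta>"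
proof -
  let ?\<zeta> = "\<lambda>x. (1 - t) * \<xi> x + t * \<eta> x"
  note [measurable] = borel_cost[OF assms(1)] borel_cost[OF assms(2)]
  have "cost ?\<zeta> z \<le> (1 - t) * cost \<xi> z + t * cost \<eta> z" for z
    using mult_right_mono[OF cosh_convex[OF assms(3), of "jump \<xi> z" "jump \<eta> z"] weight_nonneg[of z]]
    unfolding cost_def jump_lincomb by (simp add: algebra_simps)
  then have "(\<integral>\<^sup>+z. ennreal (cost ?\<zeta> z) \<partial>lborel) \<le>
      (\<integral>\<^sup>+z. ennreal (1 - t) * ennreal (cost \<xi> z) + ennreal t * ennreal (cost \<eta> z) \<partial>lborel)"
    using assms(3) cost_nonneg
    by (intro nn_integral_mono) (simp add: ennreal_mult[symmetric] ennreal_plus[symmetric] ennreal_leI del: ennreal_plus)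
  also have "\<dots> = ennreal (1 - t) * (\<integral>\<^sup>+z. ennreal (cost \<xi> z) \<partial>lborel) + ennreal t * (\<integral>\<^sup>+z. ennreal (cost \<eta> z) \<partial>lborel)"
    by (simp add: nn_integral_add nn_integral_cmult)
  finally show ?thesis
    using assms(3) unfolding Psi_star_eq[OF assms(1)] Psi_star_eq[OF assms(2)] Psi_star_eq[OF C1_lincomb[OF assms(1,2)]]
    by (simp add: less_eq_ennreal.rep_eq plus_ennreal.rep_eq times_ennreal.rep_eq)
qed

text \<open>The tangent of \<open>cosh\<close> at the affinity, evaluated at 0, bounds
  \<open>cost\<close> by the integrand of the adjoint generator at \<open>- dS/2\<close>, whose
  integrability is the domain condition.\<close>

lemma Psi_star_affinity:
  assumes "(\<lambda>x. - (1/2) * dS x) \<in> C"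
  shows "integrable lborel (cost (\<lambda>x. - (1/2) * dS x))"
proof (rule Bochner_Integration.integrable_bound[OF adjoint_andersen_gen(1)[OF assms]])
  show "cost (\<lambda>x. - (1/2) * dS x) \<in> borel_measurable lborel"
    using borel_cost[OF C_C1[OF assms]] by simp
  show "AE z in lborel. norm (cost (\<lambda>x. - (1/2) * dS x) z)
      \<le> norm (weight z * sinh (affinity z) * jump (\<lambda>x. - (1/2) * dS x) z)"
  proof (rule AE_I2)
    fix z
    have "cosh (affinity z) - 1 \<le> sinh (affinity z) * affinity z"
      using cosh_tangent_le[of "affinity z" 0] by simp
    from mult_right_mono[OF this weight_nonneg[of z]]
    have "cost (\<lambda>x. - (1/2) * dS x) z \<le> weight z * sinh (affinity z) * affinity z"
      by (simp only: cost_def affinity_def mult_ac)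
    then show "norm (cost (\<lambda>x. - (1/2) * dS x) z)
        \<le> norm (weight z * sinh (affinity z) * jump (\<lambda>x. - (1/2) * dS x) z)"
      using cost_nonneg[of "\<lambda>x. - (1/2) * dS x" z] unfolding affinity_def[symmetric] by simp
  qed
qed

text \<open>Pointwise, \<open>sinh c * y - cosh y\<close> is largest at \<open>y = c\<close>, here
  with \<open>c = affinity z\<close>; integrate against \<open>weight\<close>.\<close>

lemma adjoint_optimal:
  assumes a: "(\<lambda>x. - (1/2) * dS x) \<in> C" and \<xi>: "\<xi> \<in> C"
  shows "ereal (adjoint_gen (andersen_gen m \<gamma>) \<rho> \<xi>) - \<Psi>s \<xi> \<le>
    ereal (adjoint_gen (andersen_gen m \<gamma>) \<rho> (\<lambda>x. - (1/2) * dS x)) - \<Psi>s (\<lambda>x. - (1/2) * dS x)"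
proof (cases rule: Psi_star_cases[OF C_C1[OF \<xi>]])
  case 2
  let ?a = "\<lambda>x. - (1/2) * dS x"
  note int = adjoint_andersen_gen(1)[OF \<xi>] adjoint_andersen_gen(1)[OF a] Psi_star_affinity[OF a] 2(1)
  have "(LINT z|lborel. weight z * sinh (affinity z) * jump \<xi> z - cost \<xi> z) \<le>
      (LINT z|lborel. weight z * sinh (affinity z) * jump ?a z - cost ?a z)"
  proof (rule integral_mono)
    fix z
    show "weight z * sinh (affinity z) * jump \<xi> z - cost \<xi> z \<le> weight z * sinh (affinity z) * jump ?a z - cost ?a z"
      using mult_left_mono[OF cosh_tangent_le[of "affinity z" "jump \<xi> z"] weight_nonneg[of z]]
      unfolding cost_def affinity_def[symmetric] by (simp add: algebra_simps)
  qed (intro Bochner_Integration.integrable_diff int)+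
  then show ?thesis
    using int by (simp only: 2(2) Psi_star_of_integrable[OF C_C1[OF a] int(3)]
        adjoint_andersen_gen(2)[OF \<xi>] adjoint_andersen_gen(2)[OF a]
        Bochner_Integration.integral_diff ereal_minus ereal_less_eq)
qed simp

text \<open>Truncations to compact sets of the flux that is optimal for \<open>\<xi>\<close>; unlike that flux itself,
  they are bounded with respect to the \<open>H\<^sup>1\<close> seminorm.\<close>
definition trunc_flux :: "real \<Rightarrow> 'd fn \<Rightarrow> 'd functional" where
  "trunc_flux R \<xi> \<eta> = (LINT z|lborel. indicator (jump_box R) z *\<^sub>R (weight z * sinh (jump \<xi> z) * jump \<eta> z))"

lemma trunc_flux_integrable:
  assumes "C1 \<xi>" "C1 \<eta>"
  shows "integrable lborel (\<lambda>z. indicator (jump_box R) z *\<^sub>R (weight z * sinh (jump \<xi> z) * jump \<eta> z))"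
  by (intro borel_integrable_compact compact_jump_box continuous_intros continuous_on_sinh
      continuous_on_subset[OF continuous_weight] continuous_on_subset[OF continuous_jump]
      C1_continuous assms) auto

text \<open>Cauchy-Schwarz against the indicator of the compact set divided by
  \<open>\<rho>\<close>, which is in L2 of \<open>\<rho>\<close> because \<open>\<rho>\<close> is
  continuous and positive. The witness, the root of the integral of 1/\<open>\<rho>\<close> over
  that set, is fixed only by the final \<open>show\<close>.\<close>

lemma integral_grad_cball_le:
  "\<exists>c. \<forall>\<eta>\<in>H1 \<rho>.
    (\<integral>\<^sup>+x. indicator (cball 0 R \<times> cball 0 R) x * ennreal (norm (grad \<eta> x)) \<partial>lborel) \<le> ennreal (c * H1_seminorm \<rho> \<eta>)"
proof (intro exI ballI)
  fix \<eta> assume \<eta>: "\<eta> \<in> H1 \<rho>"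
  let ?K = "cball 0 R \<times> cball 0 R :: 'd phase set"
  let ?Y = "\<lambda>x. indicator ?K x / \<rho> x"
  have \<rho>0: "\<rho> x \<noteq> 0" for x using \<rho>_pos[of x] by simp
  have K: "compact ?K" by (intro compact_Times compact_cball)
  then have [measurable]: "?K \<in> sets borel" by (intro borel_closed compact_imp_closed)
  have [measurable]: "grad \<eta> \<in> borel_measurable borel" using C1_grad_borel[OF H1_C1[OF \<eta>]] .
  have "integrable lborel (\<lambda>x. indicator ?K x *\<^sub>R (1 / \<rho> x))"
    by (intro borel_integrable_compact K continuous_intros continuous_on_subset[OF continuous_\<rho>]) (auto simp: \<rho>0)
  also have "(\<lambda>x. indicator ?K x *\<^sub>R (1 / \<rho> x)) = (\<lambda>x. (norm (?Y x))\<^sup>2 * \<rho> x)"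
    using \<rho>0 by (auto simp: fun_eq_iff indicator_def power2_eq_square)
  finally have Y: "integrable lborel (\<lambda>x. (norm (?Y x))\<^sup>2 * \<rho> x)" .
  have X: "integrable lborel (\<lambda>x. (norm (norm (grad \<eta> x)))\<^sup>2 * \<rho> x)"
    using \<eta> by (simp add: H1_def)
  have CS: "integrable lborel (\<lambda>x. (?Y x \<bullet> norm (grad \<eta> x)) * \<rho> x)"
    "\<bar>LINT x|lborel. (?Y x \<bullet> norm (grad \<eta> x)) * \<rho> x\<bar> \<le> sqrt (LINT x|lborel. (norm (?Y x))\<^sup>2 * \<rho> x) * H1_seminorm \<rho> \<eta>"
    using weighted_Cauchy_Schwarz[OF _ _ borel(1) \<rho>_nonneg Y X] by (simp_all add: H1_seminorm_def)
  have eq: "indicator ?K x * ennreal (norm (grad \<eta> x)) = ennreal ((?Y x \<bullet> norm (grad \<eta> x)) * \<rho> x)" for x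
    using \<rho>0[of x] by (auto simp: indicator_def)
  have "(\<integral>\<^sup>+x. indicator ?K x * ennreal (norm (grad \<eta> x)) \<partial>lborel) = ennreal (LINT x|lborel. (?Y x \<bullet> norm (grad \<eta> x)) * \<rho> x)"
    unfolding eq using CS(1) \<rho>_nonneg by (intro nn_integral_eq_integral) (auto simp: indicator_def)
  also have "\<dots> \<le> ennreal (sqrt (LINT x|lborel. (norm (?Y x))\<^sup>2 * \<rho> x) * H1_seminorm \<rho> \<eta>)"
    using CS(2) by (intro ennreal_leI) linarith
  finally show "(\<integral>\<^sup>+x. indicator ?K x * ennreal (norm (grad \<eta> x)) \<partial>lborel) \<le>
    ennreal (sqrt (LINT x|lborel. (norm (indicator ?K x / \<rho> x))\<^sup>2 * \<rho> x) * H1_seminorm \<rho> \<eta>)" .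
qed

lemma trunc_flux_tangent:
  assumes \<xi>: "C1 \<xi>" and R: "0 \<le> R"
  shows "trunc_flux R \<xi> \<in> tangent (H1 \<rho>) \<rho>"
proof -
  obtain c where c: "\<And>\<eta>. \<eta> \<in> H1 \<rho> \<Longrightarrow>
      (\<integral>\<^sup>+x. indicator (cball 0 R \<times> cball 0 R) x * ennreal (norm (grad \<eta> x)) \<partial>lborel) \<le> ennreal (c * H1_seminorm \<rho> \<eta>)"
    using integral_grad_cball_le[of R] by blast
  have "continuous_on (jump_box R) (\<lambda>z. weight z * sinh (jump \<xi> z))"
    by (intro continuous_intros continuous_on_sinh continuous_on_subset[OF continuous_weight]
      continuous_on_subset[OF continuous_jump] C1_continuous \<xi>) auto
  then have "bounded ((\<lambda>z. weight z * sinh (jump \<xi> z)) ` jump_box R)"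
    using compact_jump_box by (intro compact_imp_bounded compact_continuous_image)
  then obtain B where B: "0 < B" "\<And>z. z \<in> jump_box R \<Longrightarrow> \<bar>weight z * sinh (jump \<xi> z)\<bar> \<le> B"
    unfolding bounded_pos by auto
  let ?D = "2 * R * (2 ^ CARD('d) * measure lborel (cball (0::real^'d) R))"
  show ?thesis
  proof (rule tangentI)
    fix \<eta> \<zeta> a b assume "\<eta> \<in> H1 \<rho>" "\<zeta> \<in> H1 \<rho>"
    then have int: "integrable lborel (\<lambda>z. indicator (jump_box R) z *\<^sub>R (weight z * sinh (jump \<xi> z) * jump \<eta> z))"
      "integrable lborel (\<lambda>z. indicator (jump_box R) z *\<^sub>R (weight z * sinh (jump \<xi> z) * jump \<zeta> z))"
      by - (rule trunc_flux_integrable[OF \<xi> H1_C1], assumption)+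
    have "indicator (jump_box R) z *\<^sub>R (weight z * sinh (jump \<xi> z) * jump (\<lambda>x. a * \<eta> x + b * \<zeta> x) z) =
        a * (indicator (jump_box R) z *\<^sub>R (weight z * sinh (jump \<xi> z) * jump \<eta> z)) +
        b * (indicator (jump_box R) z *\<^sub>R (weight z * sinh (jump \<xi> z) * jump \<zeta> z))" for z
      by (simp add: jump_lincomb algebra_simps)
    then show "trunc_flux R \<xi> (\<lambda>x. a * \<eta> x + b * \<zeta> x) = a * trunc_flux R \<xi> \<eta> + b * trunc_flux R \<xi> \<zeta>"
      unfolding trunc_flux_def
      using integrable_mult_right[OF int(1), of a] integrable_mult_right[OF int(2), of b]
      by (simp only: Bochner_Integration.integral_add integral_mult_right_zero)
  next
    fix \<eta> assume \<eta>: "\<eta> \<in> H1 \<rho>"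
    note C1 = H1_C1[OF \<eta>]
    have seminorm: "0 \<le> H1_seminorm \<rho> \<eta>"
      unfolding H1_seminorm_def using \<rho>_nonneg by simp
    have "ennreal \<bar>trunc_flux R \<xi> \<eta>\<bar> \<le>
        (\<integral>\<^sup>+z. ennreal (norm (indicator (jump_box R) z *\<^sub>R (weight z * sinh (jump \<xi> z) * jump \<eta> z))) \<partial>lborel)"
      using integral_norm_bound_ennreal[OF trunc_flux_integrable[OF \<xi> C1]] by (simp add: trunc_flux_def)
    also have "\<dots> \<le> (\<integral>\<^sup>+z. ennreal B * (indicator (jump_box R) z * ennreal \<bar>jump \<eta> z\<bar>) \<partial>lborel)"
    proof (rule nn_integral_mono)
      fix z
      show "ennreal (norm (indicator (jump_box R) z *\<^sub>R (weight z * sinh (jump \<xi> z) * jump \<eta> z)))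
          \<le> ennreal B * (indicator (jump_box R) z * ennreal \<bar>jump \<eta> z\<bar>)"
      proof (cases "z \<in> jump_box R")
        case True
        then show ?thesis
          using mult_right_mono[OF B(2)[OF True], of "\<bar>jump \<eta> z\<bar>"] B(1)
          by (simp add: ennreal_mult[symmetric] abs_mult ennreal_leI)
      qed simp
    qed
    also have "\<dots> = ennreal B * (\<integral>\<^sup>+z. indicator (jump_box R) z * ennreal \<bar>jump \<eta> z\<bar> \<partial>lborel)"
      using borel_jump[OF C1] by (intro nn_integral_cmult) measurable
    also have "\<dots> \<le> ennreal B * (ennreal (2 * R) * (ennreal (2 ^ CARD('d)) * emeasure lborel (cball (0::real^'d) R)) *
        ennreal (c * H1_seminorm \<rho> \<eta>))"
      by (intro mult_left_mono order_trans[OF nn_integral_jump_le[OF C1]] c \<eta>) auto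
    \<comment> \<open>The sign of \<open>c\<close> is unknown, and products split under
      \<open>ennreal\<close> only for nonnegative factors.\<close>
    also have "\<dots> \<le> ennreal B * (ennreal (2 * R) * (ennreal (2 ^ CARD('d)) * emeasure lborel (cball (0::real^'d) R)) *
        ennreal (\<bar>c\<bar> * H1_seminorm \<rho> \<eta>))"
      using seminorm by (intro mult_left_mono ennreal_leI mult_right_mono) auto
    also have "\<dots> = ennreal (B * (?D * (\<bar>c\<bar> * H1_seminorm \<rho> \<eta>)))"
    proof -
      have "emeasure lborel (cball (0::real^'d) R) = ennreal (measure lborel (cball (0::real^'d) R))"
        by (rule emeasure_eq_ennreal_measure) (use emeasure_lborel_cball_finite[of "0::real^'d" R] in simp)
      then show ?thesis using B(1) R seminorm by (simp add: ennreal_mult mult.assoc)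
    qed
    finally show "\<bar>trunc_flux R \<xi> \<eta>\<bar> \<le> (B * (?D * \<bar>c\<bar>)) * H1_seminorm \<rho> \<eta>"
      using B(1) R seminorm by (subst (asm) ennreal_le_iff) (auto simp: mult.assoc)
  qed
qed

text \<open>Inside the box the tangent inequality at \<open>jump \<xi> z\<close> applies; outside it
  the flux vanishes and a competitor only pays nonnegative cost. Hence the Legendre transform is at
  most the pairing with \<open>\<xi>\<close> minus the truncated cost.\<close>

lemma trunc_flux_duality:
  assumes \<xi>: "\<xi> \<in> C"
  shows "enn2ereal (\<integral>\<^sup>+z. ennreal (indicator (jump_box R) z *\<^sub>R cost \<xi> z) \<partial>lborel) \<le>
    ereal (trunc_flux R \<xi> \<xi>) - legendre (cotangent (andersen_dom m)) (andersen_Psi_star m \<gamma>) \<rho> (trunc_flux R \<xi>)"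
proof -
  note C1 = C_C1[OF \<xi>]
  have cost_int: "integrable lborel (\<lambda>z. indicator (jump_box R) z *\<^sub>R cost \<xi> z)"
    unfolding cost_def
    by (intro borel_integrable_compact compact_jump_box continuous_intros continuous_on_cosh
      continuous_on_subset[OF continuous_weight] continuous_on_subset[OF continuous_jump] C1_continuous C1) auto
  let ?I = "LINT z|lborel. indicator (jump_box R) z *\<^sub>R cost \<xi> z"
  have "legendre (cotangent (andersen_dom m)) (andersen_Psi_star m \<gamma>) \<rho> (trunc_flux R \<xi>) \<le> ereal (trunc_flux R \<xi> \<xi> - ?I)"
    unfolding legendre_def
  proof (rule SUP_least)
    fix \<eta> assume \<eta>: "\<eta> \<in> C"
    show "ereal (trunc_flux R \<xi> \<eta>) - \<Psi>s \<eta> \<le> ereal (trunc_flux R \<xi> \<xi> - ?I)"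
    proof (cases rule: Psi_star_cases[OF C_C1[OF \<eta>]])
      case 2
      note int = trunc_flux_integrable[OF C1 C_C1[OF \<eta>], of R] trunc_flux_integrable[OF C1 C1, of R] cost_int 2(1)
      have "(LINT z|lborel. indicator (jump_box R) z *\<^sub>R (weight z * sinh (jump \<xi> z) * jump \<eta> z) - cost \<eta> z) \<le>
        (LINT z|lborel. indicator (jump_box R) z *\<^sub>R (weight z * sinh (jump \<xi> z) * jump \<xi> z) - indicator (jump_box R) z *\<^sub>R cost \<xi> z)"
      proof (rule integral_mono)
        fix z
        show "indicator (jump_box R) z *\<^sub>R (weight z * sinh (jump \<xi> z) * jump \<eta> z) - cost \<eta> z \<le>
          indicator (jump_box R) z *\<^sub>R (weight z * sinh (jump \<xi> z) * jump \<xi> z) - indicator (jump_box R) z *\<^sub>R cost \<xi> z"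
          using mult_left_mono[OF cosh_tangent_le[of "jump \<xi> z" "jump \<eta> z"] weight_nonneg[of z]] cost_nonneg[of \<eta> z]
          by (cases "z \<in> jump_box R") (simp_all add: cost_def algebra_simps)
      qed (intro Bochner_Integration.integrable_diff int)+
      then show ?thesis
        using int by (simp only: 2(2) trunc_flux_def Bochner_Integration.integral_diff ereal_minus ereal_less_eq)
    qed simp
  qed
  then have "ereal (trunc_flux R \<xi> \<xi>) - ereal (trunc_flux R \<xi> \<xi> - ?I) \<le>
      ereal (trunc_flux R \<xi> \<xi>) - legendre (cotangent (andersen_dom m)) (andersen_Psi_star m \<gamma>) \<rho> (trunc_flux R \<xi>)"
    by (intro ereal_minus_mono) auto
  moreover have "(\<integral>\<^sup>+z. ennreal (indicator (jump_box R) z *\<^sub>R cost \<xi> z) \<partial>lborel) = ennreal ?I"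
    using cost_int cost_nonneg by (intro nn_integral_eq_integral) auto
  moreover have "0 \<le> ?I" using cost_nonneg by simp
  ultimately show ?thesis by simp
qed

text \<open>The boxes exhaust the space, so the truncated costs increase to the full one and
  monotone convergence gives the bound, also when the potential is infinite.\<close>

lemma Psi_star_le_bidual:
  assumes \<xi>: "\<xi> \<in> C"
  shows "\<Psi>s \<xi> \<le> (SUP v\<in>tangent C \<rho>. ereal (v \<xi>) -
    legendre (cotangent (andersen_dom m)) (andersen_Psi_star m \<gamma>) \<rho> v)" (is "_ \<le> ?Y")
proof -
  let ?f = "\<lambda>n z. ennreal (indicator (jump_box (real n)) z *\<^sub>R cost \<xi> z)"
  have le: "enn2ereal (\<integral>\<^sup>+z. ?f n z \<partial>lborel) \<le> ?Y" for n
  proof (rule SUP_upper2)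
    show "trunc_flux (real n) \<xi> \<in> tangent C \<rho>"
      using trunc_flux_tangent[OF C_C1[OF \<xi>], of "real n"] tangent_mono[OF cotangent_subset_H1] by auto
  qed (rule trunc_flux_duality[OF \<xi>])
  \<comment> \<open>Nonnegativity makes the passage from \<open>ereal\<close> to
    \<open>ennreal\<close> and back lossless.\<close>
  have Y: "0 \<le> ?Y" using order_trans[OF enn2ereal_nonneg le[of 0]] .
  have "(\<integral>\<^sup>+z. ?f n z \<partial>lborel) \<le> e2ennreal ?Y" for n
    using e2ennreal_mono[OF le[of n]] by simp
  moreover have "(\<integral>\<^sup>+z. ennreal (cost \<xi> z) \<partial>lborel) = (SUP n. \<integral>\<^sup>+z. ?f n z \<partial>lborel)"
  proof -
    have inc: "incseq ?f"
    proof (intro incseq_SucI le_funI ennreal_leI)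
      fix n z
      show "indicator (jump_box (real n)) z *\<^sub>R cost \<xi> z \<le> indicator (jump_box (real (Suc n))) z *\<^sub>R cost \<xi> z"
        using cost_nonneg[of \<xi> z] by (auto simp: indicator_def jump_box_def)
    qed
    have "(SUP n. ?f n z) = ennreal (cost \<xi> z)" for z
    proof (rule antisym)
      show "(SUP n. ?f n z) \<le> ennreal (cost \<xi> z)"
        using cost_nonneg[of \<xi> z] by (intro SUP_least ennreal_leI) (auto simp: indicator_def)
      obtain n where "norm z \<le> real n" using real_arch_simple by blast
      then have "norm (fst (fst z)) \<le> real n" "norm (snd (fst z)) \<le> real n" "norm (snd z) \<le> real n"
        using norm_fst_le_norm[of z] norm_snd_le_norm[of z] norm_fst_le_norm[of "fst z"] norm_snd_le_norm[of "fst z"]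
        by linarith+
      then have "z \<in> jump_box (real n)" by (cases z) (auto simp: jump_box_def mem_Times_iff)
      then show "ennreal (cost \<xi> z) \<le> (SUP n. ?f n z)" by (intro SUP_upper2[of n]) auto
    qed
    then have "(\<integral>\<^sup>+z. ennreal (cost \<xi> z) \<partial>lborel) = (\<integral>\<^sup>+z. (SUP n. ?f n z) \<partial>lborel)" by simp
    also have "\<dots> = (SUP n. \<integral>\<^sup>+z. ?f n z \<partial>lborel)"
      using borel_cost[OF C_C1[OF \<xi>]] by (intro nn_integral_monotone_convergence_SUP inc) measurable
    finally show ?thesis .
  qed
  ultimately have "(\<integral>\<^sup>+z. ennreal (cost \<xi> z) \<partial>lborel) \<le> e2ennreal ?Y"
    by (simp add: SUP_least)
  then have "\<Psi>s \<xi> \<le> enn2ereal (e2ennreal ?Y)"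
    by (simp add: Psi_star_eq[OF C_C1[OF \<xi>]] less_eq_ennreal.rep_eq)
  then show ?thesis using Y by (simp add: enn2ereal_e2ennreal)
qed

end

theorem andersen_pre_GENERIC:
  fixes m \<gamma> :: real and V \<Phi> :: "real^'d::finite \<Rightarrow> real"
  assumes \<gamma>: "\<gamma> > 0" and M: "\<And>\<rho>. \<rho> \<in> M \<Longrightarrow> regular_state m V \<Phi> \<rho>"
    and dS: "\<And>\<rho>. \<rho> \<in> M \<Longrightarrow> d_entropy m V \<Phi> \<rho> \<in> cotangent (andersen_dom m) \<rho>"
    and G: "\<And>\<rho>. \<rho> \<in> M \<Longrightarrow> adjoint_gen (andersen_gen m \<gamma>) \<rho> \<in> tangent (cotangent (andersen_dom m) \<rho>) \<rho>"
  defines "C \<equiv> cotangent (andersen_dom m)"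
  shows "pre_GENERIC M C (evolution (andersen_gen m \<gamma>) m V \<Phi>) (entropy m V \<Phi>) (d_entropy m V \<Phi>)
    (\<lambda>\<rho>. L \<rho> (d_energy m V \<Phi> \<rho>)) (legendre C (andersen_Psi_star m \<gamma>)) (andersen_Psi_star m \<gamma>)"
proof (rule pre_GENERIC_legendreI)
  fix \<rho> assume mem: "\<rho> \<in> M"
  show "regular_state m V \<Phi> \<rho>" using mem by (rule M)
  then interpret andersen_state m V \<Phi> \<rho> \<gamma>
    using \<gamma> by (simp add: andersen_state_def andersen_state_axioms_def)
  show "C \<rho> \<subseteq> H1 \<rho>" unfolding C_def by (rule cotangent_subset_H1)
  show dS: "dS \<in> C \<rho>" and "adjoint_gen (andersen_gen m \<gamma>) \<rho> \<in> tangent (C \<rho>) \<rho>"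
    using assms(3,4)[OF mem] by (simp_all add: C_def)
  have scale: "(\<lambda>x. c * \<xi> x) \<in> C \<rho>" if "\<xi> \<in> C \<rho>" for \<xi> c
    using that unfolding C_def by (rule andersen_cotangent_scale)
  have a: "(\<lambda>x. - (1/2) * dS x) \<in> cotangent (andersen_dom m) \<rho>"
    using scale[OF dS, of "- (1/2)"] unfolding C_def .
  show "\<exists>s. andersen_Psi_star m \<gamma> \<rho> (\<lambda>x. - (1/2) * dS x) = ereal s"
    using Psi_star_of_integrable[OF C_C1[OF a] Psi_star_affinity[OF a]] by blast
  show "andersen_Psi_star m \<gamma> \<rho> (\<lambda>_. 0) = 0"
    by (simp add: andersen_Psi_star_def zero_ennreal.rep_eq)
  fix \<xi> assume "\<xi> \<in> C \<rho>"
  then have \<xi>: "\<xi> \<in> cotangent (andersen_dom m) \<rho>" by (simp add: C_def)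
  show "(\<lambda>x. c * \<xi> x) \<in> C \<rho>" for c using \<open>\<xi> \<in> C \<rho>\<close> by (rule scale)
  show "0 \<le> andersen_Psi_star m \<gamma> \<rho> \<xi>" by (simp add: andersen_Psi_star_def)
  show "andersen_Psi_star m \<gamma> \<rho> (\<lambda>x. - \<xi> x) = andersen_Psi_star m \<gamma> \<rho> \<xi>"
    by (rule Psi_star_even[OF C_C1[OF \<xi>]])
  show "andersen_Psi_star m \<gamma> \<rho> (\<lambda>x. (1 - t) * \<xi> x + t * \<eta> x)
      \<le> ereal (1 - t) * andersen_Psi_star m \<gamma> \<rho> \<xi> + ereal t * andersen_Psi_star m \<gamma> \<rho> \<eta>"
    if "\<eta> \<in> C \<rho>" "t \<in> {0..1}" for \<eta> t
    using that \<xi> by (intro Psi_star_convex C_C1) (simp_all add: C_def)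
  show "andersen_Psi_star m \<gamma> \<rho> \<xi> \<le> (SUP v\<in>tangent (C \<rho>) \<rho>. ereal (v \<xi>) - legendre C (andersen_Psi_star m \<gamma>) \<rho> v)"
    unfolding C_def by (rule Psi_star_le_bidual[OF \<xi>])
  show "ereal (adjoint_gen (andersen_gen m \<gamma>) \<rho> \<xi>) - andersen_Psi_star m \<gamma> \<rho> \<xi> \<le>
       ereal (adjoint_gen (andersen_gen m \<gamma>) \<rho> (\<lambda>x. - (1/2) * dS x)) - andersen_Psi_star m \<gamma> \<rho> (\<lambda>x. - (1/2) * dS x)"
    by (rule adjoint_optimal[OF a \<xi>])
qed

text \<open>The first conjunct certifies that the function generating \<open>W\<close> is the
  differential of the energy; for the entropy the corresponding statement is part of
  \<open>pre_GENERIC\<close>.\<close>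

theorem theorem5p1:
  fixes m \<gamma> :: real and V \<Phi> :: "real^'d::finite \<Rightarrow> real"
  assumes "m > 0" and "\<gamma> > 0"
    and "C1 V" and "C1 \<Phi>" and "\<And>q. \<Phi> (- q) = \<Phi> q"
  defines "E \<equiv> energy m V \<Phi>" and "dE \<equiv> d_energy m V \<Phi>"
    and "S \<equiv> entropy m V \<Phi>" and "dS \<equiv> d_entropy m V \<Phi>"
    and "W \<equiv> (\<lambda>\<rho>. L \<rho> (d_energy m V \<Phi> \<rho>))"
    and "M_A \<equiv> regular_states (andersen_gen m \<gamma>) (andersen_dom m) m V \<Phi>"
    and "C_A \<equiv> cotangent (andersen_dom m)"
    and "M_V \<equiv> regular_states (vfp_gen m \<gamma>) (vfp_dom m \<gamma>) m V \<Phi>"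
    and "C_V \<equiv> cotangent (vfp_dom m \<gamma>)"
  shows "(\<forall>\<rho>\<in>M_A \<union> M_V. has_functional_derivative E (dE \<rho>) \<rho>)
    \<and> pre_GENERIC M_A C_A (evolution (andersen_gen m \<gamma>) m V \<Phi>) S dS W
        (legendre C_A (andersen_Psi_star m \<gamma>)) (andersen_Psi_star m \<gamma>)
    \<and> pre_GENERIC M_V C_V (evolution (vfp_gen m \<gamma>) m V \<Phi>) S dS W
        (legendre C_V (vfp_Psi_star \<gamma>)) (vfp_Psi_star \<gamma>)"
proof (intro conjI ballI)
  note regular = regular_statesD[OF assms(1,3,4,5)]
  show "has_functional_derivative E (dE \<rho>) \<rho>" if "\<rho> \<in> M_A \<union> M_V" for \<rho>
  proof -
    have "regular_state m V \<Phi> \<rho>" using that regular unfolding M_A_def M_V_def by blast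
    then show ?thesis unfolding E_def dE_def by (rule regular_state.energy_functional_derivative)
  qed
  show "pre_GENERIC M_A C_A (evolution (andersen_gen m \<gamma>) m V \<Phi>) S dS W
        (legendre C_A (andersen_Psi_star m \<gamma>)) (andersen_Psi_star m \<gamma>)"
    unfolding S_def dS_def W_def C_A_def
    by (rule andersen_pre_GENERIC[OF assms(2)]) (auto simp: M_A_def regular regular_states_def)
  show "pre_GENERIC M_V C_V (evolution (vfp_gen m \<gamma>) m V \<Phi>) S dS W
        (legendre C_V (vfp_Psi_star \<gamma>)) (vfp_Psi_star \<gamma>)"
    unfolding S_def dS_def W_def C_V_def
    by (rule vfp_pre_GENERIC[OF assms(2)]) (auto simp: M_V_def regular regular_states_def)
qed

end
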